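(* Let $k$ be a finitely generated field, and let $V\subset\mathbb P^3$ be a smooth cubic surface over $k$ admitting a birational morphism $p:V\to\mathbb P^2$ defined over $k$; fix $p$. Then the complement in $V(k)$ to the lines blown down by $p$ is finitely generated with respect to the operations $\circ_{(C,p)}$, with the additional restriction that the operation $x\circ_{(C,p)}y$ is applied only to different previously constructed points $x\ne y$.
   Context: For a cubic hypersurface $W$ (e.g. a plane cubic curve) without multiple components over $k$, points $x,y,z\in W(k)$ (possibly coinciding) are collinear if either $x+y+z$ is the intersection cycle of $W$ with a line (with correct multiplicities) or $x,y,z$ lie on a $k$-line contained in $W$; then one writes $z=x\circ y$, a partial and multivalued composition law. Let $C$ be a plane section of $V$ defined over $k$ and not containing any of the lines blown down by $p$ as a component. Then $p$ embeds $C$ into $\mathbb P^2$ as a cubic curve $p(C)$. For $x,y\in C(k)$ such that $p(x)\circ p(y)$ is defined on $p(C)$, put $x\circ_{(C,p)}y:=p^{-1}(p(x)\circ p(y))$, where $p^{-1}$ is the inverse of $p:C\to p(C)$ and $\circ$ is computed on the plane cubic $p(C)$. "Finitely generated" means: there is a finite subset from which every point of the set in question can be obtained by iteratively applying operations $\circ_{(C,p)}$ (with $C$ varying over the plane sections of $V$ defined over $k$, not containing any of the lines blown down by $p$ as a component, and passing through the two points) to previously constructed points and adding the results. *)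

theory Defs
  imports
    "HOL-Analysis.Finite_Cartesian_Product"
    "HOL-Library.Poly_Mapping"
    "HOL-Library.Multiset"
    "HOL-Library.Numeral_Type"
    "HOL-Computational_Algebra.Squarefree"
    "HOL-Algebra.Algebraic_Closure_Type"
    "HOL-Algebra.Generated_Fields"
begin

text \<open>Varieties over a field \<open>'k\<close> are given by polynomials with coefficients in \<open>'k\<close>
  and are identified with their sets of points over the algebraic closure \<open>'k alg_closure\<close>.\<close>

definition finitely_generated_field :: "'k::field itself \<Rightarrow> bool" where
  "finitely_generated_field _ \<longleftrightarrow>
     (\<exists>S::'k set. finite S \<and> generate_field ring_of_type_algebra S = UNIV)"


section \<open>Polynomials in variables indexed by a type\<close>

type_synonym ('a, 'n) mpoly = "('n \<Rightarrow>\<^sub>0 nat) \<Rightarrow>\<^sub>0 'a"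

definition mp_eval :: "('a::zero \<Rightarrow> 'b::comm_ring_1) \<Rightarrow> ('a, 'n::finite) mpoly \<Rightarrow> 'b ^ 'n \<Rightarrow> 'b" where
  "mp_eval \<phi> F v = (\<Sum>m\<in>Poly_Mapping.keys F.
      \<phi> (Poly_Mapping.lookup F m) * (\<Prod>i\<in>UNIV. v $ i ^ Poly_Mapping.lookup m i))"

definition homogeneous :: "nat \<Rightarrow> ('a::zero, 'n::finite) mpoly \<Rightarrow> bool" where
  "homogeneous d F \<longleftrightarrow> (\<forall>m\<in>Poly_Mapping.keys F. (\<Sum>i\<in>UNIV. Poly_Mapping.lookup m i) = d)"

definition mp_pderiv :: "'n \<Rightarrow> ('a::comm_ring_1, 'n) mpoly \<Rightarrow> ('a, 'n) mpoly" where
  "mp_pderiv i F = (\<Sum>m\<in>Poly_Mapping.keys F.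
      Poly_Mapping.single (m - Poly_Mapping.single i 1)
        (of_nat (Poly_Mapping.lookup m i) * Poly_Mapping.lookup F m))"


section \<open>Projective space\<close>

definition proj_rel :: "'a::field ^ 'n::finite \<Rightarrow> 'a ^ 'n \<Rightarrow> bool" where
  "proj_rel v w \<longleftrightarrow> v \<noteq> 0 \<and> w \<noteq> 0 \<and> (\<exists>c. c \<noteq> 0 \<and> w = c *s v)"

text \<open>The projective space with homogeneous coordinates indexed by \<open>'n\<close>;
  its dimension is \<open>CARD('n) - 1\<close>.\<close>

quotient_type (overloaded) ('a, 'n) proj = "'a::field ^ 'n::finite" / partial: proj_rel
proof (rule part_equivpI)
  show "\<exists>x::'a ^ 'n. proj_rel x x"
    by (rule exI[of _ "\<chi> i. 1"], unfold proj_rel_def, intro conjI exI[of _ 1])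
       (auto simp: vec_eq_iff vector_scalar_mult_def)
  show "symp (proj_rel :: 'a ^ 'n \<Rightarrow> 'a ^ 'n \<Rightarrow> bool)"
  proof (rule sympI)
    fix v w :: "'a ^ 'n"
    assume "proj_rel v w"
    then obtain c where "v \<noteq> 0" "w \<noteq> 0" "c \<noteq> 0" "w = c *s v"
      by (auto simp: proj_rel_def)
    then show "proj_rel w v"
      unfolding proj_rel_def
      by (intro conjI exI[of _ "inverse c"]) (auto simp: vec_eq_iff vector_scalar_mult_def)
  qed
  show "transp (proj_rel :: 'a ^ 'n \<Rightarrow> 'a ^ 'n \<Rightarrow> bool)"
  proof (rule transpI)
    fix u v w :: "'a ^ 'n"
    assume "proj_rel u v" "proj_rel v w"
    then obtain c d where "u \<noteq> 0" "w \<noteq> 0" "c \<noteq> 0" "d \<noteq> 0" "v = c *s u" "w = d *s v"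
      by (auto simp: proj_rel_def)
    then show "proj_rel u w"
      unfolding proj_rel_def
      by (intro conjI exI[of _ "d * c"]) (auto simp: vec_eq_iff vector_scalar_mult_def mult.assoc)
  qed
qed

text \<open>The geometric points of projective space over \<open>'k\<close>.\<close>

type_synonym ('k, 'n) gpt = "('k alg_closure, 'n) proj"

definition rational :: "('k::field, 'n::finite) gpt \<Rightarrow> bool" where
  "rational P \<longleftrightarrow> (\<exists>v::'k ^ 'n. v \<noteq> 0 \<and> P = abs_proj (\<chi> i. to_ac (v $ i)))"

text \<open>The value at a chosen representative of the point; for homogeneous polynomials its
  (non-)vanishing does not depend on the representative.\<close>

definition value_at :: "('k::field, 'n::finite) mpoly \<Rightarrow> ('k, 'n) gpt \<Rightarrow> 'k alg_closure" where
  "value_at F P = mp_eval to_ac F (rep_proj P)"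

definition zeros :: "('k::field, 'n::finite) mpoly \<Rightarrow> ('k, 'n) gpt set" where
  "zeros F = {P. value_at F P = 0}"

definition line_through :: "('a::field, 'n::finite) proj \<Rightarrow> ('a, 'n) proj \<Rightarrow> ('a, 'n) proj set" where
  "line_through P Q = {R. \<exists>s t. rep_proj R = s *s rep_proj P + t *s rep_proj Q}"

definition is_line :: "('a::field, 'n::finite) proj set \<Rightarrow> bool" where
  "is_line l \<longleftrightarrow> (\<exists>P Q. P \<noteq> Q \<and> l = line_through P Q)"

definition is_rational_line :: "('k::field, 'n::finite) gpt set \<Rightarrow> bool" where
  "is_rational_line l \<longleftrightarrow> (\<exists>P Q. rational P \<and> rational Q \<and> P \<noteq> Q \<and> l = line_through P Q)"


section \<open>Morphisms and birational morphisms over the base field\<close>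

definition zariski_open_in :: "('k::field, 'n::finite) gpt set \<Rightarrow> ('k, 'n) gpt set \<Rightarrow> bool" where
  "zariski_open_in M U \<longleftrightarrow>
     (\<exists>S::('k, 'n) mpoly set. (\<forall>g\<in>S. \<exists>d. homogeneous d g) \<and>
        U = {P \<in> M. \<exists>g\<in>S. value_at g P \<noteq> 0})"

text \<open>Every point of the (locally closed) set \<open>M\<close> has an open neighbourhood, here the
  complement of the zeros of \<open>h\<close>, on which \<open>f\<close> is given by forms \<open>g i\<close> of one degree
  without common zeros; all these forms have coefficients in \<open>'k\<close>.\<close>

definition regular_map ::
  "('k::field, 'm::finite) gpt set \<Rightarrow> (('k, 'm) gpt \<Rightarrow> ('k, 'n::finite) gpt) \<Rightarrow> bool" where
  "regular_map M f \<longleftrightarrow>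
     (\<forall>P\<in>M. \<exists>(h::('k, 'm) mpoly) e (g::'n \<Rightarrow> ('k, 'm) mpoly) d.
        homogeneous e h \<and> value_at h P \<noteq> 0 \<and> (\<forall>i. homogeneous d (g i)) \<and>
        (\<forall>Q\<in>M. value_at h Q \<noteq> 0 \<longrightarrow>
           (\<exists>i. value_at (g i) Q \<noteq> 0) \<and> f Q = abs_proj (\<chi> i. value_at (g i) Q)))"

definition birational_morphism ::
  "('k::field, 'm::finite) gpt set \<Rightarrow> ('k, 'n::finite) gpt set \<Rightarrow>
     (('k, 'm) gpt \<Rightarrow> ('k, 'n) gpt) \<Rightarrow> bool" where
  "birational_morphism M N p \<longleftrightarrow>
     regular_map M p \<and> p ` M \<subseteq> N \<and>
     (\<exists>U W. zariski_open_in M U \<and> U \<noteq> {} \<and> zariski_open_in N W \<and> W \<noteq> {} \<and>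
        bij_betw p U W \<and> regular_map W (the_inv_into U p))"

definition smooth_cubic_surface :: "('k::field, 4) mpoly \<Rightarrow> bool" where
  "smooth_cubic_surface F \<longleftrightarrow> F \<noteq> 0 \<and> homogeneous 3 F \<and>
     (\<forall>P. \<not> (value_at F P = 0 \<and> (\<forall>i. value_at (mp_pderiv i F) P = 0)))"


section \<open>Collinearity on a plane cubic curve\<close>

text \<open>No multiple components over the algebraic closure.\<close>

definition plane_cubic :: "('k::field, 3) mpoly \<Rightarrow> bool" where
  "plane_cubic G \<longleftrightarrow> G \<noteq> 0 \<and> homogeneous 3 G \<and> squarefree (Poly_Mapping.map to_ac G)"

text \<open>The restriction of \<open>G\<close> to the line through \<open>P\<close> and \<open>Q\<close>, in the affine coordinate
  \<open>t\<close> of \<open>P + t Q\<close>.\<close>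

definition restrict_to_line ::
  "('k::field, 'n::finite) mpoly \<Rightarrow> ('k, 'n) gpt \<Rightarrow> ('k, 'n) gpt \<Rightarrow> 'k alg_closure poly" where
  "restrict_to_line G P Q =
     mp_eval (\<lambda>c. [:to_ac c:]) G (\<chi> i. [:rep_proj P $ i, rep_proj Q $ i:])"

text \<open>The order of vanishing at \<open>P\<close> of the restriction of \<open>G\<close> to a line \<open>l\<close> not contained in
  the curve; it does not depend on the second point chosen on \<open>l\<close>.\<close>

definition intersection_mult ::
  "('k::field, 'n::finite) mpoly \<Rightarrow> ('k, 'n) gpt set \<Rightarrow> ('k, 'n) gpt \<Rightarrow> nat" where
  "intersection_mult G l P =
     (if P \<in> l then Polynomial.order 0 (restrict_to_line G P (SOME Q. Q \<in> l \<and> Q \<noteq> P)) else 0)"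

text \<open>Effective zero-cycles are multisets of points.\<close>

definition is_intersection_cycle ::
  "('k::field, 'n::finite) mpoly \<Rightarrow> ('k, 'n) gpt set \<Rightarrow> ('k, 'n) gpt multiset \<Rightarrow> bool" where
  "is_intersection_cycle G l Z \<longleftrightarrow>
     is_line l \<and> \<not> l \<subseteq> zeros G \<and> (\<forall>P. count Z P = intersection_mult G l P)"

definition rational_points :: "('k::field, 'n::finite) gpt set \<Rightarrow> ('k, 'n) gpt set" where
  "rational_points M = {P \<in> M. rational P}"

definition collinear_on ::
  "('k::field, 3) mpoly \<Rightarrow> ('k, 3) gpt \<Rightarrow> ('k, 3) gpt \<Rightarrow> ('k, 3) gpt \<Rightarrow> bool" where
  "collinear_on G x y z \<longleftrightarrow>
     {x, y, z} \<subseteq> rational_points (zeros G) \<and>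
     ((\<exists>l. is_intersection_cycle G l {#x, y, z#}) \<or>
      (\<exists>l. is_rational_line l \<and> l \<subseteq> zeros G \<and> {x, y, z} \<subseteq> l))"

text \<open>The set of all values of the multivalued partial law.\<close>

definition cubic_comp :: "('k::field, 3) mpoly \<Rightarrow> ('k, 3) gpt \<Rightarrow> ('k, 3) gpt \<Rightarrow> ('k, 3) gpt set" where
  "cubic_comp G x y = {z. collinear_on G x y z}"


section \<open>Composition along plane sections of a cubic surface\<close>

definition blown_down_lines ::
  "('k::field, 4) gpt set \<Rightarrow> (('k, 4) gpt \<Rightarrow> ('k, 3) gpt) \<Rightarrow> ('k, 4) gpt set set" where
  "blown_down_lines V p = {l. is_line l \<and> l \<subseteq> V \<and> (\<exists>q. p ` l = {q})}"

definition admissible_section ::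
  "('k::field, 4) gpt set \<Rightarrow> (('k, 4) gpt \<Rightarrow> ('k, 3) gpt) \<Rightarrow> ('k, 4) gpt set \<Rightarrow> bool" where
  "admissible_section V p C \<longleftrightarrow>
     (\<exists>H::('k, 4) mpoly. H \<noteq> 0 \<and> homogeneous 1 H \<and> C = V \<inter> zeros H) \<and>
     (\<forall>l\<in>blown_down_lines V p. \<not> l \<subseteq> C)"

text \<open>The values of \<open>x \<circ>\<^bsub>(C,p)\<^esub> y\<close>. Plane sections of a smooth cubic surface are
  geometrically reduced, so the cubic curve \<open>p(C)\<close> is the plane cubic \<open>G\<close> without multiple
  components whose set of points is \<open>p ` C\<close>; this determines \<open>G\<close> up to a constant factor.\<close>

definition section_comp ::
  "(('k::field, 4) gpt \<Rightarrow> ('k, 3) gpt) \<Rightarrow> ('k, 4) gpt set \<Rightarrow>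
     ('k, 4) gpt \<Rightarrow> ('k, 4) gpt \<Rightarrow> ('k, 4) gpt set" where
  "section_comp p C x y =
     {the_inv_into C p w | w. \<exists>G. plane_cubic G \<and> zeros G = p ` C \<and> w \<in> cubic_comp G (p x) (p y)}"

inductive_set generated_points ::
  "('k::field, 4) gpt set \<Rightarrow> (('k, 4) gpt \<Rightarrow> ('k, 3) gpt) \<Rightarrow> ('k, 4) gpt set \<Rightarrow> ('k, 4) gpt set"
  for V p B where
    base: "x \<in> B \<Longrightarrow> x \<in> generated_points V p B"
  | comp: "\<lbrakk>x \<in> generated_points V p B; y \<in> generated_points V p B; x \<noteq> y;
            admissible_section V p C; x \<in> rational_points C; y \<in> rational_points C;
            z \<in> section_comp p C x y\<rbrakk> \<Longrightarrow> z \<in> generated_points V p B"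

text \<open>Only points of \<open>S\<close> may serve as generators, but, the operations being defined on all
  rational points of a plane section, intermediate results need not lie in \<open>S\<close>.\<close>

definition finitely_generated_points ::
  "('k::field, 4) gpt set \<Rightarrow> (('k, 4) gpt \<Rightarrow> ('k, 3) gpt) \<Rightarrow> ('k, 4) gpt set \<Rightarrow> bool" where
  "finitely_generated_points V p S \<longleftrightarrow> (\<exists>B. finite B \<and> B \<subseteq> S \<and> S \<subseteq> generated_points V p B)"

end

(*
Over the algebraic closure let Q be a representation of least degree of the inverse of p by four
ternary forms. It has finitely many base points, the differential of Q at a base point w is injective
modulo w, and p contracts its image, a line, to w. Comparing Q x and the derivatives of Q at x with the
tangent plane of V at Q x shows that Q is cubic, so that plane sections of V correspond to plane cubics
h o Q = 0. Along a line l of the plane that avoids the base points the four cubics are independent, i.e.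
Q(l) is a twisted cubic. For three rational points z, y, x of l, the plane through Q z, Q y, Q x therefore
cuts out a cubic that meets l in the cycle z + y + x; it has no multiple component and, for generic z
and y, the plane contains no contracted line. So Q x is a composition of Q z and Q y.

If k is finite, V(k) is finite. If k is infinite, the images of a generic triangle a, b, c generate:
they give all rational points of the sides ab and ac, and a point z off these sides lies on a
suitable line joining a point x of ab with a point of ac.
*)
theory Submission
  imports Defs "HOL-Analysis.Cartesian_Space"
begin

unbundle no Formal_Power_Series.fps_syntax

section \<open>Evaluation of polynomials\<close>

text \<open>The identity relating \<open>cross4 (Q x) (DQ x u) (DQ x v)\<close> to
  \<open>det3 x u v\<close> times the gradient at \<open>Q x\<close> is the adjunction formula in
  coordinates: it compares the area form of the plane with the residue form of a cubic surface. The
  factor between them has no zeros on a line off the base points, because \<open>p\<close> is a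
  regular left inverse of \<open>Q\<close> and the surface is smooth; so it is constant, and degrees
  give 3 d - 2 = 2 d + 1. Read along a line through a base point, the same identity shows that the
  differential of \<open>Q\<close> there is as injective as it can be; this replaces the structure
  theory of blow-ups.

  The characteristic is arbitrary and the base field may be imperfect. Derivatives are therefore
  coefficients along lines, no step divides by 2 or 3, and the inverse map descends to the base
  field through linear functionals, not through Galois invariants.

  The side conditions on a pair of points are nonvanishing statements about finitely many
  polynomials, so rational points over an infinite field can satisfy them.\<close>

definition ring_hom_on :: "('a::comm_ring_1 \<Rightarrow> 'b::comm_ring_1) \<Rightarrow> bool" where
  "ring_hom_on \<phi> \<longleftrightarrow> \<phi> 0 = 0 \<and> \<phi> 1 = 1 \<and> (\<forall>x y. \<phi> (x + y) = \<phi> x + \<phi> y) \<and> (\<forall>x y. \<phi> (x * y) = \<phi> x * \<phi> y)"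

lemma ring_hom_onD:
  assumes "ring_hom_on \<phi>"
  shows "\<phi> 0 = 0" "\<phi> 1 = 1" "\<phi> (x + y) = \<phi> x + \<phi> y" "\<phi> (x * y) = \<phi> x * \<phi> y"
  using assms by (auto simp: ring_hom_on_def)

lemma ring_hom_on_sum: "ring_hom_on \<phi> \<Longrightarrow> \<phi> (sum f A) = (\<Sum>x\<in>A. \<phi> (f x))"
  by (induction A rule: infinite_finite_induct) (auto simp: ring_hom_on_def)

lemma ring_hom_on_prod: "ring_hom_on \<phi> \<Longrightarrow> \<phi> (prod f A) = (\<Prod>x\<in>A. \<phi> (f x))"
  by (induction A rule: infinite_finite_induct) (auto simp: ring_hom_on_def)

lemma ring_hom_on_power: "ring_hom_on \<phi> \<Longrightarrow> \<phi> (x ^ n) = \<phi> x ^ n"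
  by (induction n) (auto simp: ring_hom_on_def)

lemma ring_hom_on_id: "ring_hom_on (\<lambda>x. x)"
  by (simp add: ring_hom_on_def)

lemma ring_hom_on_to_ac: "ring_hom_on to_ac"
  by (simp add: ring_hom_on_def)

lemma ring_hom_on_const_poly: "ring_hom_on (\<lambda>c. [:c:])"
  by (simp add: ring_hom_on_def one_pCons)

lemma ring_hom_on_poly: "ring_hom_on (\<lambda>p. poly p t)"
  by (simp add: ring_hom_on_def)

definition monom_eval :: "'b::comm_ring_1 ^ 'n::finite \<Rightarrow> ('n \<Rightarrow>\<^sub>0 nat) \<Rightarrow> 'b" where
  "monom_eval v m = (\<Prod>i\<in>UNIV. v $ i ^ Poly_Mapping.lookup m i)"

lemma monom_eval_0 [simp]: "monom_eval v 0 = 1"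
  by (simp add: monom_eval_def)

lemma monom_eval_add: "monom_eval v (m + m') = monom_eval v m * monom_eval v m'"
  by (simp add: monom_eval_def lookup_add power_add prod.distrib)

lemma monom_eval_single: "monom_eval v (Poly_Mapping.single i n) = v $ i ^ n"
proof -
  have "monom_eval v (Poly_Mapping.single i n) = (\<Prod>j\<in>UNIV. if j = i then v $ i ^ n else 1)"
    unfolding monom_eval_def by (intro prod.cong) (auto simp: lookup_single when_def)
  then show ?thesis
    by simp
qed

definition mdeg :: "('n::finite \<Rightarrow>\<^sub>0 nat) \<Rightarrow> nat" where
  "mdeg m = (\<Sum>i\<in>UNIV. Poly_Mapping.lookup m i)"

lemma mdeg_add: "mdeg (m + m') = mdeg m + mdeg m'"
  by (simp add: mdeg_def lookup_add sum.distrib)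

lemma mdeg_0 [simp]: "mdeg 0 = 0"
  by (simp add: mdeg_def)

lemma mdeg_single: "mdeg (Poly_Mapping.single i n) = n"
proof -
  have "mdeg (Poly_Mapping.single i n) = (\<Sum>j\<in>UNIV. if j = i then n else 0)"
    unfolding mdeg_def by (intro sum.cong) (auto simp: lookup_single when_def)
  then show ?thesis
    by simp
qed

lemma monom_eval_scale: "monom_eval (c *s v) m = c ^ mdeg m * monom_eval v m"
  by (simp add: monom_eval_def mdeg_def power_mult_distrib prod.distrib power_sum)

lemma homogeneous_mdeg: "homogeneous d F \<longleftrightarrow> (\<forall>m\<in>Poly_Mapping.keys F. mdeg m = d)"
  by (simp add: homogeneous_def mdeg_def)

lemma mp_eval_alt: "mp_eval \<phi> F v = (\<Sum>m\<in>Poly_Mapping.keys F. \<phi> (Poly_Mapping.lookup F m) * monom_eval v m)"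
  by (simp add: mp_eval_def monom_eval_def)

lemma mp_eval_superset:
  assumes "finite A" "Poly_Mapping.keys F \<subseteq> A" "\<phi> 0 = 0"
  shows "mp_eval \<phi> F v = (\<Sum>m\<in>A. \<phi> (Poly_Mapping.lookup F m) * monom_eval v m)"
  unfolding mp_eval_alt
  by (rule sum.mono_neutral_left) (use assms in \<open>auto simp: in_keys_iff\<close>)

lemma mp_eval_0 [simp]: "mp_eval \<phi> 0 v = 0"
  by (simp add: mp_eval_alt)

lemma mp_eval_single:
  assumes "\<phi> 0 = 0"
  shows "mp_eval \<phi> (Poly_Mapping.single m c) v = \<phi> c * monom_eval v m"
  by (subst mp_eval_superset[where A = "{m}"]) (use assms in auto)

lemma mp_eval_add:
  assumes "ring_hom_on \<phi>"
  shows "mp_eval \<phi> (F + G) v = mp_eval \<phi> F v + mp_eval \<phi> G v"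
proof -
  let ?A = "Poly_Mapping.keys F \<union> Poly_Mapping.keys G"
  have "mp_eval \<phi> H v = (\<Sum>m\<in>?A. \<phi> (Poly_Mapping.lookup H m) * monom_eval v m)"
    if "Poly_Mapping.keys H \<subseteq> ?A" for H
    by (rule mp_eval_superset) (use that assms in \<open>auto simp: ring_hom_on_def\<close>)
  then show ?thesis
    using keys_add[of F G]
    by (simp add: lookup_add ring_hom_onD[OF assms] distrib_right sum.distrib)
qed

lemma mp_eval_sum:
  assumes "ring_hom_on \<phi>"
  shows "mp_eval \<phi> (sum F A) v = (\<Sum>x\<in>A. mp_eval \<phi> (F x) v)"
  by (induction A rule: infinite_finite_induct) (auto simp: mp_eval_add[OF assms])

lemma mpoly_eq_sum_single:
  "F = (\<Sum>m\<in>Poly_Mapping.keys F. Poly_Mapping.single m (Poly_Mapping.lookup F m))"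
  by (rule poly_mapping_eqI)
     (auto simp: lookup_sum lookup_single when_def in_keys_iff sum.delta)

lemma mp_eval_mult:
  assumes "ring_hom_on \<phi>"
  shows "mp_eval \<phi> (F * G) v = mp_eval \<phi> F v * mp_eval \<phi> G v"
proof -
  note h = ring_hom_onD[OF assms]
  have "F * G = (\<Sum>m\<in>Poly_Mapping.keys F. \<Sum>m'\<in>Poly_Mapping.keys G.
      Poly_Mapping.single (m + m') (Poly_Mapping.lookup F m * Poly_Mapping.lookup G m'))"
    by (subst (1) mpoly_eq_sum_single[of F], subst (1) mpoly_eq_sum_single[of G])
       (simp add: sum_product mult_single)
  then show ?thesis
    by (simp add: mp_eval_sum[OF assms] mp_eval_single h monom_eval_add)
       (simp add: mp_eval_alt sum_product algebra_simps)
qed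

lemma mp_eval_1: "ring_hom_on \<phi> \<Longrightarrow> mp_eval \<phi> 1 v = 1"
  using mp_eval_single[of \<phi> 0 1 v] by (simp add: ring_hom_on_def)

lemma ring_hom_on_mp_eval: "ring_hom_on \<phi> \<Longrightarrow> ring_hom_on (\<lambda>F. mp_eval \<phi> F v)"
  by (subst ring_hom_on_def) (auto simp: mp_eval_add mp_eval_mult mp_eval_1)

lemma mp_eval_hom:
  assumes "ring_hom_on \<psi>"
  shows "\<psi> (mp_eval \<phi> F v) = mp_eval (\<lambda>c. \<psi> (\<phi> c)) F (\<chi> i. \<psi> (v $ i))"
  by (simp add: mp_eval_def ring_hom_on_sum[OF assms] ring_hom_onD[OF assms]
      ring_hom_on_prod[OF assms] ring_hom_on_power[OF assms])

lemma mp_eval_scale: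
  assumes "homogeneous d F"
  shows "mp_eval \<phi> F (c *s v) = c ^ d * mp_eval \<phi> F v"
  using assms
  by (simp add: mp_eval_alt monom_eval_scale homogeneous_mdeg sum_distrib_left mult_ac)

lemma mp_eval_dvd_diff:
  fixes a b :: "'b::comm_ring_1 ^ 'n::finite"
  assumes "\<And>i. m dvd a $ i - b $ i"
  shows "m dvd mp_eval \<phi> F a - mp_eval \<phi> F b"
proof -
  have pw: "m dvd x ^ n - y ^ n" if "m dvd x - y" for x y :: 'b and n
  proof (induction n)
    case (Suc n)
    have "x ^ Suc n - y ^ Suc n = x * (x ^ n - y ^ n) + (x - y) * y ^ n"
      by (simp add: algebra_simps)
    then show ?case
      using Suc that by (simp add: dvd_add dvd_mult dvd_mult2)
  qed simp
  have pr: "m dvd (\<Prod>i\<in>A. x i) - (\<Prod>i\<in>A. y i)" if "\<And>i. m dvd x i - y i"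
    for x y :: "'n \<Rightarrow> 'b" and A :: "'n set"
  proof (induction A rule: infinite_finite_induct)
    case (insert j A)
    have "(\<Prod>i\<in>insert j A. x i) - (\<Prod>i\<in>insert j A. y i)
      = x j * ((\<Prod>i\<in>A. x i) - (\<Prod>i\<in>A. y i)) + (x j - y j) * (\<Prod>i\<in>A. y i)"
      using insert by (simp add: algebra_simps)
    then show ?case
      using insert that[of j] by (simp add: dvd_add dvd_mult dvd_mult2)
  qed auto
  have "mp_eval \<phi> F a - mp_eval \<phi> F b
    = (\<Sum>k\<in>Poly_Mapping.keys F. \<phi> (Poly_Mapping.lookup F k) * (monom_eval a k - monom_eval b k))"
    by (simp add: mp_eval_alt right_diff_distrib sum_subtractf)
  also have "m dvd \<dots>"
    unfolding monom_eval_def by (intro dvd_sum dvd_mult pr pw assms)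
  finally show ?thesis .
qed

lemma homogeneous_0 [simp]: "homogeneous d 0"
  by (simp add: homogeneous_def)

lemma homogeneous_add: "homogeneous d F \<Longrightarrow> homogeneous d G \<Longrightarrow> homogeneous d (F + G)"
  using keys_add[of F G] by (fastforce simp: homogeneous_mdeg)

lemma homogeneous_sum: "(\<And>x. x \<in> A \<Longrightarrow> homogeneous d (F x)) \<Longrightarrow> homogeneous d (sum F A)"
  by (induction A rule: infinite_finite_induct) (auto intro: homogeneous_add)

lemma homogeneous_mult: "homogeneous d F \<Longrightarrow> homogeneous e G \<Longrightarrow> homogeneous (d + e) (F * G)"
  using keys_mult[of F G] by (fastforce simp: homogeneous_mdeg mdeg_add)

lemma homogeneous_single: "homogeneous (mdeg m) (Poly_Mapping.single m c)"
  by (simp add: homogeneous_mdeg)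

abbreviation mp_const :: "'a::comm_ring_1 \<Rightarrow> ('a, 'n) mpoly" where
  "mp_const \<equiv> Poly_Mapping.single 0"

abbreviation mp_var :: "'n \<Rightarrow> ('a::comm_ring_1, 'n) mpoly" where
  "mp_var i \<equiv> Poly_Mapping.single (Poly_Mapping.single i 1) 1"

lemma homogeneous_const: "homogeneous 0 (mp_const c)"
  by (simp add: homogeneous_mdeg)

lemma homogeneous_var: "homogeneous 1 (mp_var i)"
  by (simp add: homogeneous_mdeg mdeg_single)

lemma homogeneous_1: "homogeneous 0 (1 :: ('a::comm_ring_1, 'n::finite) mpoly)"
  by (simp add: homogeneous_mdeg)

lemma homogeneous_power:
  fixes F :: "('a::comm_ring_1, 'n::finite) mpoly"
  shows "homogeneous d F \<Longrightarrow> homogeneous (n * d) (F ^ n)"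
  by (induction n) (auto simp: homogeneous_mult homogeneous_1)

lemma homogeneous_prod:
  fixes F :: "'b \<Rightarrow> ('a::comm_ring_1, 'n::finite) mpoly"
  shows
  "(\<And>x. x \<in> A \<Longrightarrow> homogeneous (d x) (F x)) \<Longrightarrow> homogeneous (sum d A) (prod F A)"
  by (induction A rule: infinite_finite_induct)
     (auto simp: homogeneous_mult homogeneous_1)

definition mp_subst :: "('a::comm_ring_1, 'm::finite) mpoly \<Rightarrow> ('m \<Rightarrow> ('a, 'n) mpoly) \<Rightarrow> ('a, 'n::finite) mpoly" where
  "mp_subst F G = mp_eval mp_const F (\<chi> i. G i)"

lemma mp_eval_subst:
  assumes "ring_hom_on \<phi>"
  shows "mp_eval \<phi> (mp_subst F G) v = mp_eval \<phi> F (\<chi> i. mp_eval \<phi> (G i) v)"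
  unfolding mp_subst_def
  by (subst mp_eval_hom[OF ring_hom_on_mp_eval[OF assms]])
     (simp add: mp_eval_single ring_hom_onD[OF assms])

lemma homogeneous_subst:
  assumes "homogeneous d F" "\<And>i. homogeneous e (G i)"
  shows "homogeneous (d * e) (mp_subst F G)"
proof -
  have "homogeneous (0 + (\<Sum>i\<in>UNIV. Poly_Mapping.lookup m i * e))
      (mp_const (Poly_Mapping.lookup F m) * (\<Prod>i\<in>UNIV. G i ^ Poly_Mapping.lookup m i))"
    for m
    by (intro homogeneous_mult homogeneous_const homogeneous_prod homogeneous_power assms)
  moreover have "(\<Sum>i\<in>UNIV. Poly_Mapping.lookup m i * e) = d * e" if "m \<in> Poly_Mapping.keys F" for m
    using that assms(1) by (simp add: homogeneous_def flip: sum_distrib_right)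
  ultimately have "homogeneous (d * e)
      (mp_const (Poly_Mapping.lookup F m) * (\<Prod>i\<in>UNIV. G i ^ Poly_Mapping.lookup m i))"
    if "m \<in> Poly_Mapping.keys F" for m
    using that by (metis (no_types, lifting) add_0)
  then show ?thesis
    unfolding mp_subst_def mp_eval_def by (auto intro: homogeneous_sum)
qed

section \<open>Polynomial functions\<close>

abbreviation ev :: "('a::comm_ring_1, 'n::finite) mpoly \<Rightarrow> 'a ^ 'n \<Rightarrow> 'a" where
  "ev \<equiv> mp_eval (\<lambda>c. c)"

lemmas ev_simps = mp_eval_add[OF ring_hom_on_id] mp_eval_mult[OF ring_hom_on_id]
  mp_eval_1[OF ring_hom_on_id] mp_eval_sum[OF ring_hom_on_id] mp_eval_subst[OF ring_hom_on_id]

lemma ev_const [simp]: "ev (mp_const c) v = c"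
  by (simp add: mp_eval_single)

lemma ev_var [simp]: "ev (mp_var i) v = v $ i"
  by (simp add: mp_eval_single monom_eval_single)

text \<open>Working with functions instead of polynomials turns polynomiality into closure rules;
  over an infinite field a function determines its polynomial, by \<open>ev_eq_imp\<close>.\<close>

definition polyfun :: "('a::comm_ring_1 ^ 'n::finite \<Rightarrow> 'a) \<Rightarrow> bool" where
  "polyfun f \<longleftrightarrow> (\<exists>F. \<forall>v. f v = ev F v)"

lemma polyfun_ev [intro, simp]: "polyfun (ev F)"
  by (auto simp: polyfun_def)

lemma polyfun_const [intro, simp]: "polyfun (\<lambda>v. c)"
  unfolding polyfun_def by (rule exI[of _ "mp_const c"]) simp

lemma polyfun_nth [intro, simp]: "polyfun (\<lambda>v. v $ i)"
  unfolding polyfun_def by (rule exI[of _ "mp_var i"], subst ev_var) simp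

lemma polyfun_add [intro]: "polyfun f \<Longrightarrow> polyfun g \<Longrightarrow> polyfun (\<lambda>v. f v + g v)"
proof -
  assume "polyfun f" "polyfun g"
  then obtain F G where "\<forall>v. f v = ev F v" "\<forall>v. g v = ev G v"
    unfolding polyfun_def by blast
  then have "\<forall>v. f v + g v = ev (F + G) v"
    by (simp add: mp_eval_add[OF ring_hom_on_id])
  then show ?thesis
    unfolding polyfun_def by blast
qed

lemma polyfun_mult [intro]: "polyfun f \<Longrightarrow> polyfun g \<Longrightarrow> polyfun (\<lambda>v. f v * g v)"
proof -
  assume "polyfun f" "polyfun g"
  then obtain F G where "\<forall>v. f v = ev F v" "\<forall>v. g v = ev G v"
    unfolding polyfun_def by blast
  then have "\<forall>v. f v * g v = ev (F * G) v"
    by (simp add: mp_eval_mult[OF ring_hom_on_id])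
  then show ?thesis
    unfolding polyfun_def by blast
qed

lemma polyfun_uminus [intro]: "polyfun f \<Longrightarrow> polyfun (\<lambda>v. - f v)"
  using polyfun_mult[OF polyfun_const[of "-1"], of f] by simp

lemma polyfun_diff [intro]: "polyfun f \<Longrightarrow> polyfun g \<Longrightarrow> polyfun (\<lambda>v. f v - g v)"
  using polyfun_add[OF _ polyfun_uminus, of f g] by simp

lemma polyfun_sum [intro]: "(\<And>x. x \<in> A \<Longrightarrow> polyfun (f x)) \<Longrightarrow> polyfun (\<lambda>v. \<Sum>x\<in>A. f x v)"
  by (induction A rule: infinite_finite_induct) auto

lemma polyfun_prod [intro]: "(\<And>x. x \<in> A \<Longrightarrow> polyfun (f x)) \<Longrightarrow> polyfun (\<lambda>v. \<Prod>x\<in>A. f x v)"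
  by (induction A rule: infinite_finite_induct) auto

lemma polyfun_power [intro]: "polyfun f \<Longrightarrow> polyfun (\<lambda>v. f v ^ n)"
  by (induction n) auto

lemma polyfun_induct [consumes 1, case_names const nth add mult]:
  assumes "polyfun f"
    and "\<And>c. P (\<lambda>v. c)" and "\<And>i. P (\<lambda>v. v $ i)"
    and add: "\<And>f g. polyfun f \<Longrightarrow> polyfun g \<Longrightarrow> P f \<Longrightarrow> P g \<Longrightarrow> P (\<lambda>v. f v + g v)"
    and mult: "\<And>f g. polyfun f \<Longrightarrow> polyfun g \<Longrightarrow> P f \<Longrightarrow> P g \<Longrightarrow> P (\<lambda>v. f v * g v)"
  shows "P f"
proof -
  obtain F where F: "f = ev F"
    using assms(1) by (auto simp: polyfun_def)
  have pw: "P (\<lambda>v. v $ i ^ n)" for i n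
    by (induction n) (auto intro!: assms polyfun_power)
  have pr: "P (\<lambda>v. \<Prod>i\<in>A. v $ i ^ h i)" for A h
    by (induction A rule: infinite_finite_induct) (auto intro!: assms pw polyfun_power polyfun_prod)
  have "P (\<lambda>v. \<Sum>m\<in>A. Poly_Mapping.lookup F m * (\<Prod>i\<in>UNIV. v $ i ^ Poly_Mapping.lookup m i))" for A
    by (induction A rule: infinite_finite_induct)
       (auto intro!: assms pr polyfun_power polyfun_prod polyfun_sum)
  then show ?thesis
    unfolding F by (simp add: mp_eval_def [abs_def])
qed

lemma polyfun_comp:
  assumes "polyfun f" "\<And>i. polyfun (\<lambda>v. g v $ i)"
  shows "polyfun (\<lambda>v. f (g v))"
  using assms(1) by (induction rule: polyfun_induct) (use assms(2) in auto)

section \<open>Kronecker substitution and points off a hypersurface\<close>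

lemma digits_inj:
  fixes a b :: "nat \<Rightarrow> nat"
  assumes "\<And>j. j < n \<Longrightarrow> a j < B" "\<And>j. j < n \<Longrightarrow> b j < B"
    and "(\<Sum>j<n. a j * B ^ j) = (\<Sum>j<n. b j * B ^ j)" "j < n"
  shows "a j = b j"
  using assms
proof (induction n arbitrary: a b j)
  case (Suc n)
  have eq: "(\<Sum>j<Suc n. c j * B ^ j) = c 0 + B * (\<Sum>j<n. c (Suc j) * B ^ j)" for c :: "nat \<Rightarrow> nat"
    unfolding sum.lessThan_Suc_shift by (simp add: sum_distrib_left algebra_simps)
  have lt: "a 0 < B" "b 0 < B"
    using Suc.prems(1,2)[of 0] by auto
  then have 0: "a 0 = b 0"
    using Suc.prems(3) unfolding eq by (metis mod_less mod_mult_self2)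
  then have "(\<Sum>j<n. a (Suc j) * B ^ j) = (\<Sum>j<n. b (Suc j) * B ^ j)"
    using Suc.prems(3) lt unfolding eq by auto
  then have "a (Suc j) = b (Suc j)" if "j < n" for j
    using Suc.IH[of "a \<circ> Suc" "b \<circ> Suc" j] Suc.prems(1,2) that by auto
  then show ?case
    using 0 Suc.prems(4) by (cases j) auto
qed simp

text \<open>Kronecker substitution \<open>v\<^sub>i = t ^ w\<^sub>i\<close> with the weights \<open>w\<^sub>i\<close> powers of a large base.\<close>

lemma kronecker_substitution:
  fixes F :: "('a::field, 'n::finite) mpoly"
  assumes "F \<noteq> 0"
  obtains w :: "'n \<Rightarrow> nat" and g :: "'a poly"
  where "g \<noteq> 0" "\<And>t. poly g t = ev F (\<chi> i. t ^ w i)"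
proof -
  obtain e :: "'n \<Rightarrow> nat" and N where e: "bij_betw e UNIV {..<N}"
    using ex_bij_betw_finite_nat[of "UNIV :: 'n set"] by (auto simp: atLeast0LessThan)
  obtain d where d: "bij_betw d {..<N} UNIV" and de: "\<And>i. d (e i) = i"
    using e by (metis UNIV_I bij_betw_inv_into bij_betw_inv_into_left)
  \<comment> \<open>The base exceeds every exponent occurring in \<open>F\<close>, so the exponents
    of a monomial are the digits of its weight.\<close>
  define B where "B = Suc (Max (insert 0 ((\<lambda>(m, i). Poly_Mapping.lookup m i) ` (Poly_Mapping.keys F \<times> UNIV))))"
  define w where "w i = B ^ e i" for i
  define wt where "wt m = (\<Sum>i\<in>UNIV. Poly_Mapping.lookup m i * w i)" for m
  have lt: "Poly_Mapping.lookup m i < B" if "m \<in> Poly_Mapping.keys F" for m i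
    unfolding B_def less_Suc_eq_le by (rule Max_ge) (use that in force)+
  have wt: "wt m = (\<Sum>j<N. Poly_Mapping.lookup m (d j) * B ^ j)" for m
    unfolding wt_def w_def
    by (subst sum.reindex_bij_betw[OF e, symmetric]) (simp add: de)
  have inj: "m = m'" if "m \<in> Poly_Mapping.keys F" "m' \<in> Poly_Mapping.keys F" "wt m = wt m'" for m m'
  proof (rule poly_mapping_eqI)
    fix i
    have "Poly_Mapping.lookup m (d (e i)) = Poly_Mapping.lookup m' (d (e i))"
      by (rule digits_inj[where B = B and n = N])
         (use that lt e in \<open>auto simp: wt bij_betw_def\<close>)
    then show "Poly_Mapping.lookup m i = Poly_Mapping.lookup m' i"
      by (simp add: de)
  qed
  define g where "g = (\<Sum>m\<in>Poly_Mapping.keys F. monom (Poly_Mapping.lookup F m) (wt m))"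
  obtain m where m: "m \<in> Poly_Mapping.keys F"
    using assms by (metis all_not_in_conv lookup_not_eq_zero_eq_in_keys lookup_zero poly_mapping_eqI)
  have "coeff g (wt m) = (\<Sum>m'\<in>Poly_Mapping.keys F. if m' = m then Poly_Mapping.lookup F m else 0)"
    unfolding g_def coeff_sum by (intro sum.cong) (use inj m in auto)
  then have "coeff g (wt m) \<noteq> 0"
    using m by (simp add: in_keys_iff)
  moreover have "poly g t = ev F (\<chi> i. t ^ w i)" for t
    by (simp add: g_def poly_sum poly_monom mp_eval_def wt_def power_sum power_mult mult.commute[of _ "w _"])
  ultimately show thesis
    by (intro that[of g w]) auto
qed

text \<open>The substitution produces a point whose coordinates are powers of one \<open>t\<close>,
  hence the closure of \<open>S\<close> under powers. Rational points arise from
  \<open>S = range to_ac\<close>.\<close>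

lemma polyfun_nonzero_point:
  fixes f :: "'a::field ^ 'n::finite \<Rightarrow> 'a"
  assumes "polyfun f" "f v \<noteq> 0" "infinite S" "\<And>t n. t \<in> S \<Longrightarrow> t ^ n \<in> S"
  obtains u where "\<And>i. u $ i \<in> S" "f u \<noteq> 0"
proof -
  obtain F where F: "f = ev F"
    using assms(1) by (auto simp: polyfun_def)
  then have "F \<noteq> 0"
    using assms(2) by auto
  then obtain w g where g: "g \<noteq> 0" "\<And>t. poly g t = ev F (\<chi> i. t ^ w i)"
    using kronecker_substitution by blast
  have "finite {t. poly g t = 0}"
    using g(1) by (rule poly_roots_finite)
  then obtain t where "t \<in> S" "poly g t \<noteq> 0"
    using assms(3) by (metis (mono_tags, lifting) finite_subset mem_Collect_eq subsetI)
  then show thesis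
    using that[of "\<chi> i. t ^ w i"] assms(4) g(2) F by auto
qed

lemma ev_eq_0_imp:
  fixes F :: "('a::field, 'n::finite) mpoly"
  assumes "infinite (UNIV :: 'a set)" "\<And>v. ev F v = 0"
  shows "F = 0"
proof (rule ccontr)
  assume "F \<noteq> 0"
  then obtain w g where g: "g \<noteq> 0" "\<And>t. poly g t = ev F (\<chi> i. t ^ w i)"
    using kronecker_substitution by blast
  have "finite {t. poly g t = 0}"
    using g(1) by (rule poly_roots_finite)
  then show False
    using assms g(2) by simp
qed

lemma ev_eq_imp:
  fixes F :: "('a::field, 'n::finite) mpoly"
  assumes "infinite (UNIV :: 'a set)" "\<And>v. ev F v = ev G v"
  shows "F = G"
proof -
  have "ev (F + mp_const (-1) * G) v = 0" for v
    by (simp add: ev_simps assms)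
  then have "F + mp_const (-1) * G = 0"
    using ev_eq_0_imp[OF assms(1)] by blast
  then show ?thesis
    by (simp add: single_uminus add_eq_0_iff)
qed


section \<open>Directional derivatives and homogeneous components\<close>

definition line_poly :: "('a::comm_ring_1, 'n::finite) mpoly \<Rightarrow> 'a ^ 'n \<Rightarrow> 'a ^ 'n \<Rightarrow> 'a poly" where
  "line_poly F x v = mp_eval (\<lambda>c. [:c:]) F (\<chi> i. [:x $ i, v $ i:])"

lemma poly_line_poly: "poly (line_poly F x v) t = ev F (x + t *s v)"
  unfolding line_poly_def
  by (subst mp_eval_hom[OF ring_hom_on_poly]) (simp add: plus_vec_def vector_scalar_mult_def)

text \<open>With the coefficient of \<open>t\<close> in \<open>F (x + t v)\<close> as derivative,
  product rule, chain rule and scaling are identities of polynomials in \<open>t\<close>, valid in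
  every characteristic.\<close>

definition dder :: "('a::comm_ring_1, 'n::finite) mpoly \<Rightarrow> 'a ^ 'n \<Rightarrow> 'a ^ 'n \<Rightarrow> 'a" where
  "dder F x v = coeff (line_poly F x v) 1"

lemma coeff_0_line_poly: "coeff (line_poly F x v) 0 = ev F x"
  using poly_line_poly[of F x v 0] by (simp add: poly_0_coeff_0)

lemma coeff_1_mult: "coeff (p * q) 1 = coeff p 0 * coeff q 1 + coeff p 1 * coeff q (0::nat)"
  by (simp add: coeff_mult)

lemma coeff_1_prod:
  fixes f :: "'b \<Rightarrow> 'a::comm_ring_1 poly"
  shows "finite A \<Longrightarrow> coeff (prod f A) 1 = (\<Sum>i\<in>A. coeff (f i) 1 * (\<Prod>j\<in>A - {i}. coeff (f j) 0))"
proof (induction A rule: finite_induct)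
  case (insert a A)
  have "(\<Sum>i\<in>A. coeff (f i) 1 * (\<Prod>j\<in>insert a A - {i}. coeff (f j) 0))
      = (\<Sum>i\<in>A. coeff (f a) 0 * (coeff (f i) 1 * (\<Prod>j\<in>A - {i}. coeff (f j) 0)))"
  proof (rule sum.cong[OF refl])
    fix i assume "i \<in> A"
    then have "insert a A - {i} = insert a (A - {i})"
      using insert by auto
    then show "coeff (f i) 1 * (\<Prod>j\<in>insert a A - {i}. coeff (f j) 0)
        = coeff (f a) 0 * (coeff (f i) 1 * (\<Prod>j\<in>A - {i}. coeff (f j) 0))"
      using insert by (simp add: mult_ac)
  qed
  moreover have "coeff (prod f A) 0 = (\<Prod>j\<in>A. coeff (f j) 0)"
    by (simp add: poly_prod flip: poly_0_coeff_0)
  ultimately show ?case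
    using insert by (simp add: coeff_1_mult sum_distrib_left algebra_simps del: One_nat_def)
qed simp

lemma coeff_linear_power:
  "coeff ([:a, b:] ^ n) 0 = a ^ n" "coeff ([:a, b:] ^ n) 1 = of_nat n * a ^ (n - 1) * (b::'a::comm_ring_1)"
proof -
  show 0: "coeff ([:a, b:] ^ n) 0 = a ^ n" for n
    by (simp flip: poly_0_coeff_0)
  show "coeff ([:a, b:] ^ n) 1 = of_nat n * a ^ (n - 1) * b"
  proof (induction n)
    case (Suc n)
    have "coeff ([:a, b:] ^ Suc n) 1 = a * coeff ([:a, b:] ^ n) 1 + b * a ^ n"
      using 0[of n] by (simp add: coeff_pCons)
    then show ?case
      unfolding Suc by (cases n) (simp_all add: algebra_simps)
  qed (simp add: coeff_pCons)
qed

lemma dder_eq_sum: "dder F x v = (\<Sum>i\<in>UNIV. v $ i * ev (mp_pderiv i F) x)"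
proof -
  let ?K = "Poly_Mapping.keys F" and ?c = "Poly_Mapping.lookup F" and ?e = "Poly_Mapping.lookup"
  \<comment> \<open>If the exponent of \<open>x $ i\<close> is 0, the truncated subtractions do no
    harm, as both sides carry the factor 0.\<close>
  have *: "(\<Prod>j\<in>UNIV - {i}. x $ j ^ ?e m j) * (of_nat (?e m i) * x $ i ^ (?e m i - 1))
      = of_nat (?e m i) * monom_eval x (m - Poly_Mapping.single i 1)" for m i
  proof (cases "?e m i")
    case (Suc n)
    have "monom_eval x (m - Poly_Mapping.single i 1)
        = x $ i ^ (?e m i - 1) * (\<Prod>j\<in>UNIV - {i}. x $ j ^ ?e (m - Poly_Mapping.single i 1) j)"
      unfolding monom_eval_def
      by (subst prod.remove[of _ i]) (auto simp: lookup_minus)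
    also have "(\<Prod>j\<in>UNIV - {i}. x $ j ^ ?e (m - Poly_Mapping.single i 1) j)
        = (\<Prod>j\<in>UNIV - {i}. x $ j ^ ?e m j)"
      by (rule prod.cong) (auto simp: lookup_minus lookup_single when_def)
    finally show ?thesis
      by (simp add: mult_ac)
  qed simp
  have "dder F x v = (\<Sum>m\<in>?K. ?c m * coeff (\<Prod>i\<in>UNIV. [:x $ i, v $ i:] ^ ?e m i) 1)"
    unfolding dder_def line_poly_def mp_eval_def by (simp add: coeff_sum del: One_nat_def)
  also have "\<dots> = (\<Sum>m\<in>?K. ?c m * (\<Sum>i\<in>UNIV. v $ i * (of_nat (?e m i) * monom_eval x (m - Poly_Mapping.single i 1))))"
    by (intro sum.cong refl arg_cong2[where f = "(*)"])
       (simp add: coeff_1_prod coeff_linear_power flip: * del: One_nat_def, simp add: mult_ac)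
  also have "\<dots> = (\<Sum>i\<in>UNIV. v $ i * (\<Sum>m\<in>?K. of_nat (?e m i) * ?c m * monom_eval x (m - Poly_Mapping.single i 1)))"
    by (simp add: sum_distrib_left mult_ac) (rule sum.swap)
  also have "\<dots> = (\<Sum>i\<in>UNIV. v $ i * ev (mp_pderiv i F) x)"
    by (simp add: mp_pderiv_def ev_simps mp_eval_single)
  finally show ?thesis .
qed

lemma dder_0 [simp]: "dder F x 0 = 0"
  by (simp add: dder_eq_sum)

lemma dder_add: "dder F x (u + v) = dder F x u + dder F x v"
  by (simp add: dder_eq_sum algebra_simps sum.distrib)

lemma dder_scale: "dder F x (c *s v) = c * dder F x v"
  by (simp add: dder_eq_sum algebra_simps sum_distrib_left)

lemma polyfun_dder:
  assumes "\<And>i. polyfun (\<lambda>z. g z $ i)" "\<And>i. polyfun (\<lambda>z. h z $ i)"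
  shows "polyfun (\<lambda>z. dder F (g z) (h z))"
  unfolding dder_eq_sum
  by (intro polyfun_sum polyfun_mult assms polyfun_comp[OF polyfun_ev])

lemma line_poly_scale:
  assumes "homogeneous d F"
  shows "line_poly F (c *s x) (c *s v) = smult (c ^ d) (line_poly F x v)"
proof -
  have "(\<chi> i. [:(c *s x) $ i, (c *s v) $ i:]) = [:c:] *s (\<chi> i. [:x $ i, v $ i:])"
    by (simp add: vec_eq_iff)
  then show ?thesis
    unfolding line_poly_def by (simp add: mp_eval_scale[OF assms] poly_const_pow)
qed

lemma line_poly_self:
  assumes "homogeneous d F"
  shows "line_poly F x x = smult (ev F x) ([:1, 1:] ^ d)"
proof -
  have "(\<chi> i. [:x $ i, x $ i:]) = [:1, 1:] *s (\<chi> i. [:x $ i:])"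
    by (simp add: vec_eq_iff)
  moreover have "mp_eval (\<lambda>c. [:c:]) F (\<chi> i. [:x $ i:]) = [:ev F x:]"
    by (subst mp_eval_hom[OF ring_hom_on_const_poly]) simp
  ultimately show ?thesis
    unfolding line_poly_def by (simp add: mp_eval_scale[OF assms])
qed

lemma dder_self: "homogeneous d F \<Longrightarrow> dder F x x = of_nat d * ev F x"
  by (simp add: dder_def line_poly_self coeff_linear_power mult.commute del: One_nat_def)

text \<open>Scaling point and direction together multiplies the whole line polynomial by
  \<open>c ^ Suc d\<close>; the scaling of the direction is then divided out.\<close>

lemma dder_scale_arg:
  fixes F :: "('a::field, 'n::finite) mpoly"
  assumes "homogeneous (Suc d) F" "c \<noteq> 0"
  shows "dder F (c *s x) v = c ^ d * dder F x v"
proof -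
  have "c * dder F (c *s x) v = dder F (c *s x) (c *s v)"
    by (simp add: dder_scale)
  also have "\<dots> = c ^ Suc d * dder F x v"
    by (simp add: dder_def line_poly_scale[OF assms(1)])
  finally show ?thesis
    using assms(2) by simp
qed

lemma dvd_monom_2_coeff:
  fixes p q :: "'a::comm_ring_1 poly"
  assumes "[:0, 1:] ^ 2 dvd p - q"
  shows "coeff p 0 = coeff q 0" "coeff p 1 = coeff q 1"
proof -
  obtain r where r: "p - q = [:0, 1:] ^ 2 * r"
    using assms by blast
  have "coeff (p - q) 0 = 0" "coeff (p - q) 1 = 0"
    unfolding r by (simp_all add: power2_eq_square coeff_pCons)
  then show "coeff p 0 = coeff q 0" "coeff p 1 = coeff q 1"
    by auto
qed

lemma monom_2_dvdI:
  fixes p :: "'a::comm_ring_1 poly"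
  shows "[:0, 1:] ^ 2 dvd p - [:coeff p 0, coeff p 1:]"
proof -
  obtain a b r where "p = pCons a (pCons b r)"
    by (metis pCons_cases)
  then have "p - [:coeff p 0, coeff p 1:] = [:0, 1:] ^ 2 * r"
    by (simp add: power2_eq_square)
  then show ?thesis
    by simp
qed

text \<open>The chain rule holds because modulo \<open>t ^ 2\<close> the inner polynomials may be
  replaced by their linear parts.\<close>

lemma dder_subst: "dder (mp_subst F G) x v = dder F (\<chi> i. ev (G i) x) (\<chi> i. dder (G i) x v)"
proof -
  let ?C = "\<lambda>c::'a. [:c:]"
  have "line_poly (mp_subst F G) x v = mp_eval ?C F (\<chi> i. line_poly (G i) x v)"
    unfolding line_poly_def by (rule mp_eval_subst[OF ring_hom_on_const_poly])
  moreover have "[:0, 1:] ^ 2 dvd mp_eval ?C F (\<chi> i. line_poly (G i) x v)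
      - line_poly F (\<chi> i. ev (G i) x) (\<chi> i. dder (G i) x v)"
    unfolding line_poly_def[of F]
    by (rule mp_eval_dvd_diff)
       (use monom_2_dvdI[of "line_poly (G _) x v"] in \<open>simp add: coeff_0_line_poly dder_def\<close>)
  ultimately show ?thesis
    unfolding dder_def by (simp add: dvd_monom_2_coeff del: One_nat_def)
qed

text \<open>Shifting the parameter by \<open>t\<close> moves the derivative at 0, which
  \<open>dder\<close> records, to any point of the line.\<close>

lemma pderiv_line_poly:
  fixes F :: "('a::field, 'n::finite) mpoly"
  assumes "infinite (UNIV :: 'a set)"
  shows "poly (pderiv (line_poly F x v)) t = dder F (x + t *s v) v"
proof -
  have "line_poly F (x + t *s v) v = pcompose (line_poly F x v) [:t, 1:]"
  proof -
    have "poly (line_poly F (x + t *s v) v - pcompose (line_poly F x v) [:t, 1:]) s = 0" for s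
    proof -
      have "x + t *s v + s *s v = x + (t + s) *s v"
        by (simp add: vec_eq_iff algebra_simps)
      then show ?thesis
        by (simp add: poly_line_poly poly_pcompose add.assoc)
    qed
    then have "line_poly F (x + t *s v) v - pcompose (line_poly F x v) [:t, 1:] = 0"
      by (metis (mono_tags, lifting) UNIV_eq_I assms mem_Collect_eq poly_roots_finite)
    then show ?thesis
      by simp
  qed
  then have "dder F (x + t *s v) v = poly (pderiv (pcompose (line_poly F x v) [:t, 1:])) 0"
    by (simp add: dder_def poly_0_coeff_0 coeff_pderiv)
  then show ?thesis
    by (simp add: pderiv_pcompose poly_pcompose pderiv_pCons)
qed

section \<open>Homogeneous components as coefficients along rays\<close>

definition hom_comp :: "nat \<Rightarrow> ('a::comm_ring_1, 'n::finite) mpoly \<Rightarrow> ('a, 'n) mpoly" where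
  "hom_comp d F = (\<Sum>m\<in>{m\<in>Poly_Mapping.keys F. mdeg m = d}. Poly_Mapping.single m (Poly_Mapping.lookup F m))"

lemma homogeneous_hom_comp: "homogeneous d (hom_comp d F)"
  unfolding hom_comp_def by (rule homogeneous_sum) (use homogeneous_single in blast)

lemma sum_hom_comp:
  assumes "\<And>m. m \<in> Poly_Mapping.keys F \<Longrightarrow> mdeg m \<le> N"
  shows "F = (\<Sum>d\<le>N. hom_comp d F)"
proof -
  have "(\<Sum>d\<le>N. hom_comp d F)
      = (\<Sum>m\<in>Poly_Mapping.keys F. Poly_Mapping.single m (Poly_Mapping.lookup F m))"
    unfolding hom_comp_def
    by (subst sum.group) (use assms in auto)
  then show ?thesis
    using mpoly_eq_sum_single[of F] by simp
qed

lemma ex_degree_bound: "\<exists>N. \<forall>m\<in>Poly_Mapping.keys F. mdeg m \<le> N"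
  by (rule exI[of _ "\<Sum>m\<in>Poly_Mapping.keys F. mdeg m"]) (auto intro!: member_le_sum)

lemma ev_scale_hom_comp:
  fixes F :: "('a::field, 'n::finite) mpoly"
  obtains p where "\<And>t. poly p t = ev F (t *s v)" "\<And>d. coeff p d = ev (hom_comp d F) v"
proof -
  obtain N where N: "\<forall>m\<in>Poly_Mapping.keys F. mdeg m \<le> N"
    using ex_degree_bound by blast
  define p where "p = (\<Sum>d\<le>N. monom (ev (hom_comp d F) v) d)"
  have "poly p t = ev F (t *s v)" for t
  proof -
    have "ev F (t *s v) = (\<Sum>d\<le>N. ev (hom_comp d F) (t *s v))"
      by (subst sum_hom_comp[of F N]) (use N in \<open>auto simp: ev_simps\<close>)
    then show ?thesis
      by (simp add: p_def poly_sum poly_monom mp_eval_scale[OF homogeneous_hom_comp] mult.commute)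
  qed
  moreover have "hom_comp d F = 0" if "d > N" for d
  proof -
    have "{m\<in>Poly_Mapping.keys F. mdeg m = d} = {}"
      using N that by fastforce
    then show ?thesis
      unfolding hom_comp_def by (simp only: sum.empty)
  qed
  then have "coeff p d = ev (hom_comp d F) v" for d
    by (auto simp: p_def coeff_sum sum.delta not_le)
  ultimately show thesis
    using that[of p] by blast
qed

lemma polyfun_homogeneousE:
  fixes f :: "'a::field ^ 'n::finite \<Rightarrow> 'a"
  assumes "infinite (UNIV :: 'a set)" "polyfun f" "\<And>t v. f (t *s v) = t ^ d * f v"
  obtains F where "homogeneous d F" "f = ev F"
proof -
  obtain F where F: "f = ev F"
    using assms(2) by (auto simp: polyfun_def)
  have "ev (hom_comp d F) v = f v" for v
  proof -
    obtain p where p: "\<And>t. poly p t = ev F (t *s v)" "\<And>d. coeff p d = ev (hom_comp d F) v"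
      using ev_scale_hom_comp[where F = F and v = v] by metis
    have "poly (p - monom (f v) d) t = 0" for t
      using assms(3)[of t v] by (simp add: p F poly_monom)
    then have "p - monom (f v) d = 0"
      by (metis (mono_tags, lifting) UNIV_eq_I assms(1) mem_Collect_eq poly_roots_finite)
    then show ?thesis
      using p(2)[of d] by simp
  qed
  then show thesis
    using that[of "hom_comp d F"] homogeneous_hom_comp[of d F] by presburger
qed


section \<open>Nonvanishing and factorization of polynomial functions\<close>

lemma infinite_UNIV_alg_closed: "infinite (UNIV :: 'a::alg_closed_field set)"
proof
  assume fin: "finite (UNIV :: 'a set)"
  define p where "p = (\<Prod>a\<in>(UNIV :: 'a set). [:- a, 1:]) + 1"
  have p1: "poly p x = 1" for x
    unfolding p_def using fin by (simp add: poly_prod)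
  have "degree (\<Prod>a\<in>(UNIV :: 'a set). [:- a, 1:]) = card (UNIV :: 'a set)"
    by (subst degree_prod_eq_sum_degree) auto
  moreover have "card (UNIV :: 'a set) > 0"
    using fin by (simp add: card_gt_0_iff)
  ultimately have "degree p > 0"
    unfolding p_def by (subst degree_add_eq_left) auto
  then show False
    using alg_closed_imp_poly_has_root[of p] p1 by auto
qed

lemma poly_eqI_infinite:
  fixes p q :: "'a::field poly"
  assumes "infinite S" "\<And>t. t \<in> S \<Longrightarrow> poly p t = poly q t"
  shows "p = q"
proof (rule ccontr)
  assume "p \<noteq> q"
  then have "finite {t. poly (p - q) t = 0}"
    by (intro poly_roots_finite) auto
  moreover have "S \<subseteq> {t. poly (p - q) t = 0}"
    using assms(2) by auto
  ultimately show False
    using assms(1) finite_subset by blast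
qed

text \<open>On the line joining \<open>u\<close> and \<open>v\<close> both functions restrict to
  nonzero polynomials in one variable. This is the irreducibility of affine space.\<close>

lemma polyfun_common_nonzero:
  fixes f g :: "'a::field ^ 'n::finite \<Rightarrow> 'a"
  assumes "infinite (UNIV :: 'a set)" "polyfun f" "polyfun g" "f u \<noteq> 0" "g v \<noteq> 0"
  shows "\<exists>w. f w \<noteq> 0 \<and> g w \<noteq> 0"
proof -
  obtain F where F: "f = ev F"
    using assms(2) by (auto simp: polyfun_def)
  obtain G where G: "g = ev G"
    using assms(3) by (auto simp: polyfun_def)
  note FG = F G
  have uv: "u + 1 *s (v - u) = v" "u + 0 *s (v - u) = u"
    by (auto simp: vec_eq_iff)
  have "line_poly F u (v - u) \<noteq> 0" "line_poly G u (v - u) \<noteq> 0"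
    using poly_line_poly[of F u "v - u" 0] poly_line_poly[of G u "v - u" 1] assms(4,5) uv FG by auto
  then have "finite {t. poly (line_poly F u (v - u) * line_poly G u (v - u)) t = 0}"
    by (intro poly_roots_finite) auto
  then obtain t where "poly (line_poly F u (v - u) * line_poly G u (v - u)) t \<noteq> 0"
    using assms(1) by (metis (mono_tags, lifting) UNIV_eq_I mem_Collect_eq)
  then show ?thesis
    by (auto simp: poly_line_poly FG)
qed

lemma polyfun_mult_eq_0:
  fixes f g :: "'a::field ^ 'n::finite \<Rightarrow> 'a"
  assumes "infinite (UNIV :: 'a set)" "polyfun f" "polyfun g" "\<And>v. f v \<noteq> 0 \<Longrightarrow> g v = 0" "f u \<noteq> 0"
  shows "g v = 0"
  using polyfun_common_nonzero[OF assms(1-3,5)] assms(4) by blast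

lemma polyfun_prod_nonzero:
  fixes f :: "'b \<Rightarrow> 'a::field ^ 'n::finite \<Rightarrow> 'a"
  assumes "infinite (UNIV :: 'a set)" "finite A" "\<And>a. a \<in> A \<Longrightarrow> polyfun (f a)"
    "\<And>a. a \<in> A \<Longrightarrow> \<exists>v. f a v \<noteq> 0"
  shows "\<exists>v. (\<Prod>a\<in>A. f a v) \<noteq> 0"
  using assms(2-)
proof (induction A rule: finite_induct)
  case (insert a A)
  obtain u v where "f a u \<noteq> 0" "(\<Prod>a\<in>A. f a v) \<noteq> 0"
    using insert by (metis insertI1 insertI2)
  then obtain w where "f a w \<noteq> 0" "(\<Prod>a\<in>A. f a w) \<noteq> 0"
    using polyfun_common_nonzero[of "f a" "\<lambda>w. \<Prod>a\<in>A. f a w" u v] assms(1) insert.prems(1)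
    by (auto intro!: polyfun_prod)
  then show ?case
    using insert.hyps by auto
qed auto

text \<open>The order at 0 of each factor is at most its degree, while the orders and the degrees
  both add up to \<open>d\<close>; so order and degree agree for each factor.\<close>

lemma mult_eq_monomD:
  fixes p q :: "'a::field poly"
  assumes "p * q = monom c d" "c \<noteq> 0"
  shows "p = monom (lead_coeff p) (degree p)"
proof -
  have nz: "p * q \<noteq> 0"
    using assms by simp
  have "order 0 (p * q) = d"
    unfolding assms(1) using order_power_n_n[of "0 :: 'a" d] assms(2)
    by (metis monom_altdef order_smult minus_zero)
  moreover have "degree (p * q) = d"
    unfolding assms(1) using assms(2) by (simp add: degree_monom_eq)
  ultimately have "order 0 p + order 0 q = degree p + degree q"
    using nz by (simp add: order_mult degree_mult_eq)
  moreover have "order 0 p \<le> degree p" "order 0 q \<le> degree q"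
    using nz by (auto intro: order_degree)
  ultimately have o: "order 0 p = degree p"
    by linarith
  obtain r where r: "p = [:0, 1:] ^ degree p * r"
    using order_1[of 0 p] unfolding o by (auto elim: dvdE)
  have "degree r = 0"
  proof -
    define n where "n = degree p"
    have r': "p = [:0, 1:] ^ n * r"
      using r by (simp add: n_def)
    have "r \<noteq> 0"
      using nz r by auto
    then have "degree p = n + degree r"
      unfolding r' by (simp add: degree_mult_eq degree_power_eq)
    then show ?thesis
      by (simp add: n_def)
  qed
  then obtain a where "r = [:a:]"
    by (metis degree_eq_zeroE)
  then have "p = monom a (degree p)"
    using r by (simp add: monom_altdef)
  then show ?thesis
    by (metis lead_coeff_monom)
qed

lemma poly_line_poly_0: "poly (line_poly F 0 v) t = ev F (t *s v)"
  by (simp add: poly_line_poly)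

lemma coeff_line_poly_0:
  fixes F :: "('a::field, 'n::finite) mpoly"
  assumes "infinite (UNIV :: 'a set)"
  shows "coeff (line_poly F 0 v) d = ev (hom_comp d F) v"
proof -
  obtain p where p: "\<And>t. poly p t = ev F (t *s v)" "\<And>d. coeff p d = ev (hom_comp d F) v"
    using ev_scale_hom_comp[where F = F and v = v] by (metis (no_types))
  have "line_poly F 0 v = p"
    by (rule poly_eqI_infinite[OF assms]) (simp add: poly_line_poly_0 p)
  then show ?thesis
    using p by simp
qed

text \<open>On a ray where \<open>h\<close> is not zero both factors divide a monomial, hence are
  monomials. Their degree cannot vary with the ray, since two nonzero components of \<open>f\<close>
  would both survive at some common vector.\<close>

lemma homogeneous_factor:
  fixes f g h :: "'a::field ^ 'n::finite \<Rightarrow> 'a"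
  assumes inf: "infinite (UNIV :: 'a set)" and "polyfun f" "polyfun g" "\<And>v. f v * g v = h v"
    and h: "\<And>t v. h (t *s v) = t ^ d * h v" "h v0 \<noteq> 0"
  obtains a b where "a + b = d" "\<And>t v. f (t *s v) = t ^ a * f v" "\<And>t v. g (t *s v) = t ^ b * g v"
proof -
  have main: "\<exists>a. (\<forall>t v. f (t *s v) = t ^ a * f v)"
    if fg: "polyfun f" "polyfun g" "\<And>v. f v * g v = h v" for f g
  proof -
    obtain F where F: "f = ev F"
      using fg(1) by (auto simp: polyfun_def)
    obtain G where G: "g = ev G"
      using fg(2) by (auto simp: polyfun_def)
    define p where "p v = line_poly F 0 v" for v
    define q where "q v = line_poly G 0 v" for v
    have p: "\<And>v t. poly (p v) t = f (t *s v)" "\<And>v d. coeff (p v) d = ev (hom_comp d F) v"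
      unfolding F p_def by (simp_all add: poly_line_poly_0 coeff_line_poly_0[OF inf])
    have q: "\<And>v t. poly (q v) t = g (t *s v)"
      unfolding G q_def by (simp add: poly_line_poly_0)
    have mono: "p v = monom (lead_coeff (p v)) (degree (p v))" if "h v \<noteq> 0" for v
    proof (rule mult_eq_monomD)
      show "p v * q v = monom (h v) d"
        by (rule poly_eqI_infinite[OF inf])
           (simp add: p q poly_monom fg(3) h(1) mult.commute)
    qed fact
    define a where "a = degree (p v0)"
    have pv0: "p v0 \<noteq> 0"
      using p(1)[of v0 1] h(2) fg(3)[of v0] by auto
    have 0: "ev (hom_comp j F) v = 0" if "j \<noteq> a" for j v
    proof (rule ccontr)
      assume "ev (hom_comp j F) v \<noteq> 0"
      moreover have "ev (hom_comp a F) v0 \<noteq> 0"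
        using pv0 by (simp add: a_def flip: p(2))
      ultimately obtain w where w: "ev (hom_comp j F) w \<noteq> 0" "ev (hom_comp a F) w \<noteq> 0"
        using polyfun_common_nonzero[OF inf polyfun_ev polyfun_ev] by blast
      have "polyfun (\<lambda>w. f w * g w)" "polyfun (\<lambda>w. ev (hom_comp j F) w * ev (hom_comp a F) w)"
        by (intro polyfun_mult polyfun_ev fg(1,2))+
      then obtain w where w: "ev (hom_comp j F) w * ev (hom_comp a F) w \<noteq> 0" "f w * g w \<noteq> 0"
        using polyfun_common_nonzero[OF inf, of "\<lambda>w. ev (hom_comp j F) w * ev (hom_comp a F) w" "\<lambda>w. f w * g w" w v0]
          w h(2) fg(3)[of v0] by auto
      then have "coeff (p w) j \<noteq> 0" "coeff (p w) a \<noteq> 0"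
        by (auto simp: p(2))
      then show False
        using mono[of w] w(2) fg(3)[of w] that by (metis coeff_monom)
    qed
    have pm: "p v = monom (ev (hom_comp a F) v) a" for v
      by (rule poly_eqI) (auto simp: p(2) 0)
    have "f (t *s v) = t ^ a * f v" for t v
      using p(1)[of v t] p(1)[of v 1] by (simp add: pm poly_monom mult.commute)
    then show ?thesis
      by blast
  qed
  obtain a where a: "\<And>t v. f (t *s v) = t ^ a * f v"
    using main[of f g] assms by blast
  obtain b where b: "\<And>t v. g (t *s v) = t ^ b * g v"
    using main[of g f] assms by (metis mult.commute)
  have "monom (h v0) (a + b) = monom (h v0) d"
  proof (rule poly_eqI_infinite[OF inf])
    fix t
    have "t ^ a * f v0 * (t ^ b * g v0) = t ^ d * h v0"
      using assms(4)[of "t *s v0"] h(1)[of t v0] a b by simp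
    then have "t ^ (a + b) * (f v0 * g v0) = t ^ d * h v0"
      by (simp add: power_add mult_ac)
    then show "poly (monom (h v0) (a + b)) t = poly (monom (h v0) d) t"
      by (simp add: assms(4) poly_monom mult.commute)
  qed
  then have "a + b = d"
    using h(2) by (metis degree_monom_eq)
  then show thesis
    using that a b by blast
qed

text \<open>An element of least degree in the ideal of \<open>f\<close> and \<open>g\<close> divides
  both up to constants. If it had positive degree, primality would make \<open>f\<close> divide a
  multiple of \<open>g\<close> by a constant, hence \<open>g\<close>.\<close>

lemma prime_poly_bezout:
  fixes f g :: "'r::idom_divide poly"
  assumes "prime_elem f" "degree f > 0" "\<not> f dvd g"
  obtains a b r where "r \<noteq> 0" "a * f + b * g = [:r:]"
proof -
  define I where "I = {m. m \<noteq> 0 \<and> (\<exists>a b. m = a * f + b * g)}"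
  have "f = 1 * f + 0 * g" "f \<noteq> 0"
    using assms(2) by auto
  then have fI: "f \<in> I"
    unfolding I_def by blast
  define m where "m = arg_min degree (\<lambda>m. m \<in> I)"
  have m: "m \<in> I" and min: "\<And>m'. m' \<in> I \<Longrightarrow> degree m \<le> degree m'"
    using arg_min_nat_lemma[of "\<lambda>m. m \<in> I" f degree] fI unfolding m_def by auto
  obtain a b where ab: "m = a * f + b * g" and "m \<noteq> 0"
    using m by (auto simp: I_def)
  \<comment> \<open>Pseudo-division stands in for Euclidean division: up to the constant
    \<open>c\<close>, the remainder lies in the ideal and has smaller degree.\<close>
  have dvd: "\<exists>c u. c \<noteq> 0 \<and> smult c x = m * u" if x: "x = a' * f + b' * g" for x a' b'
  proof -
    obtain c u where cu: "c \<noteq> 0" "smult c x = m * u + pseudo_mod x m"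
      using pseudo_mod(1)[OF \<open>m \<noteq> 0\<close>] by blast
    have "pseudo_mod x m = 0 \<or> degree (pseudo_mod x m) < degree m"
      using pseudo_mod(2)[OF \<open>m \<noteq> 0\<close>] by blast
    moreover have "pseudo_mod x m = ([:c:] * a' - u * a) * f + ([:c:] * b' - u * b) * g"
    proof -
      have "pseudo_mod x m = [:c:] * x - m * u"
        using cu(2) by simp
      then show ?thesis
        unfolding ab x by (simp add: algebra_simps)
    qed
    ultimately have "pseudo_mod x m = 0"
      using min[of "pseudo_mod x m"] unfolding I_def by fastforce
    then show ?thesis
      using cu by auto
  qed
  have "degree m = 0"
  proof (rule ccontr)
    assume dm: "degree m \<noteq> 0"
    obtain c u where c: "c \<noteq> 0" "smult c f = m * u"
      using dvd[of f 1 0] by auto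
    then have "f dvd m * u"
      by (metis dvd_refl dvd_smult)
    then consider "f dvd m" | "f dvd u"
      using assms(1) prime_elem_dvd_mult_iff by blast
    then show False
    proof cases
      case 2
      then obtain u' where "u = f * u'" ..
      then have "f * [:c:] = f * (m * u')"
        using c(2) by (simp add: mult_ac)
      then have "[:c:] = m * u'"
        using assms(2) by (metis degree_0 less_irrefl mult_cancel_left)
      then have "degree m + degree u' = 0"
        using c(1) by (metis degree_mult_eq degree_pCons_0 mult_eq_0_iff pCons_eq_0_iff)
      then show False
        using dm by simp
    next
      case 1
      obtain c u where c: "c \<noteq> 0" "smult c g = m * u"
        using dvd[of g 0 1] by auto
      then have "f dvd [:c:] * g"
        using 1 by simp
      then have "f dvd [:c:]"
        using assms(1,3) prime_elem_dvd_mult_iff by blast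
      then have "degree f = 0"
        using c(1) by (metis degree_pCons_0 dvd_imp_degree_le le_zero_eq pCons_eq_0_iff)
      then show False
        using assms(2) by simp
    qed
  qed
  then obtain r where "m = [:r:]"
    by (metis degree_eq_zeroE)
  then show thesis
    using that[of r a b] ab \<open>m \<noteq> 0\<close> by auto
qed

lemma poly_map_poly_section:
  assumes "ring_hom_on e" "\<And>t. e (c t) = t"
  shows "poly (map_poly e f) t = e (poly f (c t))"
  by (induction f) (simp_all add: ring_hom_onD[OF assms(1)] assms(2) map_poly_pCons)

text \<open>A Nullstellensatz for one prime polynomial: away from the zeros of the leading coefficient
  and of the constant produced by \<open>prime_poly_bezout\<close>, any root of the prime polynomial would be a
  root of that constant.\<close>

lemma prime_poly_nullstellensatz:
  fixes f g :: "'r::idom_divide poly" and e :: "'s \<Rightarrow> 'r \<Rightarrow> 'a::alg_closed_field"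
  assumes "prime_elem f" "degree f > 0"
    and e: "\<And>s. ring_hom_on (e s)" "\<And>s t. e s (c t) = t" "\<And>r. r \<noteq> 0 \<Longrightarrow> \<exists>s. e s r \<noteq> 0"
    and vanish: "\<And>s t. e s (poly f (c t)) = 0 \<Longrightarrow> e s (poly g (c t)) = 0"
  shows "f dvd g"
proof (rule ccontr)
  assume "\<not> f dvd g"
  then obtain a b r where r: "r \<noteq> 0" "a * f + b * g = [:r:]"
    using prime_poly_bezout[OF assms(1,2)] by blast
  have lc: "lead_coeff f \<noteq> 0"
    using assms(2) by auto
  then obtain s where s: "e s (r * lead_coeff f) \<noteq> 0"
    using e(3)[of "r * lead_coeff f"] r(1) by auto
  note h = ring_hom_onD[OF e(1)[of s]]
  have "coeff (map_poly (e s) f) (degree f) \<noteq> 0"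
    using s by (simp add: coeff_map_poly h)
  then have "degree (map_poly (e s) f) > 0"
    using assms(2) le_degree by (metis gr_zeroI leD)
  then obtain t where t: "poly (map_poly (e s) f) t = 0"
    using alg_closed_imp_poly_has_root by blast
  then have "e s (poly f (c t)) = 0"
    using poly_map_poly_section[where e = "e s" and c = c, OF e(1,2)] by metis
  moreover from this have "e s (poly g (c t)) = 0"
    by (rule vanish)
  moreover have "poly a (c t) * poly f (c t) + poly b (c t) * poly g (c t) = r"
    using arg_cong[OF r(2), of "\<lambda>p. poly p (c t)"] by simp
  ultimately have "e s r = 0"
    using h(3,4) by (metis add_0 mult_zero_right)
  then show False
    using s by (simp add: h)
qed

section \<open>Polynomials in several variables as iterated univariate polynomials\<close>

lemma ring_hom_on_poly_comp: "ring_hom_on \<phi> \<Longrightarrow> ring_hom_on (\<lambda>p. \<phi> (poly p x))"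
  by (simp add: ring_hom_on_def)

text \<open>Iterated polynomial rings inherit factoriality one variable at a time and allow
  elimination of the outermost variable, which receives the last argument; \<open>s0\<close> belongs
  to the innermost one.\<close>

definition ev2 :: "'a::field \<Rightarrow> 'a \<Rightarrow> 'a poly poly \<Rightarrow> 'a" where
  "ev2 s0 s1 f = poly (poly f [:s1:]) s0"

definition ev3 :: "'a::field \<Rightarrow> 'a \<Rightarrow> 'a \<Rightarrow> 'a poly poly poly \<Rightarrow> 'a" where
  "ev3 s0 s1 s2 f = ev2 s0 s1 (poly f [:[:s2:]:])"

definition ev4 :: "'a::field \<Rightarrow> 'a \<Rightarrow> 'a \<Rightarrow> 'a \<Rightarrow> 'a poly poly poly poly \<Rightarrow> 'a" where
  "ev4 s0 s1 s2 s3 f = ev3 s0 s1 s2 (poly f [:[:[:s3:]:]:])"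

lemma ring_hom_on_ev2: "ring_hom_on (ev2 s0 s1)"
  unfolding ev2_def by (rule ring_hom_on_poly_comp[OF ring_hom_on_poly])

lemma ring_hom_on_ev3: "ring_hom_on (ev3 s0 s1 s2)"
  unfolding ev3_def by (rule ring_hom_on_poly_comp[OF ring_hom_on_ev2])

lemma ring_hom_on_ev4: "ring_hom_on (ev4 s0 s1 s2 s3)"
  unfolding ev4_def by (rule ring_hom_on_poly_comp[OF ring_hom_on_ev3])

lemma ev_const_poly [simp]: "ev2 s0 s1 [:[:c:]:] = c" "ev3 s0 s1 s2 [:[:[:c:]:]:] = c"
  "ev4 s0 s1 s2 s3 [:[:[:[:c:]:]:]:] = c"
  by (simp_all add: ev2_def ev3_def ev4_def)

text \<open>A nonzero coefficient is detected by some evaluation \<open>e\<close>, after which a univariate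
  polynomial remains.\<close>

lemma nested_eval_nonzero:
  fixes e :: "'s \<Rightarrow> 'r::idom \<Rightarrow> 'a::field"
  assumes inf: "infinite (UNIV :: 'a set)" and "f \<noteq> 0"
    and e: "\<And>s. ring_hom_on (e s)" "\<And>s t. e s (c t) = t" "\<And>r. r \<noteq> 0 \<Longrightarrow> \<exists>s. e s r \<noteq> 0"
  shows "\<exists>s t. e s (poly f (c t)) \<noteq> 0"
proof -
  obtain s where s: "e s (lead_coeff f) \<noteq> 0"
    using e(3)[of "lead_coeff f"] assms(2) by auto
  then have "coeff (map_poly (e s) f) (degree f) \<noteq> 0"
    by (simp add: coeff_map_poly ring_hom_onD[OF e(1)])
  then have "map_poly (e s) f \<noteq> 0"
    by auto
  then obtain t where "poly (map_poly (e s) f) t \<noteq> 0"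
    using poly_eqI_infinite[OF inf, of "map_poly (e s) f" 0] by auto
  then show ?thesis
    using poly_map_poly_section[where e = "e s" and c = c, OF e(1,2)] by metis
qed

lemma ev2_nonzero:
  assumes "infinite (UNIV :: 'a::field set)" "(f :: 'a poly poly) \<noteq> 0"
  shows "\<exists>s0 s1. ev2 s0 s1 f \<noteq> 0"
  unfolding ev2_def
  by (rule nested_eval_nonzero[where e = "\<lambda>s p. poly p s" and c = "\<lambda>t. [:t:]"])
     (use assms poly_eqI_infinite[OF assms(1), of _ 0] in \<open>auto intro: ring_hom_on_poly\<close>)

lemma ev3_nonzero:
  assumes "infinite (UNIV :: 'a::field set)" "(f :: 'a poly poly poly) \<noteq> 0"
  shows "\<exists>s0 s1 s2. ev3 s0 s1 s2 f \<noteq> 0"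
  using nested_eval_nonzero[where e = "\<lambda>(s0, s1). ev2 s0 s1" and c = "\<lambda>t. [:[:t:]:]" and f = f]
    assms ev2_nonzero[OF assms(1)]
  by (fastforce simp: ev3_def ring_hom_on_ev2 split_beta)

lemma ev4_nonzero:
  assumes "infinite (UNIV :: 'a::field set)" "(f :: 'a poly poly poly poly) \<noteq> 0"
  shows "\<exists>s0 s1 s2 s3. ev4 s0 s1 s2 s3 f \<noteq> 0"
  using nested_eval_nonzero[where e = "\<lambda>(s0, s1, s2). ev3 s0 s1 s2" and c = "\<lambda>t. [:[:[:t:]:]:]" and f = f]
    assms ev3_nonzero[OF assms(1)]
  by (fastforce simp: ev4_def ring_hom_on_ev3 split_beta)

lemma polyfun_imp_ev3:
  fixes f :: "'a::field ^ 'n::finite \<Rightarrow> 'a"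
  assumes "polyfun f"
  shows "\<exists>n. \<forall>s0 s1 s2. ev3 s0 s1 s2 n = f (s0 *s P + s1 *s Q + s2 *s R)"
  using assms
proof (induction rule: polyfun_induct)
  case (const c)
  show ?case
    by (rule exI[of _ "[:[:[:c:]:]:]"]) simp
next
  case (nth i)
  show ?case
    by (rule exI[of _ "[:[:[:0, P $ i:], [:Q $ i:]:], [:[:R $ i:]:]:]"]) (simp add: ev3_def ev2_def)
next
  case (add f g)
  then obtain n m where "\<forall>s0 s1 s2. ev3 s0 s1 s2 n = f (s0 *s P + s1 *s Q + s2 *s R)"
    "\<forall>s0 s1 s2. ev3 s0 s1 s2 m = g (s0 *s P + s1 *s Q + s2 *s R)" by blast
  then show ?case
    by (intro exI[of _ "n + m"]) (simp add: ring_hom_onD[OF ring_hom_on_ev3])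
next
  case (mult f g)
  then obtain n m where "\<forall>s0 s1 s2. ev3 s0 s1 s2 n = f (s0 *s P + s1 *s Q + s2 *s R)"
    "\<forall>s0 s1 s2. ev3 s0 s1 s2 m = g (s0 *s P + s1 *s Q + s2 *s R)" by blast
  then show ?case
    by (intro exI[of _ "n * m"]) (simp add: ring_hom_onD[OF ring_hom_on_ev3])
qed

lemma polyfun_imp_ev4:
  fixes f :: "'a::field ^ 4 \<Rightarrow> 'a"
  assumes "polyfun f"
  shows "\<exists>n. \<forall>v. ev4 (v $ 1) (v $ 2) (v $ 3) (v $ 4) n = f v"
  using assms
proof (induction rule: polyfun_induct)
  case (const c)
  show ?case
    by (rule exI[of _ "[:[:[:[:c:]:]:]:]"]) simp
next
  case (nth i)
  consider "i = 1" | "i = 2" | "i = 3" | "i = 4"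
    using exhaust_4 by blast
  then show ?case
  proof cases
    case 1
    show ?thesis
      unfolding 1 by (rule exI[of _ "[:[:[:[:0, 1:]:]:]:]"]) (simp add: ev4_def ev3_def ev2_def)
  next
    case 2
    show ?thesis
      unfolding 2 by (rule exI[of _ "[:[:[:0, 1:]:]:]"]) (simp add: ev4_def ev3_def ev2_def)
  next
    case 3
    show ?thesis
      unfolding 3 by (rule exI[of _ "[:[:0, 1:]:]"]) (simp add: ev4_def ev3_def ev2_def)
  next
    case 4
    show ?thesis
      unfolding 4 by (rule exI[of _ "[:0, 1:]"]) (simp add: ev4_def ev3_def ev2_def)
  qed
next
  case (add f g)
  then obtain n m where "\<forall>v. ev4 (v $ 1) (v $ 2) (v $ 3) (v $ 4) n = f v"
    "\<forall>v. ev4 (v $ 1) (v $ 2) (v $ 3) (v $ 4) m = g v" by blast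
  then show ?case
    by (intro exI[of _ "n + m"]) (simp add: ring_hom_onD[OF ring_hom_on_ev4])
next
  case (mult f g)
  then obtain n m where "\<forall>v. ev4 (v $ 1) (v $ 2) (v $ 3) (v $ 4) n = f v"
    "\<forall>v. ev4 (v $ 1) (v $ 2) (v $ 3) (v $ 4) m = g v" by blast
  then show ?case
    by (intro exI[of _ "n * m"]) (simp add: ring_hom_onD[OF ring_hom_on_ev4])
qed

lemma polyfun_nested_poly:
  assumes "\<And>r. polyfun (\<lambda>v. e v r)" "\<And>v. ring_hom_on (e v)" "\<And>v t. e v (c t) = t" "polyfun h"
  shows "polyfun (\<lambda>v. e v (poly f (c (h v))))"
proof (induction f)
  case 0
  show ?case
    using assms(2) by (simp add: ring_hom_on_def polyfun_const)
next
  case (pCons a f)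
  show ?case
    using pCons by (simp add: ring_hom_onD[OF assms(2)] assms(3) polyfun_add polyfun_mult assms(1,4))
qed

lemma polyfun_poly_const:
  assumes "polyfun h"
  shows "polyfun (\<lambda>v. poly f (h v))"
  by (induction f) (simp_all add: polyfun_add polyfun_mult polyfun_const assms)

lemma polyfun_ev2:
  assumes "polyfun x" "polyfun y"
  shows "polyfun (\<lambda>v. ev2 (x v) (y v) f)"
  unfolding ev2_def
  by (rule polyfun_nested_poly[where e = "\<lambda>v p. poly p (x v)" and c = "\<lambda>t. [:t:]"])
     (simp_all add: polyfun_poly_const assms ring_hom_on_poly)

lemma polyfun_ev3:
  assumes "polyfun x" "polyfun y" "polyfun z"
  shows "polyfun (\<lambda>v. ev3 (x v) (y v) (z v) f)"
  unfolding ev3_def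
  by (rule polyfun_nested_poly[where e = "\<lambda>v. ev2 (x v) (y v)" and c = "\<lambda>t. [:[:t:]:]"])
     (simp_all add: polyfun_ev2 assms ring_hom_on_ev2)

lemma polyfun_ev4:
  assumes "polyfun x" "polyfun y" "polyfun z" "polyfun w"
  shows "polyfun (\<lambda>v. ev4 (x v) (y v) (z v) (w v) f)"
  unfolding ev4_def
  by (rule polyfun_nested_poly[where e = "\<lambda>v. ev3 (x v) (y v) (z v)" and c = "\<lambda>t. [:[:[:t:]:]:]"])
     (simp_all add: polyfun_ev3 assms ring_hom_on_ev3)


instance alg_closure :: (field) field_gcd ..

section \<open>Smooth cubic surfaces are irreducible\<close>

text \<open>Were the restriction to \<open>u + t v\<close> constant, homogeneity would make the one
  to \<open>v + t u\<close> a multiple of \<open>t ^ e\<close>, so that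
  \<open>g v = 0\<close>.\<close>

lemma polyfun_zero_on_plane:
  fixes g :: "'a::alg_closed_field ^ 'n::finite \<Rightarrow> 'a"
  assumes "polyfun g" "\<And>t v. g (t *s v) = t ^ e * g v" "e > 0"
  shows "\<exists>a b. (a, b) \<noteq> (0, 0) \<and> g (a *s u + b *s v) = 0"
proof (cases "g v = 0")
  case True
  then show ?thesis
    by (intro exI[of _ 0] exI[of _ 1]) simp
next
  case False
  obtain G where G: "g = ev G"
    using assms(1) by (auto simp: polyfun_def)
  have "degree (line_poly G u v) > 0"
  proof (rule ccontr)
    assume "\<not> degree (line_poly G u v) > 0"
    then obtain c where c: "line_poly G u v = [:c:]"
      by (metis degree_eq_zeroE gr0I)
    have "line_poly G v u = monom c e"
    proof (rule poly_eqI_infinite)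
      show "infinite (UNIV - {0 :: 'a})"
        using infinite_UNIV_alg_closed by simp
    next
      fix t :: 'a assume "t \<in> UNIV - {0}"
      then have t: "t \<noteq> 0" by simp
      have "v + t *s u = t *s (u + (1 / t) *s v)"
        using t by (simp add: vec_eq_iff field_simps)
      then have "poly (line_poly G v u) t = t ^ e * poly (line_poly G u v) (1 / t)"
        unfolding poly_line_poly using assms(2) G by metis
      then show "poly (line_poly G v u) t = poly (monom c e) t"
        by (simp add: c poly_monom mult.commute)
    qed
    then have "g v = poly (monom c e) 0"
      using poly_line_poly[of G v u 0] G by simp
    then show False
      using False assms(3) by (simp add: poly_monom)
  qed
  then obtain t where "poly (line_poly G u v) t = 0"
    using alg_closed_imp_poly_has_root by blast
  then show ?thesis
    by (intro exI[of _ 1] exI[of _ t]) (simp add: poly_line_poly G)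
qed

lemma homogeneous_1_linear:
  fixes f :: "'a::field ^ 'n::finite \<Rightarrow> 'a"
  assumes "infinite (UNIV :: 'a set)" "polyfun f" "\<And>t v. f (t *s v) = t * f v"
  shows "f (u + v) = f u + f v"
proof -
  obtain F where F: "homogeneous 1 F" "f = ev F"
    using polyfun_homogeneousE[OF assms(1,2), of 1] assms(3) by auto
  have "monom_eval (u + v) m = monom_eval u m + monom_eval v m" if "m \<in> Poly_Mapping.keys F" for m
  proof -
    have "mdeg m = 1"
      using F(1) that by (simp add: homogeneous_mdeg)
    then obtain i where i: "Poly_Mapping.lookup m i = 1" "\<And>j. j \<noteq> i \<Longrightarrow> Poly_Mapping.lookup m j = 0"
      unfolding mdeg_def using sum_eq_1_iff[of UNIV "Poly_Mapping.lookup m"] by auto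
    then have "m = Poly_Mapping.single i 1"
      by (intro poly_mapping_eqI) (auto simp: lookup_single when_def)
    then show ?thesis
      by (simp only: monom_eval_single) simp
  qed
  then show ?thesis
    by (simp add: F(2) mp_eval_alt distrib_left sum.distrib)
qed

text \<open>The linear form has a zero in each of two complementary coordinate planes. It vanishes
  on their span, where the other form has a nontrivial zero.\<close>

lemma common_zero_linear_form:
  fixes f g :: "'a::alg_closed_field ^ 4 \<Rightarrow> 'a"
  assumes "polyfun f" "polyfun g" "\<And>t v. f (t *s v) = t * f v" "\<And>t v. g (t *s v) = t ^ e * g v" "e > 0"
  shows "\<exists>v. v \<noteq> 0 \<and> f v = 0 \<and> g v = 0"
proof -
  let ?e = "\<lambda>i. axis i 1 :: 'a ^ 4"
  note lin = homogeneous_1_linear[OF infinite_UNIV_alg_closed assms(1,3)]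
  obtain a b where ab: "(a, b) \<noteq> (0, 0)" "f (a *s ?e 1 + b *s ?e 2) = 0"
    using polyfun_zero_on_plane[OF assms(1), of 1 "?e 1" "?e 2"] assms(3) by auto
  obtain c d where cd: "(c, d) \<noteq> (0, 0)" "f (c *s ?e 3 + d *s ?e 4) = 0"
    using polyfun_zero_on_plane[OF assms(1), of 1 "?e 3" "?e 4"] assms(3) by auto
  define u v where "u = a *s ?e 1 + b *s ?e 2" and "v = c *s ?e 3 + d *s ?e 4"
  obtain s t where st: "(s, t) \<noteq> (0, 0)" "g (s *s u + t *s v) = 0"
    using polyfun_zero_on_plane[OF assms(2,4,5)] by blast
  have "f (s *s u + t *s v) = 0"
    using ab cd by (simp add: lin assms(3) u_def v_def)
  moreover have "s *s u + t *s v \<noteq> 0"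
  proof
    assume "s *s u + t *s v = 0"
    then have "\<And>i. (s *s u + t *s v) $ i = 0" by simp
    from this[of 1] this[of 2] this[of 3] this[of 4] show False
      using ab(1) cd(1) st(1) by (auto simp: u_def v_def axis_def)
  qed
  ultimately show ?thesis
    using st by blast
qed

definition smooth_form :: "('a::comm_ring_1, 'n::finite) mpoly \<Rightarrow> bool" where
  "smooth_form F \<longleftrightarrow> (\<forall>v. v \<noteq> 0 \<longrightarrow> ev F v = 0 \<longrightarrow> (\<exists>u. dder F v u \<noteq> 0))"

text \<open>A proper factorization of \<open>F\<close> has a linear factor, and a common zero of the two factors is singular;
  so \<open>F\<close> is prime, and the Nullstellensatz turns vanishing on the surface into divisibility by \<open>F\<close>.\<close>

theorem smooth_cubic_irreducible:
  fixes F :: "('a::{alg_closed_field,field_gcd}, 4) mpoly"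
  assumes "homogeneous 3 F" "smooth_form F"
    and f: "polyfun f" and g: "polyfun g" and fg: "\<And>v. ev F v = 0 \<Longrightarrow> f v = 0 \<or> g v = 0"
  shows "(\<forall>v. ev F v = 0 \<longrightarrow> f v = 0) \<or> (\<forall>v. ev F v = 0 \<longrightarrow> g v = 0)"
proof -
  note inf = infinite_UNIV_alg_closed[where 'a = 'a]
  let ?E = "\<lambda>n (v :: 'a ^ 4). ev4 (v $ 1) (v $ 2) (v $ 3) (v $ 4) n"
  have vec: "\<exists>v :: 'a ^ 4. v $ 1 = a \<and> v $ 2 = b \<and> v $ 3 = c \<and> v $ 4 = d" for a b c d
    by (rule exI[of _ "\<chi> i. if i = 1 then a else if i = 2 then b else if i = 3 then c else d"]) simp
  have inj: "n = m" if "\<And>v. ?E n v = ?E m v" for n m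
  proof (rule ccontr)
    assume "n \<noteq> m"
    then obtain a b c d where "ev4 a b c d (n - m) \<noteq> 0"
      using ev4_nonzero[OF inf, of "n - m"] by auto
    moreover have "ev4 a b c d (n - m + m) = ev4 a b c d (n - m) + ev4 a b c d m"
      by (rule ring_hom_onD[OF ring_hom_on_ev4])
    ultimately show False
      using that vec[of a b c d] by auto
  qed
  have pf: "polyfun (?E n)" for n
    by (intro polyfun_ev4 polyfun_nth)
  obtain n where n: "\<And>v. ?E n v = ev F v"
    using polyfun_imp_ev4[OF polyfun_ev, of F] by auto
  have F0: "ev F 0 = 0"
    using mp_eval_scale[OF assms(1), of "\<lambda>x. x" 0 0] by simp
  have Fs: "ev F (t *s v) = t ^ 3 * ev F v" for t v
    by (rule mp_eval_scale[OF assms(1)])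
  have E0: "?E 0 v = 0" for v
    by (rule ring_hom_onD[OF ring_hom_on_ev4])
  have E1: "?E 1 v = 1" for v
    by (rule ring_hom_onD[OF ring_hom_on_ev4])
  have Em: "?E (x * y) v = ?E x v * ?E y v" for x y v
    by (rule ring_hom_onD[OF ring_hom_on_ev4])
  \<comment> \<open>If the last variable did not occur, the surface would be a cone, singular at its
    vertex \<open>axis 4 1\<close>.\<close>
  have deg: "degree n > 0"
  proof (rule ccontr)
    assume "\<not> degree n > 0"
    then obtain c where c: "n = [:c:]"
      by (metis degree_eq_zeroE gr0I)
    let ?e = "axis 4 1 :: 'a ^ 4"
    have e: "ev F (v + ?e) = ev F v" for v
      by (simp add: n[symmetric] c ev4_def axis_def)
    have "dder F ?e u = 0" for u
    proof -
      have "line_poly F ?e u = monom (ev F u) 3"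
        by (rule poly_eqI_infinite[OF inf])
           (use e[of "t *s u" for t] in \<open>simp add: poly_line_poly poly_monom Fs add.commute mult.commute\<close>)
      then show ?thesis
        by (simp add: dder_def)
    qed
    moreover have "ev F ?e = 0"
      using e[of 0] F0 by simp
    moreover have "?e \<noteq> 0"
      by simp
    ultimately show False
      using assms(2) unfolding smooth_form_def by blast
  qed
  have unit: "is_unit x" if x: "\<And>t v. ?E x (t *s v) = ?E x v" "x \<noteq> 0" for x
  proof -
    let ?c = "?E x 0"
    have "x = [:[:[:[:?c:]:]:]:]"
      using x(1)[of 0] by (intro inj) simp
    moreover from this have "?c \<noteq> 0"
      using x(2) by auto
    ultimately show ?thesis
      by (metis is_unit_const_poly_iff dvd_field_iff one_neq_zero)
  qed
  have nz: "n \<noteq> 0"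
    using deg by auto
  then obtain v0 where v0: "ev F v0 \<noteq> 0"
    using inj[of n 0] n E0 by metis
  have "irreducible n"
  proof (rule irreducibleI)
    show "\<not> is_unit n"
    proof
      assume "is_unit n"
      then obtain m where "1 = n * m" ..
      then have "?E 1 0 = ?E n 0 * ?E m 0"
        using Em by metis
      then show False
        using n[of 0] F0 E1[of 0] by simp
    qed
  next
    fix x y assume xy: "n = x * y"
    have prod: "?E x v * ?E y v = ev F v" for v
      using n[of v] unfolding xy Em .
    obtain a b where ab: "a + b = 3" "\<And>t v. ?E x (t *s v) = t ^ a * ?E x v" "\<And>t v. ?E y (t *s v) = t ^ b * ?E y v"
      using homogeneous_factor[OF inf pf pf prod Fs v0] by blast
    have xy0: "x \<noteq> 0" "y \<noteq> 0"
      using xy nz by auto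
    have sing: False if v: "v \<noteq> 0" "?E x v = 0" "?E y v = 0" for v
    proof -
      obtain G where G: "\<And>v. ?E x v = ev G v"
        using pf[of x] unfolding polyfun_def by blast
      obtain H where H: "\<And>v. ?E y v = ev H v"
        using pf[of y] unfolding polyfun_def by blast
      have "F = G * H"
        by (rule ev_eq_imp[OF inf]) (simp add: ev_simps flip: prod G H)
      have "dder F v u = 0" for u
      proof -
        have "line_poly F v u = line_poly G v u * line_poly H v u"
          unfolding \<open>F = G * H\<close> line_poly_def by (rule mp_eval_mult[OF ring_hom_on_const_poly])
        then show ?thesis
          using v G[of v] H[of v]
          by (simp add: dder_def coeff_1_mult coeff_0_line_poly del: One_nat_def)
      qed
      then show False
        using assms(2) v prod[of v] by (auto simp: smooth_form_def)
    qed
    consider "a = 0" | "b = 0" | "a = 1" "b > 0" | "b = 1" "a > 0"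
      using ab(1) by linarith
    then show "is_unit x \<or> is_unit y"
    proof cases
      case 1
      then show ?thesis using unit[of x] ab(2) xy0 by simp
    next
      case 2
      then show ?thesis using unit[of y] ab(3) xy0 by simp
    next
      case 3
      then have "\<exists>v. v \<noteq> 0 \<and> ?E x v = 0 \<and> ?E y v = 0"
        using common_zero_linear_form[OF pf[of x] pf[of y] _ ab(3)] ab(2) by simp
      then show ?thesis using sing by blast
    next
      case 4
      then have "\<exists>v. v \<noteq> 0 \<and> ?E y v = 0 \<and> ?E x v = 0"
        using common_zero_linear_form[OF pf[of y] pf[of x] _ ab(2)] ab(3) by simp
      then show ?thesis using sing by blast
    qed
  qed (use nz in auto)
  then have prime: "prime_elem n"
    by (rule irreducible_imp_prime_elem)
  obtain x where x: "\<And>v. ?E x v = f v"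
    using polyfun_imp_ev4[OF f] by auto
  obtain y where y: "\<And>v. ?E y v = g v"
    using polyfun_imp_ev4[OF g] by auto
  have "n dvd x * y"
  proof (rule prime_poly_nullstellensatz[where e = "\<lambda>(s0, s1, s2). ev3 s0 s1 s2" and c = "\<lambda>t. [:[:[:t:]:]:]"])
    fix s t assume "(case s of (s0, s1, s2) \<Rightarrow> ev3 s0 s1 s2) (poly n [:[:[:t:]:]:]) = 0"
    moreover obtain a b c where s: "s = (a, b, c)"
      by (metis prod_cases3)
    moreover obtain v :: "'a ^ 4" where "v $ 1 = a" "v $ 2 = b" "v $ 3 = c" "v $ 4 = t"
      using vec by blast
    ultimately show "(case s of (s0, s1, s2) \<Rightarrow> ev3 s0 s1 s2) (poly (x * y) [:[:[:t:]:]:]) = 0"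
      using n[of v] Em[where x = x and y = y and v = v] x[of v] y[of v] fg[of v] by (auto simp: ev4_def)
  qed (use prime deg ev3_nonzero[OF inf] in \<open>auto simp: ring_hom_on_ev3\<close>)
  then have "n dvd x \<or> n dvd y"
    using prime prime_elem_dvd_mult_iff by blast
  moreover have "ev F v = 0 \<longrightarrow> ?E z v = 0" if "n dvd z" for z v
  proof -
    obtain w where "z = n * w"
      using \<open>n dvd z\<close> ..
    then show ?thesis
      using Em[where x = n and y = w and v = v] n[of v] by simp
  qed
  ultimately show ?thesis
    using x y by metis
qed


section \<open>Linear algebra in three and four coordinates\<close>

definition dot :: "'a::comm_ring_1 ^ 'n::finite \<Rightarrow> 'a ^ 'n \<Rightarrow> 'a" where
  "dot x y = (\<Sum>i\<in>UNIV. x $ i * y $ i)"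

lemma dot_simps: "dot x (y + z) = dot x y + dot x z" "dot (x + y) z = dot x z + dot y z"
  "dot x (c *s y) = c * dot x y" "dot (c *s x) y = c * dot x y" "dot x 0 = 0" "dot 0 x = 0"
  "dot x (y - z) = dot x y - dot x z"
  by (simp_all add: dot_def algebra_simps sum.distrib sum_distrib_left sum_subtractf)

lemma dot_commute: "dot x y = dot y x"
  by (simp add: dot_def mult.commute)

lemma dot_axis: "dot x (axis i 1) = x $ i"
  by (simp add: dot_def axis_def if_distrib cong: if_cong)

definition det3 :: "'a::comm_ring_1 ^ 3 \<Rightarrow> 'a ^ 3 \<Rightarrow> 'a ^ 3 \<Rightarrow> 'a" where
  "det3 a b c = a $ 1 * (b $ 2 * c $ 3 - b $ 3 * c $ 2) + a $ 2 * (b $ 3 * c $ 1 - b $ 1 * c $ 3)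
    + a $ 3 * (b $ 1 * c $ 2 - b $ 2 * c $ 1)"

lemma det3_linear: "det3 (a + a') b c = det3 a b c + det3 a' b c" "det3 a (b + b') c = det3 a b c + det3 a b' c"
  "det3 a b (c + c') = det3 a b c + det3 a b c'" "det3 (t *s a) b c = t * det3 a b c"
  "det3 a (t *s b) c = t * det3 a b c" "det3 a b (t *s c) = t * det3 a b c"
  by (simp_all add: det3_def algebra_simps)

lemma det3_same: "det3 a a b = 0" "det3 a b a = 0" "det3 b a a = 0"
  by (simp_all add: det3_def algebra_simps)

lemma det3_swap: "det3 b a c = - det3 a b c" "det3 a c b = - det3 a b c" "det3 c b a = - det3 a b c"
  by (simp_all add: det3_def algebra_simps)

lemma det3_0: "det3 0 a b = 0" "det3 a 0 b = 0" "det3 a b 0 = 0"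
  by (simp_all add: det3_def)

lemma det3_cramer: "det3 a b c *s x = det3 x b c *s a + det3 a x c *s b + det3 a b x *s c"
  by (simp add: vec_eq_iff forall_3 det3_def algebra_simps)

lemma det3_basis:
  fixes a b c :: "'a::field ^ 3"
  assumes "det3 a b c \<noteq> 0"
  obtains r s t where "x = r *s a + s *s b + t *s c"
proof
  have "x = (1 / det3 a b c) *s (det3 a b c *s x)"
    using assms by (simp add: vec_eq_iff)
  also have "\<dots> = (det3 x b c / det3 a b c) *s a + (det3 a x c / det3 a b c) *s b + (det3 a b x / det3 a b c) *s c"
    unfolding det3_cramer[of a b c x] by (simp add: vec_eq_iff field_simps)
  finally show "x = (det3 x b c / det3 a b c) *s a + (det3 a x c / det3 a b c) *s b + (det3 a b x / det3 a b c) *s c" .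
qed

lemma det3_indep:
  fixes a b c :: "'a::field ^ 3"
  assumes "det3 a b c \<noteq> 0" "r *s a + s *s b + t *s c = 0"
  shows "r = 0 \<and> s = 0 \<and> t = 0"
proof -
  have "det3 (r *s a + s *s b + t *s c) b c = 0" "det3 a (r *s a + s *s b + t *s c) c = 0"
    "det3 a b (r *s a + s *s b + t *s c) = 0"
    unfolding assms(2) by (simp_all add: det3_0)
  then show ?thesis
    using assms(1) by (simp add: det3_linear det3_same)
qed

lemma det3_nondegenerate:
  fixes z w :: "'a::field ^ 3"
  assumes "z \<noteq> 0" "\<And>x. det3 z w x = 0"
  obtains c where "w = c *s z"
proof -
  have m: "z $ 1 * w $ 2 = z $ 2 * w $ 1" "z $ 2 * w $ 3 = z $ 3 * w $ 2" "z $ 3 * w $ 1 = z $ 1 * w $ 3"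
    using assms(2)[of "axis 1 1"] assms(2)[of "axis 2 1"] assms(2)[of "axis 3 1"]
    by (simp_all add: det3_def axis_def algebra_simps)
  obtain i where "z $ i \<noteq> 0"
    using assms(1) by (metis vec_eq_iff zero_index)
  then have "w = (w $ i / z $ i) *s z"
    using m exhaust_3[of i] by (auto simp: vec_eq_iff forall_3 field_simps)
  then show thesis
    by (rule that)
qed

lemma det3_complete:
  fixes z :: "'a::field ^ 3"
  assumes "z \<noteq> 0"
  obtains u v where "det3 z u v \<noteq> 0"
proof -
  obtain i where i: "z $ i \<noteq> 0"
    using assms by (metis vec_eq_iff zero_index)
  have "z $ 1 = det3 z (axis 2 1) (axis 3 1)" "z $ 2 = det3 z (axis 3 1) (axis 1 1)"
    "z $ 3 = det3 z (axis 1 1) (axis 2 1)"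
    by (simp_all add: det3_def axis_def)
  then show thesis
    using that i exhaust_3[of i] by metis
qed

text \<open>The signed maximal minors of the 3 x 4 matrix with rows \<open>a, b, c\<close>: a normal
  of their span, and \<open>dot d (cross4 a b c)\<close> is a 4 x 4 determinant up to sign.\<close>

definition cross4 :: "'a::comm_ring_1 ^ 4 \<Rightarrow> 'a ^ 4 \<Rightarrow> 'a ^ 4 \<Rightarrow> 'a ^ 4" where
  "cross4 a b c = (\<chi> i.
    if i = 1 then a $ 2 * (b $ 3 * c $ 4 - b $ 4 * c $ 3) + a $ 3 * (b $ 4 * c $ 2 - b $ 2 * c $ 4)
      + a $ 4 * (b $ 2 * c $ 3 - b $ 3 * c $ 2)
    else if i = 2 then - (a $ 1 * (b $ 3 * c $ 4 - b $ 4 * c $ 3) + a $ 3 * (b $ 4 * c $ 1 - b $ 1 * c $ 4)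
      + a $ 4 * (b $ 1 * c $ 3 - b $ 3 * c $ 1))
    else if i = 3 then a $ 1 * (b $ 2 * c $ 4 - b $ 4 * c $ 2) + a $ 2 * (b $ 4 * c $ 1 - b $ 1 * c $ 4)
      + a $ 4 * (b $ 1 * c $ 2 - b $ 2 * c $ 1)
    else - (a $ 1 * (b $ 2 * c $ 3 - b $ 3 * c $ 2) + a $ 2 * (b $ 3 * c $ 1 - b $ 1 * c $ 3)
      + a $ 3 * (b $ 1 * c $ 2 - b $ 2 * c $ 1)))"

lemma cross4_nth:
  "cross4 a b c $ 1 = a $ 2 * (b $ 3 * c $ 4 - b $ 4 * c $ 3) + a $ 3 * (b $ 4 * c $ 2 - b $ 2 * c $ 4)
    + a $ 4 * (b $ 2 * c $ 3 - b $ 3 * c $ 2)"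
  "cross4 a b c $ 2 = - (a $ 1 * (b $ 3 * c $ 4 - b $ 4 * c $ 3) + a $ 3 * (b $ 4 * c $ 1 - b $ 1 * c $ 4)
    + a $ 4 * (b $ 1 * c $ 3 - b $ 3 * c $ 1))"
  "cross4 a b c $ 3 = a $ 1 * (b $ 2 * c $ 4 - b $ 4 * c $ 2) + a $ 2 * (b $ 4 * c $ 1 - b $ 1 * c $ 4)
    + a $ 4 * (b $ 1 * c $ 2 - b $ 2 * c $ 1)"
  "cross4 a b c $ 4 = - (a $ 1 * (b $ 2 * c $ 3 - b $ 3 * c $ 2) + a $ 2 * (b $ 3 * c $ 1 - b $ 1 * c $ 3)
    + a $ 3 * (b $ 1 * c $ 2 - b $ 2 * c $ 1))"
  by (simp_all add: cross4_def)

lemma cross4_linear: "cross4 (a + a') b c = cross4 a b c + cross4 a' b c"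
  "cross4 a (b + b') c = cross4 a b c + cross4 a b' c"
  "cross4 a b (c + c') = cross4 a b c + cross4 a b c'" "cross4 (t *s a) b c = t *s cross4 a b c"
  "cross4 a (t *s b) c = t *s cross4 a b c" "cross4 a b (t *s c) = t *s cross4 a b c"
  by (simp_all add: vec_eq_iff forall_4 cross4_nth algebra_simps)

lemma cross4_same: "cross4 a a b = 0" "cross4 a b a = 0" "cross4 b a a = 0"
  by (simp_all add: vec_eq_iff forall_4 cross4_nth algebra_simps)

lemma cross4_swap: "cross4 b a c = - cross4 a b c" "cross4 a c b = - cross4 a b c"
  by (simp_all add: vec_eq_iff forall_4 cross4_nth algebra_simps)

lemma dot_cross4 [simp]: "dot a (cross4 a b c) = 0" "dot b (cross4 a b c) = 0" "dot c (cross4 a b c) = 0"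
  by (simp_all add: dot_def sum_4 cross4_nth algebra_simps)

lemma dot_cross4_swap: "dot d (cross4 a b c) = - dot a (cross4 d b c)"
  "dot d (cross4 a b c) = - dot b (cross4 a d c)" "dot d (cross4 a b c) = - dot c (cross4 a b d)"
  by (simp_all add: dot_def sum_4 cross4_nth algebra_simps)

lemma proportional_cases:
  fixes p q :: "'a::field ^ 'n"
  assumes "\<And>i j. p $ i * q $ j = p $ j * q $ i" "q \<noteq> 0"
  obtains c where "p = c *s q"
proof -
  obtain j where j: "q $ j \<noteq> 0"
    using assms(2) by (metis vec_eq_iff zero_index)
  have "p $ i = ((p $ j / q $ j) *s q) $ i" for i
    using assms(1)[of i j] j by (simp add: field_simps)
  then have "p = (p $ j / q $ j) *s q"
    unfolding vec_eq_iff by blast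
  then show thesis
    by (rule that)
qed

text \<open>Each 2 x 2 minor of \<open>p\<close> and the cross product is a combination of the three
  dot products, with 2 x 2 minors of \<open>a, b, c\<close> as coefficients.\<close>

lemma cross4_proportional:
  assumes "dot p a = 0" "dot p b = 0" "dot p c = 0"
  shows "p $ i * cross4 a b c $ j = p $ j * cross4 a b c $ i"
proof -
  have
    "p $ 1 * cross4 a b c $ 2 - p $ 2 * cross4 a b c $ 1 = - (dot p a * (b $ 3 * c $ 4 - b $ 4 * c $ 3) + dot p b * (c $ 3 * a $ 4 - c $ 4 * a $ 3) + dot p c * (a $ 3 * b $ 4 - a $ 4 * b $ 3))"
    "p $ 1 * cross4 a b c $ 3 - p $ 3 * cross4 a b c $ 1 =  (dot p a * (b $ 2 * c $ 4 - b $ 4 * c $ 2) + dot p b * (c $ 2 * a $ 4 - c $ 4 * a $ 2) + dot p c * (a $ 2 * b $ 4 - a $ 4 * b $ 2))"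
    "p $ 1 * cross4 a b c $ 4 - p $ 4 * cross4 a b c $ 1 = - (dot p a * (b $ 2 * c $ 3 - b $ 3 * c $ 2) + dot p b * (c $ 2 * a $ 3 - c $ 3 * a $ 2) + dot p c * (a $ 2 * b $ 3 - a $ 3 * b $ 2))"
    "p $ 2 * cross4 a b c $ 3 - p $ 3 * cross4 a b c $ 2 = - (dot p a * (b $ 1 * c $ 4 - b $ 4 * c $ 1) + dot p b * (c $ 1 * a $ 4 - c $ 4 * a $ 1) + dot p c * (a $ 1 * b $ 4 - a $ 4 * b $ 1))"
    "p $ 2 * cross4 a b c $ 4 - p $ 4 * cross4 a b c $ 2 =  (dot p a * (b $ 1 * c $ 3 - b $ 3 * c $ 1) + dot p b * (c $ 1 * a $ 3 - c $ 3 * a $ 1) + dot p c * (a $ 1 * b $ 3 - a $ 3 * b $ 1))"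
    "p $ 3 * cross4 a b c $ 4 - p $ 4 * cross4 a b c $ 3 = - (dot p a * (b $ 1 * c $ 2 - b $ 2 * c $ 1) + dot p b * (c $ 1 * a $ 2 - c $ 2 * a $ 1) + dot p c * (a $ 1 * b $ 2 - a $ 2 * b $ 1))"
    by (simp_all add: dot_def sum_4 cross4_nth algebra_simps)
  then have "\<forall>i j. p $ i * cross4 a b c $ j = p $ j * cross4 a b c $ i"
    by (simp add: forall_4 assms)
  then show ?thesis
    by blast
qed

text \<open>If \<open>a\<close> and \<open>b\<close> have a nonzero minor in the columns
  \<open>k, l\<close>, the minors in these columns are the coefficients of a relation: each of its
  entries is a determinant with a repeated column or a component of the cross product.\<close>

lemma cross4_eq_0:
  fixes a b c :: "'a::field ^ 4"
  assumes "cross4 a b c = 0"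
  obtains r s t where "(r, s, t) \<noteq> (0, 0, 0)" "r *s a + s *s b + t *s c = 0"
proof (cases "\<exists>k l. a $ k * b $ l \<noteq> a $ l * b $ k")
  case True
  then obtain k l where kl: "a $ k * b $ l - a $ l * b $ k \<noteq> 0"
    by auto
  have m:
    "(b $ 1 * c $ 2 - b $ 2 * c $ 1) * a $ 3 + (c $ 1 * a $ 2 - c $ 2 * a $ 1) * b $ 3 + (a $ 1 * b $ 2 - a $ 2 * b $ 1) * c $ 3 = - cross4 a b c $ 4"
    "(b $ 1 * c $ 2 - b $ 2 * c $ 1) * a $ 4 + (c $ 1 * a $ 2 - c $ 2 * a $ 1) * b $ 4 + (a $ 1 * b $ 2 - a $ 2 * b $ 1) * c $ 4 =  cross4 a b c $ 3"
    "(b $ 1 * c $ 3 - b $ 3 * c $ 1) * a $ 2 + (c $ 1 * a $ 3 - c $ 3 * a $ 1) * b $ 2 + (a $ 1 * b $ 3 - a $ 3 * b $ 1) * c $ 2 =  cross4 a b c $ 4"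
    "(b $ 1 * c $ 3 - b $ 3 * c $ 1) * a $ 4 + (c $ 1 * a $ 3 - c $ 3 * a $ 1) * b $ 4 + (a $ 1 * b $ 3 - a $ 3 * b $ 1) * c $ 4 = - cross4 a b c $ 2"
    "(b $ 1 * c $ 4 - b $ 4 * c $ 1) * a $ 2 + (c $ 1 * a $ 4 - c $ 4 * a $ 1) * b $ 2 + (a $ 1 * b $ 4 - a $ 4 * b $ 1) * c $ 2 = - cross4 a b c $ 3"
    "(b $ 1 * c $ 4 - b $ 4 * c $ 1) * a $ 3 + (c $ 1 * a $ 4 - c $ 4 * a $ 1) * b $ 3 + (a $ 1 * b $ 4 - a $ 4 * b $ 1) * c $ 3 =  cross4 a b c $ 2"
    "(b $ 2 * c $ 1 - b $ 1 * c $ 2) * a $ 3 + (c $ 2 * a $ 1 - c $ 1 * a $ 2) * b $ 3 + (a $ 2 * b $ 1 - a $ 1 * b $ 2) * c $ 3 =  cross4 a b c $ 4"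
    "(b $ 2 * c $ 1 - b $ 1 * c $ 2) * a $ 4 + (c $ 2 * a $ 1 - c $ 1 * a $ 2) * b $ 4 + (a $ 2 * b $ 1 - a $ 1 * b $ 2) * c $ 4 = - cross4 a b c $ 3"
    "(b $ 2 * c $ 3 - b $ 3 * c $ 2) * a $ 1 + (c $ 2 * a $ 3 - c $ 3 * a $ 2) * b $ 1 + (a $ 2 * b $ 3 - a $ 3 * b $ 2) * c $ 1 = - cross4 a b c $ 4"
    "(b $ 2 * c $ 3 - b $ 3 * c $ 2) * a $ 4 + (c $ 2 * a $ 3 - c $ 3 * a $ 2) * b $ 4 + (a $ 2 * b $ 3 - a $ 3 * b $ 2) * c $ 4 =  cross4 a b c $ 1"
    "(b $ 2 * c $ 4 - b $ 4 * c $ 2) * a $ 1 + (c $ 2 * a $ 4 - c $ 4 * a $ 2) * b $ 1 + (a $ 2 * b $ 4 - a $ 4 * b $ 2) * c $ 1 =  cross4 a b c $ 3"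
    "(b $ 2 * c $ 4 - b $ 4 * c $ 2) * a $ 3 + (c $ 2 * a $ 4 - c $ 4 * a $ 2) * b $ 3 + (a $ 2 * b $ 4 - a $ 4 * b $ 2) * c $ 3 = - cross4 a b c $ 1"
    "(b $ 3 * c $ 1 - b $ 1 * c $ 3) * a $ 2 + (c $ 3 * a $ 1 - c $ 1 * a $ 3) * b $ 2 + (a $ 3 * b $ 1 - a $ 1 * b $ 3) * c $ 2 = - cross4 a b c $ 4"
    "(b $ 3 * c $ 1 - b $ 1 * c $ 3) * a $ 4 + (c $ 3 * a $ 1 - c $ 1 * a $ 3) * b $ 4 + (a $ 3 * b $ 1 - a $ 1 * b $ 3) * c $ 4 =  cross4 a b c $ 2"
    "(b $ 3 * c $ 2 - b $ 2 * c $ 3) * a $ 1 + (c $ 3 * a $ 2 - c $ 2 * a $ 3) * b $ 1 + (a $ 3 * b $ 2 - a $ 2 * b $ 3) * c $ 1 =  cross4 a b c $ 4"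
    "(b $ 3 * c $ 2 - b $ 2 * c $ 3) * a $ 4 + (c $ 3 * a $ 2 - c $ 2 * a $ 3) * b $ 4 + (a $ 3 * b $ 2 - a $ 2 * b $ 3) * c $ 4 = - cross4 a b c $ 1"
    "(b $ 3 * c $ 4 - b $ 4 * c $ 3) * a $ 1 + (c $ 3 * a $ 4 - c $ 4 * a $ 3) * b $ 1 + (a $ 3 * b $ 4 - a $ 4 * b $ 3) * c $ 1 = - cross4 a b c $ 2"
    "(b $ 3 * c $ 4 - b $ 4 * c $ 3) * a $ 2 + (c $ 3 * a $ 4 - c $ 4 * a $ 3) * b $ 2 + (a $ 3 * b $ 4 - a $ 4 * b $ 3) * c $ 2 =  cross4 a b c $ 1"
    "(b $ 4 * c $ 1 - b $ 1 * c $ 4) * a $ 2 + (c $ 4 * a $ 1 - c $ 1 * a $ 4) * b $ 2 + (a $ 4 * b $ 1 - a $ 1 * b $ 4) * c $ 2 =  cross4 a b c $ 3"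
    "(b $ 4 * c $ 1 - b $ 1 * c $ 4) * a $ 3 + (c $ 4 * a $ 1 - c $ 1 * a $ 4) * b $ 3 + (a $ 4 * b $ 1 - a $ 1 * b $ 4) * c $ 3 = - cross4 a b c $ 2"
    "(b $ 4 * c $ 2 - b $ 2 * c $ 4) * a $ 1 + (c $ 4 * a $ 2 - c $ 2 * a $ 4) * b $ 1 + (a $ 4 * b $ 2 - a $ 2 * b $ 4) * c $ 1 = - cross4 a b c $ 3"
    "(b $ 4 * c $ 2 - b $ 2 * c $ 4) * a $ 3 + (c $ 4 * a $ 2 - c $ 2 * a $ 4) * b $ 3 + (a $ 4 * b $ 2 - a $ 2 * b $ 4) * c $ 3 =  cross4 a b c $ 1"
    "(b $ 4 * c $ 3 - b $ 3 * c $ 4) * a $ 1 + (c $ 4 * a $ 3 - c $ 3 * a $ 4) * b $ 1 + (a $ 4 * b $ 3 - a $ 3 * b $ 4) * c $ 1 =  cross4 a b c $ 2"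
    "(b $ 4 * c $ 3 - b $ 3 * c $ 4) * a $ 2 + (c $ 4 * a $ 3 - c $ 3 * a $ 4) * b $ 2 + (a $ 4 * b $ 3 - a $ 3 * b $ 4) * c $ 2 = - cross4 a b c $ 1"
    by (simp_all add: cross4_nth algebra_simps)
  have "\<forall>k l i. (b $ k * c $ l - b $ l * c $ k) * a $ i + (c $ k * a $ l - c $ l * a $ k) * b $ i
      + (a $ k * b $ l - a $ l * b $ k) * c $ i = 0"
    unfolding forall_4 m assms by (simp add: algebra_simps)
  then have "(b $ k * c $ l - b $ l * c $ k) *s a + (c $ k * a $ l - c $ l * a $ k) *s b
      + (a $ k * b $ l - a $ l * b $ k) *s c = 0"
    by (simp add: vec_eq_iff)
  then show thesis
    using that kl by blast
next
  case False
  show thesis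
  proof (cases "a = 0")
    case True
    then show ?thesis
      using that[of 1 0 0] by simp
  next
    case a: False
    then obtain k where "a $ k \<noteq> 0"
      by (metis vec_eq_iff zero_index)
    moreover have "b $ k * a $ i + (- a $ k) * b $ i = 0" for i
      using False by (simp add: mult.commute)
    then have "b $ k *s a + (- a $ k) *s b + 0 *s c = 0"
      unfolding vec_eq_iff by simp
    ultimately show ?thesis
      using that[of "b $ k" "- a $ k" 0] by auto
  qed
qed

text \<open>Four independent vectors would be the columns of an invertible matrix, and
  \<open>h\<close> would be orthogonal to everything.\<close>

lemma vectors_in_hyperplane_dependent:
  fixes a b c d h :: "'a::field ^ 4"
  assumes "h \<noteq> 0" "dot h a = 0" "dot h b = 0" "dot h c = 0" "dot h d = 0"
  obtains r s t u where "(r, s, t, u) \<noteq> (0, 0, 0, 0)" "r *s a + s *s b + t *s c + u *s d = 0"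
proof (rule ccontr)
  note obt = that
  assume "\<not> thesis"
  then have ind: "(r, s, t, u) = (0, 0, 0, 0)" if "r *s a + s *s b + t *s c + u *s d = 0" for r s t u
    using that obt \<open>\<not> thesis\<close> by blast
  define A :: "'a ^ 4 ^ 4" where "A = (\<chi> i j. if j = 1 then a $ i else if j = 2 then b $ i else if j = 3 then c $ i else d $ i)"
  have A: "A *v x = x $ 1 *s a + x $ 2 *s b + x $ 3 *s c + x $ 4 *s d" for x
    by (simp add: A_def matrix_vector_mult_def vec_eq_iff sum_4 mult.commute)
  have "x = 0" if "A *v x = 0" for x
    using ind[of "x $ 1" "x $ 2" "x $ 3" "x $ 4"] that by (simp add: A vec_eq_iff forall_4)
  then obtain B where "B ** A = mat 1"
    using matrix_left_invertible_ker[of A] by blast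
  then have AB: "A ** B = mat 1"
    using matrix_left_right_inverse by blast
  have "dot h y = 0" for y
  proof -
    have "dot h (A *v x) = 0" for x
      unfolding A by (simp add: dot_simps assms)
    from this[of "B *v y"] show ?thesis
      by (simp add: matrix_vector_mul_assoc AB)
  qed
  then have "h = 0"
    by (metis dot_axis vec_eq_iff zero_index)
  then show False
    using assms(1) by simp
qed


section \<open>The inverse map and its base points\<close>

definition eval_vec :: "('m::finite \<Rightarrow> ('a::comm_ring_1, 'n::finite) mpoly) \<Rightarrow> 'a ^ 'n \<Rightarrow> 'a ^ 'm" where
  "eval_vec g x = (\<chi> i. ev (g i) x)"

definition dder_vec :: "('m::finite \<Rightarrow> ('a::comm_ring_1, 'n::finite) mpoly) \<Rightarrow> 'a ^ 'n \<Rightarrow> 'a ^ 'n \<Rightarrow> 'a ^ 'm" where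
  "dder_vec g x u = (\<chi> i. dder (g i) x u)"

lemma eval_vec_nth [simp]: "eval_vec g x $ i = ev (g i) x"
  by (simp add: eval_vec_def)

lemma dder_vec_nth [simp]: "dder_vec g x u $ i = dder (g i) x u"
  by (simp add: dder_vec_def)

lemma dder_vec_linear: "dder_vec g x (u + v) = dder_vec g x u + dder_vec g x v"
  "dder_vec g x (c *s u) = c *s dder_vec g x u" "dder_vec g x 0 = 0"
  by (simp_all add: vec_eq_iff dder_add dder_scale)

lemma eval_vec_scale:
  assumes "\<And>i. homogeneous d (g i)"
  shows "eval_vec g (c *s x) = c ^ d *s eval_vec g x"
  by (simp add: vec_eq_iff mp_eval_scale[OF assms])

text \<open>The direction \<open>v\<close> is the point at infinity of the line; exchanging the two
  charts makes it the value at 0.\<close>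

lemma line_poly_nonzero:
  fixes G :: "('a::field, 'n::finite) mpoly"
  assumes "infinite (UNIV :: 'a set)" "homogeneous d G" "ev G v \<noteq> 0"
  shows "line_poly G x v \<noteq> 0"
proof
  assume 0: "line_poly G x v = 0"
  have "line_poly G v x = 0"
  proof (rule poly_eqI_infinite)
    show "infinite (UNIV - {0 :: 'a})"
      using assms(1) by simp
  next
    fix t :: 'a assume "t \<in> UNIV - {0}"
    then have "v + t *s x = t *s (x + (1 / t) *s v)"
      by (simp add: vec_eq_iff field_simps)
    then have "ev G (v + t *s x) = t ^ d * ev G (x + (1 / t) *s v)"
      using mp_eval_scale[OF assms(2)] by metis
    then show "poly (line_poly G v x) t = poly 0 t"
      using poly_line_poly[of G x v "1 / t"] by (simp add: poly_line_poly 0)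
  qed
  then show False
    using poly_line_poly[of G v x 0] assms(3) by simp
qed

lemma proj_relI: "v \<noteq> 0 \<Longrightarrow> c \<noteq> 0 \<Longrightarrow> proj_rel v (c *s v)"
  by (auto simp: proj_rel_def vec_eq_iff)

lemma abs_proj_eq_iff:
  assumes "v \<noteq> 0" "w \<noteq> 0"
  shows "abs_proj v = abs_proj w \<longleftrightarrow> (\<exists>c. c \<noteq> 0 \<and> w = c *s v)"
proof -
  have "proj_rel v v" "proj_rel w w"
    using assms proj_relI[of _ 1] by auto
  then have "abs_proj v = abs_proj w \<longleftrightarrow> proj_rel v w"
    using Quotient3_rel[OF Quotient3_proj, of v w] by auto
  then show ?thesis
    using assms by (auto simp: proj_rel_def)
qed

text \<open>Stated on vectors instead of points, so that the values of the forms enter polynomial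
  identities directly.\<close>

definition local_rep ::
  "('a::field, 4) mpoly \<Rightarrow> (('a, 4) proj \<Rightarrow> ('a, 3) proj) \<Rightarrow> (3 \<Rightarrow> ('a, 4) mpoly) \<Rightarrow> ('a, 4) mpoly \<Rightarrow> bool" where
  "local_rep F p g h \<longleftrightarrow> (\<exists>d. \<forall>i. homogeneous d (g i)) \<and> (\<exists>e. homogeneous e h) \<and>
     (\<forall>v. v \<noteq> 0 \<longrightarrow> ev F v = 0 \<longrightarrow> ev h v \<noteq> 0 \<longrightarrow>
        eval_vec g v \<noteq> 0 \<and> p (abs_proj v) = abs_proj (eval_vec g v))"

text \<open>Proportionality is expressed by 2 x 2 minors because these equations are linear in
  \<open>q\<close>: solutions can be divided by a common factor and descended to a smaller
  field.\<close>

definition prop_forms :: "('m::finite \<Rightarrow> ('a::comm_ring_1, 'n::finite) mpoly) \<Rightarrow> nat \<Rightarrow> ('m \<Rightarrow> ('a, 'n) mpoly) \<Rightarrow> bool" where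
  "prop_forms g d q \<longleftrightarrow> (\<forall>i. homogeneous d (q i)) \<and> (\<exists>i. q i \<noteq> 0) \<and>
     (\<forall>i j x. ev (g i) x * ev (q j) x = ev (g j) x * ev (q i) x)"

text \<open>On the set where \<open>chi\<close> does not vanish, the forms \<open>g0\<close> give the inverse of \<open>p\<close>, which is
  injective where \<open>tau\<close> does not vanish; \<open>q\<close> is a representation of this inverse of least degree.\<close>

locale cubic_parametrization =
  fixes F :: "('a::{alg_closed_field,field_gcd}, 4) mpoly"
    and p :: "('a, 4) proj \<Rightarrow> ('a, 3) proj"
    and g0 :: "4 \<Rightarrow> ('a, 3) mpoly" and chi :: "('a, 3) mpoly" and tau :: "('a, 4) mpoly"
    and q :: "4 \<Rightarrow> ('a, 3) mpoly" and d :: nat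
  assumes hom_F: "homogeneous 3 F" and smooth_F: "smooth_form F"
    and ex_local_rep: "\<And>v. v \<noteq> 0 \<Longrightarrow> ev F v = 0 \<Longrightarrow> \<exists>g h. local_rep F p g h \<and> ev h v \<noteq> 0"
    and hom_chi: "\<exists>n. homogeneous n chi" and chi_nonzero: "\<exists>x. ev chi x \<noteq> 0"
    and g0: "\<And>x. x \<noteq> 0 \<Longrightarrow> ev chi x \<noteq> 0 \<Longrightarrow>
      eval_vec g0 x \<noteq> 0 \<and> ev F (eval_vec g0 x) = 0 \<and> p (abs_proj (eval_vec g0 x)) = abs_proj x"
    and tau_nonzero: "\<exists>v. ev F v = 0 \<and> ev tau v \<noteq> 0"
    and inverse: "\<And>v x. v \<noteq> 0 \<Longrightarrow> ev F v = 0 \<Longrightarrow> ev tau v \<noteq> 0 \<Longrightarrow> x \<noteq> 0 \<Longrightarrow> p (abs_proj v) = abs_proj x \<Longrightarrow>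
      ev chi x \<noteq> 0 \<Longrightarrow> abs_proj v = abs_proj (eval_vec g0 x)"
    and q: "prop_forms g0 d q"
    and minimal: "\<And>e r. prop_forms g0 e r \<Longrightarrow> d \<le> e"
begin

lemmas inf = infinite_UNIV_alg_closed[where 'a = 'a]

lemma hom_q: "homogeneous d (q i)"
  using q by (simp add: prop_forms_def)

lemma q_prop: "ev (g0 i) x * ev (q j) x = ev (g0 j) x * ev (q i) x"
  using q by (simp add: prop_forms_def)

lemma q_scale: "eval_vec q (c *s x) = c ^ d *s eval_vec q x"
  by (rule eval_vec_scale[OF hom_q])

lemma ex_nonbase: "\<exists>x. x $ 3 \<noteq> 0 \<and> eval_vec q x \<noteq> 0"
proof -
  obtain i where "q i \<noteq> 0"
    using q by (auto simp: prop_forms_def)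
  then obtain x where "ev (q i) x \<noteq> 0"
    using ev_eq_0_imp[OF inf] by blast
  moreover have "(axis 3 1 :: 'a ^ 3) $ 3 \<noteq> 0"
    by (simp add: axis_def)
  ultimately obtain x where "ev (q i) x \<noteq> 0" "x $ 3 \<noteq> 0"
    using polyfun_common_nonzero[OF inf polyfun_ev polyfun_nth] by blast
  then show ?thesis
    by (auto simp: vec_eq_iff)
qed

text \<open>A common factor of the forms \<open>q\<close> is homogeneous, and the cofactors
  represent the same map. Minimality of \<open>d\<close> leaves only degree 0 for the
  factor.\<close>

lemma common_factor_constant:
  fixes f :: "'a ^ 3 \<Rightarrow> 'a" and r :: "4 \<Rightarrow> 'a ^ 3 \<Rightarrow> 'a"
  assumes "polyfun f" "\<And>i. polyfun (r i)" "\<And>i x. f x * r i x = ev (q i) x"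
  shows "f x = f 0" "f x \<noteq> 0"
proof -
  obtain i0 where "q i0 \<noteq> 0"
    using q by (auto simp: prop_forms_def)
  then obtain x0 where x0: "ev (q i0) x0 \<noteq> 0"
    using ev_eq_0_imp[OF inf] by blast
  have sc: "ev (q i) (t *s x) = t ^ d * ev (q i) x" for i t x
    by (rule mp_eval_scale[OF hom_q])
  obtain a b where ab: "a + b = d" "\<And>t x. f (t *s x) = t ^ a * f x" "\<And>t x. r i0 (t *s x) = t ^ b * r i0 x"
    using homogeneous_factor[OF inf assms(1,2,3) sc x0] by blast
  have f0: "f x0 \<noteq> 0"
    using assms(3)[of x0 i0] x0 by auto
  \<comment> \<open>The degree of \<open>f\<close> was found with \<open>i0\<close>. Any other
    nonzero form yields the same degree for \<open>f\<close>, and for a vanishing form the cofactor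
    vanishes.\<close>
  have rs: "r i (t *s x) = t ^ b * r i x" for i t x
  proof (cases "\<exists>y. ev (q i) y \<noteq> 0")
    case True
    then obtain y where y: "ev (q i) y \<noteq> 0" by blast
    obtain a' b' where ab': "a' + b' = d" "\<And>t x. f (t *s x) = t ^ a' * f x" "\<And>t x. r i (t *s x) = t ^ b' * r i x"
      using homogeneous_factor[OF inf assms(1,2,3) sc y] by blast
    have "monom (f x0) a = monom (f x0) a'"
      by (rule poly_eqI_infinite[OF inf]) (metis ab(2) ab'(2) poly_monom mult.commute)
    then have "a = a'"
      using f0 by (metis degree_monom_eq)
    then show ?thesis
      using ab(1) ab'(1,3) by auto
  next
    case False
    have "r i y = 0" for y
      by (rule polyfun_mult_eq_0[OF inf assms(1,2) _ f0]) (metis False assms(3) mult_eq_0_iff)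
    then show ?thesis by simp
  qed
  have "\<exists>R. homogeneous b R \<and> r i = ev R" for i
    using polyfun_homogeneousE[OF inf assms(2) rs] by blast
  then obtain R where R: "\<And>i. homogeneous b (R i)" "\<And>i. r i = ev (R i)"
    by metis
  have "prop_forms g0 b R"
    unfolding prop_forms_def
  proof (intro conjI allI)
    show "\<exists>i. R i \<noteq> 0"
    proof (rule exI[of _ i0])
      show "R i0 \<noteq> 0"
        using x0 assms(3)[of x0 i0] by (auto simp: R(2))
    qed
    fix i j y
    have "polyfun (\<lambda>y. ev (g0 i) y * r j y - ev (g0 j) y * r i y)"
      by (intro polyfun_diff polyfun_mult polyfun_ev assms)
    moreover have "ev (g0 i) y * r j y - ev (g0 j) y * r i y = 0" if "f y \<noteq> 0" for y
    proof -
      have "f y * (ev (g0 i) y * r j y - ev (g0 j) y * r i y)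
        = ev (g0 i) y * (f y * r j y) - ev (g0 j) y * (f y * r i y)"
        by (simp add: algebra_simps)
      then show ?thesis
        using that unfolding assms(3) by (simp add: q_prop)
    qed
    ultimately have "ev (g0 i) y * r j y - ev (g0 j) y * r i y = 0"
      using polyfun_mult_eq_0[OF inf assms(1) _ _ f0] by blast
    then show "ev (g0 i) y * ev (R j) y = ev (g0 j) y * ev (R i) y"
      by (simp add: R(2))
  qed (rule R(1))
  then have "a = 0"
    using minimal[of b R] ab(1) by simp
  then have const: "f y = f 0" for y
    using ab(2)[of 0 y] by simp
  then show "f x = f 0" "f x \<noteq> 0"
    using f0 by metis+
qed

text \<open>Eliminating \<open>t\<close>: no prime factor of one of the forms divides all of them, as \<open>d\<close> is minimal.
  Hence each prime factor yields a nonzero polynomial in \<open>s0, s1\<close> that vanishes at the base points.\<close>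

lemma nonbase_lines:
  assumes Q: "Q $ 3 \<noteq> 0" "eval_vec q Q \<noteq> 0"
  obtains r where "r \<noteq> 0" "\<And>s0 s1 t. ev2 s0 s1 r \<noteq> 0 \<Longrightarrow>
    eval_vec q (s0 *s axis 1 1 + s1 *s axis 2 1 + t *s Q) \<noteq> 0"
proof -
  let ?pt = "\<lambda>s0 s1 t. s0 *s axis 1 1 + s1 *s axis 2 1 + t *s Q"
  have "\<exists>n. \<forall>s0 s1 t. ev3 s0 s1 t n = ev (q i) (?pt s0 s1 t)" for i
    by (rule polyfun_imp_ev3[OF polyfun_ev])
  then obtain n where n: "\<And>i s0 s1 t. ev3 s0 s1 t (n i) = ev (q i) (?pt s0 s1 t)"
    by metis
  \<comment> \<open>\<open>c0\<close>, \<open>c1\<close>, \<open>c2\<close> are the coordinates in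
    the basis \<open>axis 1 1\<close>, \<open>axis 2 1\<close>, \<open>Q\<close>, which is a basis
    because \<open>Q $ 3\<close> is not zero.\<close>
  define c0 where "c0 x = x $ 1 - x $ 3 / Q $ 3 * Q $ 1" for x :: "'a ^ 3"
  define c1 where "c1 x = x $ 2 - x $ 3 / Q $ 3 * Q $ 2" for x :: "'a ^ 3"
  define c2 where "c2 x = x $ 3 / Q $ 3" for x :: "'a ^ 3"
  have pt: "?pt (c0 x) (c1 x) (c2 x) = x" for x
    using Q(1) by (simp add: vec_eq_iff forall_3 c0_def c1_def c2_def axis_def)
  have co: "c0 (?pt s0 s1 t) = s0" "c1 (?pt s0 s1 t) = s1" "c2 (?pt s0 s1 t) = t" for s0 s1 t
    using Q(1) by (simp_all add: c0_def c1_def c2_def axis_def)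
  have pc2: "polyfun c2"
    unfolding c2_def divide_inverse by (intro polyfun_mult polyfun_nth polyfun_const)
  have "polyfun (\<lambda>x. x $ 1 - c2 x * Q $ 1)" "polyfun (\<lambda>x. x $ 2 - c2 x * Q $ 2)"
    by (intro polyfun_diff polyfun_mult polyfun_nth polyfun_const pc2)+
  then have pc: "polyfun c0" "polyfun c1" "polyfun c2"
    using pc2 unfolding c0_def[abs_def] c1_def[abs_def] by (simp_all add: c2_def)
  obtain i0 where i0: "ev (q i0) Q \<noteq> 0"
    using Q(2) by (auto simp: vec_eq_iff)
  let ?zero = "\<lambda>s0 s1 t. \<forall>i. ev3 s0 s1 t (n i) = 0"
  \<comment> \<open>The common zeros of \<open>m\<close> and all the forms lie over the zero set of
    one nonzero polynomial in \<open>s0, s1\<close>.\<close>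
  define good where "good m \<longleftrightarrow> (\<exists>r. r \<noteq> 0 \<and> (\<forall>s0 s1 t. ?zero s0 s1 t \<longrightarrow> ev3 s0 s1 t m = 0 \<longrightarrow> ev2 s0 s1 r = 0))" for m
  have prime: "good m" if m: "prime_elem m" for m
  proof (cases "degree m = 0")
    case True
    then obtain r where r: "m = [:r:]"
      by (metis degree_eq_zeroE)
    then show ?thesis
      unfolding good_def using m by (intro exI[of _ r]) (auto simp: ev3_def prime_elem_def)
  next
    case False
    have "\<exists>i. \<not> m dvd n i"
    proof (rule ccontr)
      assume "\<not> (\<exists>i. \<not> m dvd n i)"
      then have "\<exists>l. n i = m * l" for i
        by (auto elim: dvdE)
      then obtain l where l: "\<And>i. n i = m * l i"
        by metis
      let ?e = "\<lambda>m x. ev3 (c0 x) (c1 x) (c2 x) m"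
      have "?e m x * ?e (l i) x = ev (q i) x" for i x
        using n[of "c0 x" "c1 x" "c2 x" i] unfolding l pt ring_hom_onD(4)[OF ring_hom_on_ev3] .
      note cf = common_factor_constant[where f = "?e m" and r = "\<lambda>i. ?e (l i)",
          OF polyfun_ev3[OF pc] polyfun_ev3[OF pc] this]
      have const: "?e m x = ?e m 0" for x
        by (rule cf(1))
      let ?c = "?e m 0"
      have "m = [:[:[:?c:]:]:]"
      proof (rule ccontr)
        assume "m \<noteq> [:[:[:?c:]:]:]"
        then obtain s0 s1 t where "ev3 s0 s1 t (m - [:[:[:?c:]:]:]) \<noteq> 0"
          using ev3_nonzero[OF inf, of "m - [:[:[:?c:]:]:]"] by auto
        moreover have "ev3 s0 s1 t (m - [:[:[:?c:]:]:] + [:[:[:?c:]:]:]) = ev3 s0 s1 t (m - [:[:[:?c:]:]:]) + ?c"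
          by (subst ring_hom_onD(3)[OF ring_hom_on_ev3]) simp
        ultimately show False
          using const(1)[of "?pt s0 s1 t"] by (simp add: co)
      qed
      then have "degree m = 0"
        by (metis degree_pCons_0)
      then show False
        using False by simp
    qed
    then obtain i where "\<not> m dvd n i" by blast
    then obtain a b r where r: "r \<noteq> 0" "a * m + b * n i = [:r:]"
      using prime_poly_bezout[OF m] False by blast
    have "ev2 s0 s1 r = 0" if "?zero s0 s1 t" "ev3 s0 s1 t m = 0" for s0 s1 t
    proof -
      have "ev2 s0 s1 r = ev3 s0 s1 t (a * m + b * n i)"
        unfolding r(2) by (simp add: ev3_def)
      also have "\<dots> = 0"
        using that by (simp add: ring_hom_onD[OF ring_hom_on_ev3])
      finally show ?thesis .
    qed
    then show ?thesis
      unfolding good_def using r(1) by blast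
  qed
  have "m \<noteq> 0 \<longrightarrow> good m" for m
  proof (induction m rule: prime_divisors_induct)
    case (unit m)
    then obtain l where "1 = m * l" ..
    then have "ev3 s0 s1 t m * ev3 s0 s1 t l = 1" for s0 s1 t
      using ring_hom_onD(4)[OF ring_hom_on_ev3] ring_hom_onD(2)[OF ring_hom_on_ev3] by metis
    then have "ev3 s0 s1 t m \<noteq> 0" for s0 s1 t
      by (metis mult_zero_left zero_neq_one)
    then show ?case
      unfolding good_def by (intro impI exI[of _ 1]) auto
  next
    case (factor l m)
    show ?case
    proof
      assume "l * m \<noteq> 0"
      then obtain r r' where r: "r \<noteq> 0" "r' \<noteq> 0"
        "\<forall>s0 s1 t. ?zero s0 s1 t \<longrightarrow> ev3 s0 s1 t l = 0 \<longrightarrow> ev2 s0 s1 r = 0"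
        "\<forall>s0 s1 t. ?zero s0 s1 t \<longrightarrow> ev3 s0 s1 t m = 0 \<longrightarrow> ev2 s0 s1 r' = 0"
        using factor prime[of l] unfolding good_def prime_def by auto
      then show "good (l * m)"
        unfolding good_def
        by (intro exI[of _ "r * r'"]) (auto simp: ring_hom_onD[OF ring_hom_on_ev3] ring_hom_onD[OF ring_hom_on_ev2])
    qed
  qed simp
  moreover have "n i0 \<noteq> 0"
    using n[of 0 0 1 i0] i0 by (auto simp: ring_hom_onD[OF ring_hom_on_ev3])
  ultimately obtain r where r: "r \<noteq> 0" "\<forall>s0 s1 t. ?zero s0 s1 t \<longrightarrow> ev3 s0 s1 t (n i0) = 0 \<longrightarrow> ev2 s0 s1 r = 0"
    unfolding good_def by blast
  show thesis
  proof (rule that[OF r(1)])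
    fix s0 s1 t assume "ev2 s0 s1 r \<noteq> 0"
    then show "eval_vec q (?pt s0 s1 t) \<noteq> 0"
      using r(2) unfolding n vec_eq_iff eval_vec_nth zero_index by blast
  qed
qed

text \<open>Project from a point \<open>Q\<close> off the base locus. A line through
  \<open>Q\<close> carries finitely many base points, since \<open>q i0\<close> is not zero at
  \<open>Q\<close>; and by \<open>nonbase_lines\<close> only finitely many of these lines carry
  one.\<close>

lemma finite_base_points:
  obtains Ws where "finite Ws" "\<And>w. w \<in> Ws \<Longrightarrow> w \<noteq> 0 \<and> eval_vec q w = 0"
    "\<And>x. x \<noteq> 0 \<Longrightarrow> eval_vec q x = 0 \<Longrightarrow> \<exists>w\<in>Ws. \<exists>c. c \<noteq> 0 \<and> x = c *s w"
proof -
  obtain Q where Q: "Q $ 3 \<noteq> 0" "eval_vec q Q \<noteq> 0"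
    using ex_nonbase by blast
  obtain i0 where i0: "ev (q i0) Q \<noteq> 0"
    using Q(2) by (auto simp: vec_eq_iff)
  obtain r where r: "r \<noteq> 0" "\<And>s0 s1 t. ev2 s0 s1 r \<noteq> 0 \<Longrightarrow>
      eval_vec q (s0 *s axis 1 1 + s1 *s axis 2 1 + t *s Q) \<noteq> 0"
    using nonbase_lines[OF Q] by blast
  \<comment> \<open>\<open>r\<close> need not be homogeneous. Points with nonzero \<open>s0\<close>
    are rescaled to \<open>s0 = c\<close>, where \<open>c\<close> keeps the leading coefficient of
    \<open>r\<close> in \<open>s1\<close> alive, so that finitely many values of \<open>s1\<close>
    remain.\<close>
  have "finite {s. poly (lead_coeff r * [:0, 1:]) s = 0}"
    using r(1) by (intro poly_roots_finite) auto
  then obtain c where c: "poly (lead_coeff r) c \<noteq> 0" "c \<noteq> 0"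
    using inf by (metis (mono_tags, lifting) UNIV_eq_I mem_Collect_eq mult_eq_0_iff poly_mult poly_pCons poly_0 mult_zero_right add_0)
  define r1 where "r1 = map_poly (\<lambda>p. poly p c) r"
  have "coeff r1 (degree r) \<noteq> 0"
    using c by (simp add: r1_def coeff_map_poly)
  then have r1: "r1 \<noteq> 0"
    by auto
  have r1_ev: "poly r1 s = ev2 c s r" for s
    unfolding r1_def ev2_def
    by (rule poly_map_poly_section[where e = "\<lambda>p. poly p c" and c = "\<lambda>t. [:t:]"]) (auto intro: ring_hom_on_poly)
  let ?L = "\<lambda>y. {t. poly (line_poly (q i0) y Q) t = 0}"
  have finL: "finite (?L y)" for y
    by (rule poly_roots_finite) (rule line_poly_nonzero[OF inf hom_q i0])
  let ?T0 = "(\<lambda>t. axis 2 1 + t *s Q) ` ?L (axis 2 1)"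
  let ?T1 = "\<Union>s\<in>{s. poly r1 s = 0}. (\<lambda>t. (c *s axis 1 1 + s *s axis 2 1) + t *s Q) ` ?L (c *s axis 1 1 + s *s axis 2 1)"
  define Ws where "Ws = {w \<in> ?T0 \<union> ?T1. w \<noteq> 0 \<and> eval_vec q w = 0}"
  have fin: "finite Ws"
    unfolding Ws_def using finL poly_roots_finite[OF r1] by auto
  have cover: "\<exists>w\<in>Ws. \<exists>c. c \<noteq> 0 \<and> x = c *s w" if x: "x \<noteq> 0" "eval_vec q x = 0" for x
  proof -
    define t where "t = x $ 3 / Q $ 3"
    define s0 where "s0 = x $ 1 - t * Q $ 1"
    define s1 where "s1 = x $ 2 - t * Q $ 2"
    have xe: "x = s0 *s axis 1 1 + s1 *s axis 2 1 + t *s Q"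
      using Q(1) by (simp add: vec_eq_iff forall_3 t_def s0_def s1_def axis_def)
    have scaled: "a *s x \<noteq> 0" "eval_vec q (a *s x) = 0" if "a \<noteq> 0" for a
      using that x by (auto simp: q_scale vec_eq_iff)
    have root: "t \<in> ?L y" if "eval_vec q (y + t *s Q) = 0" for y t
      using that by (auto simp: poly_line_poly vec_eq_iff)
    show ?thesis
    proof (cases "s0 = 0")
      case True
      have "s1 \<noteq> 0"
      proof
        assume "s1 = 0"
        then have xQ: "x = t *s Q"
          using xe True by simp
        then have "t \<noteq> 0"
          using x by auto
        then show False
          using x(2) Q(2) unfolding xQ q_scale by simp
      qed
      let ?w = "(1 / s1) *s x"
      have we: "?w = axis 2 1 + (t / s1) *s Q"
        using \<open>s1 \<noteq> 0\<close> True by (subst xe) (simp add: vec_eq_iff field_simps)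
      have "?w \<in> Ws"
        using scaled[of "1 / s1"] \<open>s1 \<noteq> 0\<close> root[of "axis 2 1" "t / s1"] unfolding Ws_def we by auto
      moreover have "x = s1 *s ?w"
        using \<open>s1 \<noteq> 0\<close> by simp
      ultimately show ?thesis
        using \<open>s1 \<noteq> 0\<close> by blast
    next
      case False
      let ?w = "(c / s0) *s x"
      have we: "?w = (c *s axis 1 1 + (c / s0 * s1) *s axis 2 1) + (c / s0 * t) *s Q"
        using False by (subst xe) (simp add: vec_eq_iff field_simps)
      have w: "?w \<noteq> 0" "eval_vec q ?w = 0"
        using scaled[of "c / s0"] c(2) False by auto
      then have "poly r1 (c / s0 * s1) = 0"
        unfolding r1_ev using r(2)[of c "c / s0 * s1" "c / s0 * t"] unfolding we by auto
      then have "?w \<in> Ws"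
        using w root[of "c *s axis 1 1 + (c / s0 * s1) *s axis 2 1" "c / s0 * t"] unfolding Ws_def we by blast
      moreover have "x = (s0 / c) *s ?w"
        using c(2) False by simp
      ultimately show ?thesis
        using c(2) False by (metis divide_eq_0_iff)
    qed
  qed
  show thesis
    by (rule that[of Ws]) (use fin cover in \<open>auto simp: Ws_def\<close>)
qed

end


lemma abs_proj_eqI:
  fixes v w :: "'a::field ^ 'n::finite"
  assumes "v \<noteq> 0" "w \<noteq> 0" "\<And>i j. v $ i * w $ j = v $ j * w $ i"
  shows "abs_proj v = abs_proj w"
proof -
  obtain c where c: "v = c *s w"
    using proportional_cases[OF assms(3,2)] by blast
  then show ?thesis
    using assms(1,2) abs_proj_eq_iff[of w v] by auto
qed

lemma abs_proj_eqD:
  fixes v w :: "'a::field ^ 'n::finite"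
  assumes "abs_proj v = abs_proj w" "v \<noteq> 0" "w \<noteq> 0"
  shows "v $ i * w $ j = v $ j * w $ i"
  using assms abs_proj_eq_iff[of v w] by auto

lemma dder_mult: "dder (F * G) x u = ev F x * dder G x u + dder F x u * ev G x"
  unfolding dder_def line_poly_def mp_eval_mult[OF ring_hom_on_const_poly] coeff_1_mult
  by (simp add: coeff_0_line_poly flip: line_poly_def)

lemma dder_var: "dder (mp_var j) x u = u $ j"
  unfolding dder_def line_poly_def
  by (subst mp_eval_single) (simp_all add: monom_eval_single del: One_nat_def, simp)

text \<open>Having no common root, the \<open>g i\<close> generate the unit ideal. A combination
  equal to a constant turns the ratio of the two vectors into a polynomial, and this polynomial has
  no root because the \<open>f i\<close> have no common one.\<close>

lemma unimodular_proportional: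
  fixes f g :: "'n::finite \<Rightarrow> 'a::{alg_closed_field} poly"
  assumes f: "\<And>t. \<exists>i. poly (f i) t \<noteq> 0" and g: "\<And>t. \<exists>i. poly (g i) t \<noteq> 0"
    and fg: "\<And>i j. f i * g j = f j * g i"
  obtains c where "c \<noteq> 0" "\<And>i. f i = smult c (g i)"
proof -
  define I where "I = {m. m \<noteq> 0 \<and> (\<exists>b. m = (\<Sum>i\<in>UNIV. b i * g i))}"
  obtain i0 where "poly (g i0) 0 \<noteq> 0"
    using g by blast
  moreover have "g i0 = (\<Sum>i\<in>UNIV. (if i = i0 then 1 else 0) * g i)"
    by (simp add: if_distrib[of "\<lambda>x. x * _"] cong: if_cong)
  ultimately have "g i0 \<in> I"
    unfolding I_def by auto
  define m where "m = arg_min degree (\<lambda>m. m \<in> I)"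
  have m: "m \<in> I" and min: "\<And>m'. m' \<in> I \<Longrightarrow> degree m \<le> degree m'"
    using arg_min_nat_lemma[of "\<lambda>m. m \<in> I" _ degree] \<open>g i0 \<in> I\<close> unfolding m_def by auto
  obtain b where b: "m = (\<Sum>i\<in>UNIV. b i * g i)" and "m \<noteq> 0"
    using m by (auto simp: I_def)
  have dvd: "m dvd g k" for k
  proof (rule ccontr)
    assume "\<not> m dvd g k"
    then have nz: "g k mod m \<noteq> 0"
      by (simp add: mod_eq_0_iff_dvd)
    have "g k mod m = g k - g k div m * m"
      by (simp add: minus_div_mult_eq_mod)
    also have "\<dots> = (\<Sum>i\<in>UNIV. (if i = k then 1 else 0) * g i) - (\<Sum>i\<in>UNIV. g k div m * b i * g i)"
      by (simp add: b if_distrib[of "\<lambda>x. x * _"] sum_distrib_left mult.assoc cong: if_cong)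
    also have "\<dots> = (\<Sum>i\<in>UNIV. ((if i = k then 1 else 0) - g k div m * b i) * g i)"
      by (simp add: left_diff_distrib sum_subtractf)
    finally have "g k mod m \<in> I"
      using nz unfolding I_def by (intro CollectI conjI exI)
    then have "degree m \<le> degree (g k mod m)"
      by (rule min)
    moreover have "degree (g k mod m) < degree m \<or> degree m = 0"
      using nz \<open>m \<noteq> 0\<close> degree_mod_less by blast
    moreover have "degree m \<noteq> 0"
    proof
      assume "degree m = 0"
      then obtain c where "m = [:c:]"
        by (metis degree_eq_zeroE)
      then show False
        using \<open>m \<noteq> 0\<close> \<open>\<not> m dvd g k\<close> by (metis const_poly_dvd_iff dvd_field_iff pCons_eq_0_iff)
    qed
    ultimately show False
      by simp
  qed
  have "degree m = 0"
  proof (rule ccontr)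
    assume "degree m \<noteq> 0"
    then obtain t where "poly m t = 0"
      using alg_closed_imp_poly_has_root[of m] by auto
    then have "poly (g k) t = 0" for k
      using dvd[of k] by (metis dvdE mult_zero_left poly_mult)
    then show False
      using g by blast
  qed
  then obtain c where c: "m = [:c:]"
    by (metis degree_eq_zeroE)
  then have "c \<noteq> 0"
    using \<open>m \<noteq> 0\<close> by auto
  define e where "e = (\<Sum>i\<in>UNIV. b i * f i)"
  have e: "smult c (f j) = e * g j" for j
  proof -
    have "smult c (f j) = (\<Sum>i\<in>UNIV. b i * g i) * f j"
      unfolding b[symmetric] c by simp
    also have "\<dots> = (\<Sum>i\<in>UNIV. b i * (f j * g i))"
      unfolding sum_distrib_right by (simp add: mult_ac)
    also have "\<dots> = e * g j"
      unfolding e_def sum_distrib_right fg[of j] by (simp add: mult_ac)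
    finally show ?thesis .
  qed
  have "degree e = 0"
  proof (rule ccontr)
    assume "degree e \<noteq> 0"
    then obtain t where t: "poly e t = 0"
      using alg_closed_imp_poly_has_root[of e] by auto
    then have "c * poly (f j) t = 0" for j
      using arg_cong[OF e[of j], of "\<lambda>p. poly p t"] by simp
    then show False
      using f[of t] \<open>c \<noteq> 0\<close> by auto
  qed
  then obtain c' where c': "e = [:c':]"
    by (metis degree_eq_zeroE)
  have fj: "f j = smult (c' / c) (g j)" for j
  proof -
    have "smult (1 / c) (smult c (f j)) = smult (1 / c) (e * g j)"
      using e by simp
    then show ?thesis
      using \<open>c \<noteq> 0\<close> by (simp add: c')
  qed
  have "c' / c \<noteq> 0"
  proof
    assume "c' / c = 0"
    then have "f j = 0" for j
      using fj[of j] by (simp del: divide_eq_0_iff)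
    then show False
      using f[of 0] by simp
  qed
  then show thesis
    using that fj by blast
qed

section \<open>The inverse map as an injective immersion, and the tangent planes of the
  surface\<close>

context cubic_parametrization
begin

definition grad :: "'a ^ 4 \<Rightarrow> 'a ^ 4" where
  "grad v = (\<chi> i. ev (mp_pderiv i F) v)"

abbreviation "Q \<equiv> eval_vec q"
abbreviation "DQ \<equiv> dder_vec q"

lemma dder_F: "dder F v u = dot u (grad v)"
  by (simp add: dder_eq_sum dot_def grad_def)

lemma F_scale: "ev F (c *s v) = c ^ 3 * ev F v"
  by (rule mp_eval_scale[OF hom_F])

lemma grad_nonzero: "v \<noteq> 0 \<Longrightarrow> ev F v = 0 \<Longrightarrow> grad v \<noteq> 0"
  using smooth_F by (auto simp: smooth_form_def dder_F dot_simps)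

lemma grad_scale:
  assumes "c \<noteq> 0"
  shows "grad (c *s v) = c ^ 2 *s grad v"
proof -
  have "grad (c *s v) $ i = (c ^ 2 *s grad v) $ i" for i
    using dder_scale_arg[of 2 F c v "axis i 1"] hom_F assms
    by (simp add: dder_F dot_commute[of "axis i 1"] dot_axis)
  then show ?thesis
    unfolding vec_eq_iff by blast
qed

lemma polyfun_grad: "polyfun (\<lambda>v. grad v $ i)"
  by (simp add: grad_def)

lemma polyfun_Q: "polyfun (\<lambda>x. Q x $ i)"
  by simp

lemma Q_proportional_g0:
  assumes "eval_vec g0 x \<noteq> 0"
  obtains c where "Q x = c *s eval_vec g0 x"
  by (rule proportional_cases[of "Q x" "eval_vec g0 x"]) (use assms q_prop in \<open>auto simp: mult.commute\<close>)

lemma chi_generic: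
  assumes "polyfun f" "f y \<noteq> 0"
  shows "\<exists>x. x \<noteq> 0 \<and> ev chi x \<noteq> 0 \<and> Q x \<noteq> 0 \<and> f x \<noteq> 0"
proof -
  obtain z where "z $ 3 \<noteq> 0" "Q z \<noteq> 0"
    using ex_nonbase by blast
  then obtain i where i: "ev (q i) z \<noteq> 0" "z $ 3 \<noteq> 0"
    by (auto simp: vec_eq_iff)
  obtain c where c: "ev chi c \<noteq> 0"
    using chi_nonzero by blast
  have pf: "polyfun (\<lambda>z. ev (q i) z * z $ 3)" "polyfun (\<lambda>z. (ev (q i) z * z $ 3) * f z)"
    by (intro polyfun_mult polyfun_ev polyfun_nth assms(1))+
  obtain z' where z': "ev (q i) z' * z' $ 3 \<noteq> 0" "f z' \<noteq> 0"
    using polyfun_common_nonzero[OF inf pf(1) assms(1) _ assms(2), of z] i by auto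
  obtain x where "(ev (q i) x * x $ 3) * f x \<noteq> 0" "ev chi x \<noteq> 0"
    using polyfun_common_nonzero[OF inf pf(2) polyfun_ev _ c, of z'] z' by auto
  then show ?thesis
    by (intro exI[of _ x]) (auto simp: vec_eq_iff)
qed

text \<open>Density: an identity need only be checked where \<open>g0\<close> is known to describe
  the inverse and an auxiliary \<open>c\<close> does not vanish.\<close>

lemma polyfun_zeroI:
  assumes "polyfun f" "polyfun c" "c y \<noteq> 0"
    and "\<And>x. x \<noteq> 0 \<Longrightarrow> ev chi x \<noteq> 0 \<Longrightarrow> Q x \<noteq> 0 \<Longrightarrow> c x \<noteq> 0 \<Longrightarrow> f x = 0"
  shows "f x = 0"
proof (rule ccontr)
  assume "f x \<noteq> 0"
  then obtain z where "f z * c z \<noteq> 0"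
    using polyfun_common_nonzero[OF inf assms(1,2) _ assms(3)] by auto
  then show False
    using chi_generic[of "\<lambda>z. f z * c z" z] assms(1,2,4) by (auto intro: polyfun_mult)
qed

lemma F_Q: "ev F (Q x) = 0"
proof (rule polyfun_zeroI[where c = "\<lambda>_. 1"])
  show "polyfun (\<lambda>x. ev F (Q x))"
    by (intro polyfun_comp[OF polyfun_ev] polyfun_Q)
next
  fix x :: "'a ^ 3" assume x: "x \<noteq> 0" "ev chi x \<noteq> 0"
  then obtain c where "Q x = c *s eval_vec g0 x"
    using Q_proportional_g0 g0 by blast
  then show "ev F (Q x) = 0"
    using g0[OF x] by (simp add: F_scale)
qed auto

text \<open>That \<open>p\<close> undoes \<open>Q\<close> is known through \<open>g0\<close> on an
  open set only; as minor equations the statement extends to all vectors.\<close>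

lemma local_rep_identity:
  assumes "local_rep F p g h" "ev h (Q y0) \<noteq> 0"
  shows "ev (g i) (Q y) * y $ j = ev (g j) (Q y) * y $ i"
proof -
  have "ev (g i) (Q y) * y $ j - ev (g j) (Q y) * y $ i = 0"
  proof (rule polyfun_zeroI[where c = "\<lambda>y. ev h (Q y)"])
    show "polyfun (\<lambda>y. ev (g i) (Q y) * y $ j - ev (g j) (Q y) * y $ i)" "polyfun (\<lambda>y. ev h (Q y))"
      by (intro polyfun_diff polyfun_mult polyfun_nth polyfun_comp[OF polyfun_ev] polyfun_Q)+
  next
    fix y :: "'a ^ 3" assume y: "y \<noteq> 0" "ev chi y \<noteq> 0" "Q y \<noteq> 0" "ev h (Q y) \<noteq> 0"
    obtain c where c: "Q y = c *s eval_vec g0 y"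
      using Q_proportional_g0 g0 y by blast
    have "abs_proj (Q y) = abs_proj (eval_vec g0 y)"
      using g0[OF y(1,2)] y(3) by (intro abs_proj_eqI) (auto simp: c)
    then have "p (abs_proj (Q y)) = abs_proj y"
      using g0[OF y(1,2)] by simp
    moreover have "eval_vec g (Q y) \<noteq> 0" "p (abs_proj (Q y)) = abs_proj (eval_vec g (Q y))"
      using assms(1) y F_Q unfolding local_rep_def by blast+
    ultimately have "abs_proj (eval_vec g (Q y)) = abs_proj y"
      by simp
    then have "eval_vec g (Q y) $ i * y $ j = eval_vec g (Q y) $ j * y $ i"
      using \<open>eval_vec g (Q y) \<noteq> 0\<close> y(1) by (rule abs_proj_eqD)
    then show "ev (g i) (Q y) * y $ j - ev (g j) (Q y) * y $ i = 0"
      by simp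
  qed (use assms in auto)
  then show ?thesis by simp
qed

lemma local_rep_at_Q:
  assumes "x \<noteq> 0" "Q x \<noteq> 0"
  obtains g h e c where "local_rep F p g h" "ev h (Q x) \<noteq> 0" "\<And>i. homogeneous e (g i)"
    "c \<noteq> 0" "eval_vec g (Q x) = c *s x"
proof -
  obtain g h where gh: "local_rep F p g h" "ev h (Q x) \<noteq> 0"
    using ex_local_rep[OF assms(2) F_Q] by blast
  have nz: "eval_vec g (Q x) \<noteq> 0"
    using gh assms F_Q unfolding local_rep_def by blast
  obtain c where c: "eval_vec g (Q x) = c *s x"
    by (rule proportional_cases[of "eval_vec g (Q x)" x]) (use local_rep_identity[OF gh] assms in auto)
  moreover have "c \<noteq> 0"
    using nz c by auto
  ultimately show thesis
    using that gh unfolding local_rep_def by blast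
qed

lemma p_Q:
  assumes "x \<noteq> 0" "Q x \<noteq> 0"
  shows "p (abs_proj (Q x)) = abs_proj x"
proof -
  obtain g h e c where gh: "local_rep F p g h" "ev h (Q x) \<noteq> 0" "c \<noteq> 0" "eval_vec g (Q x) = c *s x"
    using local_rep_at_Q[OF assms] by metis
  have "p (abs_proj (Q x)) = abs_proj (eval_vec g (Q x))"
    using gh(1,2) assms F_Q unfolding local_rep_def by blast
  also have "\<dots> = abs_proj x"
    using gh(3,4) assms by (intro abs_proj_eqI) auto
  finally show ?thesis .
qed

lemma Q_injective:
  assumes "x \<noteq> 0" "Q x \<noteq> 0" "y \<noteq> 0" "Q y \<noteq> 0" "abs_proj (Q x) = abs_proj (Q y)"
  shows "abs_proj x = abs_proj y"
  using p_Q assms by metis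

lemma DQ_self: "DQ x x = of_nat d *s Q x"
  by (simp add: vec_eq_iff dder_self[OF hom_q])

text \<open>Differentiate the statement that \<open>p\<close> undoes \<open>Q\<close>, written as
  the vanishing of the minors of \<open>g (Q y)\<close> and \<open>y\<close>.\<close>

lemma DQ_injective:
  assumes "x \<noteq> 0" "Q x \<noteq> 0" "a *s Q x + DQ x u = 0"
  obtains c where "u = c *s x"
proof -
  obtain g h e c where gh: "local_rep F p g h" "ev h (Q x) \<noteq> 0" "\<And>i. homogeneous e (g i)" "c \<noteq> 0" "eval_vec g (Q x) = c *s x"
    using local_rep_at_Q[OF assms(1,2)] by metis
  define G where "G i = mp_subst (g i) q" for i
  have G: "ev (G i) y = ev (g i) (Q y)" for i y
    by (simp add: G_def ev_simps eval_vec_def)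
  have Gx: "ev (G i) x = c * x $ i" for i
    using gh(5) by (simp add: G vec_eq_iff)
  have D: "DQ x u = (- a) *s Q x"
    using assms(3) by (simp add: vec_eq_iff add_eq_0_iff)
  \<comment> \<open>As \<open>DQ x u\<close> is a multiple of \<open>Q x\<close>, Euler's relation
    makes the derivative of \<open>G\<close> a multiple of \<open>x\<close>, which cancels in the
    differentiated minors.\<close>
  have dG: "dder (G i) x u = - a * of_nat e * (c * x $ i)" for i
  proof -
    have "dder (G i) x u = dder (g i) (Q x) (DQ x u)"
      by (simp add: G_def dder_subst eval_vec_def dder_vec_def)
    then show ?thesis
      unfolding D dder_scale using dder_self[OF gh(3), of i "Q x"] Gx[of i] by (simp add: G)
  qed
  have "u $ i * (c *s x) $ j = u $ j * (c *s x) $ i" for i j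
  proof -
    have "G i * mp_var j = G j * mp_var i"
      by (rule ev_eq_imp[OF inf], unfold ev_simps ev_var G, rule local_rep_identity[OF gh(1,2)])
    then have "dder (G i * mp_var j) x u = dder (G j * mp_var i) x u"
      by simp
    then show ?thesis
      unfolding dder_mult dder_var ev_var Gx dG by (auto simp: algebra_simps)
  qed
  moreover have "c *s x \<noteq> 0"
    using gh(4) assms(1) by simp
  ultimately obtain b where "u = b *s (c *s x)"
    using proportional_cases by blast
  then show thesis
    using that[of "b * c"] by (simp add: vec_eq_iff mult.assoc)
qed

lemma dot_grad_Q: "dot (grad (Q x)) (Q x) = 0"
  using dder_self[OF hom_F, of "Q x"] by (simp add: dder_F F_Q dot_commute)

lemma dot_grad_DQ: "dot (grad (Q x)) (DQ x u) = 0"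
proof -
  have "mp_subst F q = 0"
    by (rule ev_eq_0_imp[OF inf]) (use F_Q in \<open>simp add: ev_simps eval_vec_def\<close>)
  then have "dder (mp_subst F q) x u = 0"
    by (simp add: dder_eq_sum mp_pderiv_def)
  then show ?thesis
    by (simp add: dder_subst dder_F eval_vec_def dder_vec_def dot_commute)
qed

lemma cross4_Q_nonzero:
  assumes "x \<noteq> 0" "Q x \<noteq> 0" "det3 x u v \<noteq> 0"
  shows "cross4 (Q x) (DQ x u) (DQ x v) \<noteq> 0"
proof
  assume "cross4 (Q x) (DQ x u) (DQ x v) = 0"
  then obtain r s t where rst: "(r, s, t) \<noteq> (0, 0, 0)" "r *s Q x + s *s DQ x u + t *s DQ x v = 0"
    using cross4_eq_0 by blast
  then have "r *s Q x + DQ x (s *s u + t *s v) = 0"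
    by (simp add: dder_vec_linear add.assoc)
  then obtain c where "s *s u + t *s v = c *s x"
    using DQ_injective[OF assms(1,2)] by blast
  then have "(- c) *s x + (s *s u + t *s v) = 0"
    by simp
  then have "(- c) *s x + s *s u + t *s v = 0"
    by (simp only: add.assoc)
  from det3_indep[OF assms(3) this] have "s = 0" "t = 0"
    by auto
  then show False
    using rst assms(2) by auto
qed

text \<open>The cross product and the gradient are normal to the same three independent vectors,
  hence proportional. The factor depends on \<open>u, v\<close> through \<open>det3 x u v\<close>
  only, since both sides are alternating and \<open>DQ x x\<close> is a multiple of
  \<open>Q x\<close>.\<close>

lemma cross4_Q:
  assumes "x \<noteq> 0" "Q x \<noteq> 0"
  obtains r where "r \<noteq> 0" "\<And>u v. cross4 (Q x) (DQ x u) (DQ x v) = (r * det3 x u v) *s grad (Q x)"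
proof -
  obtain u0 v0 where uv0: "det3 x u0 v0 \<noteq> 0"
    using det3_complete[OF assms(1)] by blast
  let ?X = "cross4 (Q x) (DQ x u0) (DQ x v0)"
  have X: "?X \<noteq> 0"
    by (rule cross4_Q_nonzero[OF assms uv0])
  obtain m where m: "grad (Q x) = m *s ?X"
    using proportional_cases[OF cross4_proportional[OF dot_grad_Q dot_grad_DQ dot_grad_DQ] X] by blast
  have "m \<noteq> 0"
    using m grad_nonzero[OF assms(2) F_Q] by auto
  show thesis
  proof (rule that[of "1 / (m * det3 x u0 v0)"])
    fix u v
    obtain a b c where u: "u = a *s x + b *s u0 + c *s v0"
      using det3_basis[OF uv0] by blast
    obtain a' b' c' where v: "v = a' *s x + b' *s u0 + c' *s v0"
      using det3_basis[OF uv0] by blast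
    have "cross4 (Q x) (DQ x u) (DQ x v) = (b * c' - c * b') *s ?X"
      by (simp add: u v dder_vec_linear DQ_self cross4_linear cross4_same)
         (simp add: vec_eq_iff cross4_swap(2)[of "Q x" "DQ x u0" "DQ x v0"] algebra_simps)
    moreover have "det3 x u v = (b * c' - c * b') * det3 x u0 v0"
      by (simp add: u v det3_linear det3_same det3_swap(2)[of x u0 v0] algebra_simps)
    ultimately show "cross4 (Q x) (DQ x u) (DQ x v) = (1 / (m * det3 x u0 v0) * det3 x u v) *s grad (Q x)"
      using uv0 \<open>m \<noteq> 0\<close> by (simp add: m vec_eq_iff)
  qed (use uv0 \<open>m \<noteq> 0\<close> in auto)
qed

end


lemma polyfun_det3:
  assumes "\<And>i. polyfun (\<lambda>z. a z $ i)" "\<And>i. polyfun (\<lambda>z. b z $ i)" "\<And>i. polyfun (\<lambda>z. c z $ i)"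
  shows "polyfun (\<lambda>z. det3 (a z) (b z) (c z))"
  unfolding det3_def by (intro polyfun_add polyfun_mult polyfun_diff assms)

lemma polyfun_cross4:
  assumes "\<And>i. polyfun (\<lambda>z. a z $ i)" "\<And>i. polyfun (\<lambda>z. b z $ i)" "\<And>i. polyfun (\<lambda>z. c z $ i)"
  shows "polyfun (\<lambda>z. cross4 (a z) (b z) (c z) $ i)"
proof -
  have "\<forall>i. polyfun (\<lambda>z. cross4 (a z) (b z) (c z) $ i)"
    unfolding forall_4 cross4_nth
    by (intro conjI polyfun_add polyfun_mult polyfun_diff polyfun_uminus assms)
  then show ?thesis by blast
qed

lemma polyfun_dot:
  assumes "\<And>i. polyfun (\<lambda>z. a z $ i)" "\<And>i. polyfun (\<lambda>z. b z $ i)"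
  shows "polyfun (\<lambda>z. dot (a z) (b z))"
  unfolding dot_def by (intro polyfun_sum polyfun_mult assms)

lemma poly_mp_eval_const:
  "poly (mp_eval (\<lambda>c. [:c:]) G v) t = ev G (\<chi> i. poly (v $ i) t)"
  by (subst mp_eval_hom[OF ring_hom_on_poly]) simp

lemma poly_cross4:
  "poly (cross4 a b c $ i) t = cross4 (\<chi> i. poly (a $ i) t) (\<chi> i. poly (b $ i) t) (\<chi> i. poly (c $ i) t) $ i"
proof -
  have "\<forall>i. poly (cross4 a b c $ i) t = cross4 (\<chi> i. poly (a $ i) t) (\<chi> i. poly (b $ i) t) (\<chi> i. poly (c $ i) t) $ i"
    unfolding forall_4 cross4_nth by simp
  then show ?thesis by blast
qed

lemma common_order_at_0:
  fixes f :: "'n \<Rightarrow> 'a::field poly"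
  assumes "f k \<noteq> 0"
  obtains m c where "\<And>i. f i = [:0, 1:] ^ m * c i" "\<exists>i. poly (c i) 0 \<noteq> 0"
proof -
  have "\<exists>m c. (\<forall>i. f i = [:0, 1:] ^ m * c i) \<and> (\<exists>i. poly (c i) 0 \<noteq> 0)"
    using assms
  proof (induction "degree (f k)" arbitrary: f rule: less_induct)
    case less
    show ?case
    proof (cases "\<exists>i. poly (f i) 0 \<noteq> 0")
      case True
      then show ?thesis
        by (intro exI[of _ 0] exI[of _ f]) auto
    next
      case False
      then have "\<exists>g. f i = [:0, 1:] * g" for i
        using poly_eq_0_iff_dvd[of "f i" 0] by (auto elim: dvdE)
      then obtain g where g: "\<And>i. f i = [:0, 1:] * g i"
        by metis
      then have "g k \<noteq> 0"
        using less.prems by auto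
      then have "degree (f k) = Suc (degree (g k))"
        unfolding g by (simp add: degree_mult_eq)
      then obtain m c where "\<forall>i. g i = [:0, 1:] ^ m * c i" "\<exists>i. poly (c i) 0 \<noteq> 0"
        using less.hyps[of g] \<open>g k \<noteq> 0\<close> by auto
      then show ?thesis
        by (intro exI[of _ "Suc m"] exI[of _ c]) (simp add: g mult.assoc)
    qed
  qed
  then show thesis
    using that by blast
qed

text \<open>Modulo the ideal generated by the last two coordinates a polynomial equals its
  restriction to the first axis. The axis will carry a base point.\<close>

lemma polyfun_split:
  fixes f :: "'a::field ^ 3 \<Rightarrow> 'a"
  assumes "polyfun f"
  shows "\<exists>A B. polyfun A \<and> polyfun B \<and> (\<forall>x. f x = f (x $ 1 *s axis 1 1) + x $ 2 * A x + x $ 3 * B x)"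
  using assms
proof (induction rule: polyfun_induct)
  case (const c)
  show ?case
    by (intro exI[of _ "\<lambda>_. 0"]) simp
next
  case (nth i)
  consider "i = 1" | "i = 2" | "i = 3"
    using exhaust_3 by blast
  then show ?case
  proof cases
    case 1
    then show ?thesis
      by (intro exI[of _ "\<lambda>_. 0"]) simp
  next
    case 2
    then show ?thesis
      by (intro exI[of _ "\<lambda>_. 1"] exI[of _ "\<lambda>_. 0"]) (simp add: axis_def)
  next
    case 3
    then show ?thesis
      by (intro exI[of _ "\<lambda>_. 0"] exI[of _ "\<lambda>_. 1"]) (simp add: axis_def)
  qed
next
  case (add f g)
  then obtain A B A' B' where AB: "polyfun A" "polyfun B" "polyfun A'" "polyfun B'"
    and f: "\<And>x. f x = f (x $ 1 *s axis 1 1) + x $ 2 * A x + x $ 3 * B x"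
    and g: "\<And>x. g x = g (x $ 1 *s axis 1 1) + x $ 2 * A' x + x $ 3 * B' x"
    by blast
  show ?case
  proof (intro exI conjI allI)
    show "polyfun (\<lambda>x. A x + A' x)" "polyfun (\<lambda>x. B x + B' x)"
      using AB by auto
    show "f x + g x = f (x $ 1 *s axis 1 1) + g (x $ 1 *s axis 1 1) + x $ 2 * (A x + A' x) + x $ 3 * (B x + B' x)" for x
      by (subst f, subst g) (simp add: algebra_simps)
  qed
next
  case (mult f g)
  then obtain A B A' B' where AB: "polyfun A" "polyfun B" "polyfun A'" "polyfun B'"
    and f: "\<And>x. f x = f (x $ 1 *s axis 1 1) + x $ 2 * A x + x $ 3 * B x"
    and g: "\<And>x. g x = g (x $ 1 *s axis 1 1) + x $ 2 * A' x + x $ 3 * B' x"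
    by blast
  have pf: "polyfun (\<lambda>x :: 'a ^ 3. f (x $ 1 *s axis 1 1))"
    by (rule polyfun_comp[OF mult(1)]) (auto intro: polyfun_mult)
  show ?case
  proof (intro exI conjI allI)
    show "polyfun (\<lambda>x. A x * g x + f (x $ 1 *s axis 1 1) * A' x)" "polyfun (\<lambda>x. B x * g x + f (x $ 1 *s axis 1 1) * B' x)"
      by (intro polyfun_add polyfun_mult AB mult pf)+
    fix x :: "'a ^ 3"
    define f1 g1 where "f1 = f (x $ 1 *s axis 1 1)" and "g1 = g (x $ 1 *s axis 1 1)"
    have "f x * g x = f1 * g x + (x $ 2 * A x + x $ 3 * B x) * g x"
      unfolding f1_def by (subst f) (simp add: algebra_simps)
    also have "f1 * g x = f1 * (g1 + x $ 2 * A' x + x $ 3 * B' x)"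
      unfolding g1_def using g[of x] by simp
    finally show "f x * g x = f1 * g1 + x $ 2 * (A x * g x + f1 * A' x) + x $ 3 * (B x * g x + f1 * B' x)"
      by (simp add: algebra_simps)
  qed
qed

section \<open>Lines off the base locus and the degree of the inverse map\<close>

context cubic_parametrization
begin

definition base_pts :: "('a ^ 3) set" where
  "base_pts = (SOME Ws. finite Ws \<and> (\<forall>w\<in>Ws. w \<noteq> 0 \<and> Q w = 0) \<and>
     (\<forall>x. x \<noteq> 0 \<longrightarrow> Q x = 0 \<longrightarrow> (\<exists>w\<in>Ws. \<exists>c. c \<noteq> 0 \<and> x = c *s w)))"

lemma base_pts_props: "finite base_pts \<and> (\<forall>w\<in>base_pts. w \<noteq> 0 \<and> Q w = 0) \<and>
     (\<forall>x. x \<noteq> 0 \<longrightarrow> Q x = 0 \<longrightarrow> (\<exists>w\<in>base_pts. \<exists>c. c \<noteq> 0 \<and> x = c *s w))"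
  unfolding base_pts_def by (rule someI_ex) (metis finite_base_points)

lemma finite_base_pts: "finite base_pts"
  and base_ptsD: "w \<in> base_pts \<Longrightarrow> w \<noteq> 0" "w \<in> base_pts \<Longrightarrow> Q w = 0"
  and base_pts_cover: "x \<noteq> 0 \<Longrightarrow> Q x = 0 \<Longrightarrow> \<exists>w\<in>base_pts. \<exists>c. c \<noteq> 0 \<and> x = c *s w"
  using base_pts_props by blast+

lemma d_pos: "d > 0"
proof (rule ccontr)
  assume "\<not> d > 0"
  then have c: "Q x = Q 0" for x
    using q_scale[of 0 x] by simp
  then have nz: "Q x \<noteq> 0" for x
    using ex_nonbase by metis
  let ?e = "\<lambda>i. axis i 1 :: 'a ^ 3"
  have nth: "?e 1 $ 1 = 1" "?e 1 $ 2 = 0" "?e 2 $ 2 = 1" "?e 2 $ 1 = 0"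
    by (simp_all add: axis_def)
  have nz': "?e i \<noteq> 0" for i
    by simp
  have "abs_proj (?e 1) = abs_proj (?e 2)"
    by (rule Q_injective[OF _ nz _ nz]) (simp_all add: c[of "axis 1 1"] c[of "axis 2 1"])
  then show False
    using abs_proj_eqD[of "?e 1" "?e 2" 1 2, OF _ nz' nz'] unfolding nth by simp
qed

lemma Q_0: "Q 0 = 0"
  using q_scale[of 0 0] d_pos by (simp add: zero_power)

text \<open>Since \<open>Q 0 = 0\<close>, the condition contains the linear independence of
  \<open>x\<close> and \<open>y\<close>.\<close>

definition misses :: "'a ^ 3 \<Rightarrow> 'a ^ 3 \<Rightarrow> bool" where
  "misses x y \<longleftrightarrow> (\<forall>a b. (a, b) \<noteq> (0, 0) \<longrightarrow> Q (a *s x + b *s y) \<noteq> 0)"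

lemma misses_sym: "misses x y \<Longrightarrow> misses y x"
  unfolding misses_def by (metis add.commute prod.inject)

lemma missesD: "misses x y \<Longrightarrow> Q x \<noteq> 0" "misses x y \<Longrightarrow> Q y \<noteq> 0"
  "misses x y \<Longrightarrow> Q (x + t *s y) \<noteq> 0" "misses x y \<Longrightarrow> (a, b) \<noteq> (0, 0) \<Longrightarrow> Q (a *s x + b *s y) \<noteq> 0"
proof -
  assume m: "misses x y"
  have "Q (1 *s x + 0 *s y) \<noteq> 0" "Q (0 *s x + 1 *s y) \<noteq> 0" "Q (1 *s x + t *s y) \<noteq> 0"
    using m unfolding misses_def by (metis prod.inject zero_neq_one)+
  then show "Q x \<noteq> 0" "Q y \<noteq> 0" "Q (x + t *s y) \<noteq> 0"
    by auto
qed (auto simp: misses_def)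

lemma Q_nonzero_imp: "Q x \<noteq> 0 \<Longrightarrow> x \<noteq> 0"
  using Q_0 by auto

lemma misses_indep:
  assumes "misses x y"
  obtains z where "det3 x y z \<noteq> 0"
proof (rule ccontr)
  note obt = that
  assume *: "\<not> thesis"
  have "det3 x y z = 0" for z
    using obt * by blast
  then obtain c where "y = c *s x"
    using det3_nondegenerate[of x y] missesD(1)[OF assms] Q_nonzero_imp by blast
  then have "c *s x + (- 1) *s y = 0"
    by (simp add: vec_eq_iff)
  then show False
    using missesD(4)[OF assms, of c "- 1"] Q_0 by simp
qed

text \<open>The determinant with \<open>u\<close> only secures that \<open>z\<close> and
  \<open>x\<close> are independent; those with the base points keep these off the line.\<close>

lemma misses_criterion:
  assumes z: "Q z \<noteq> 0" and "det3 z u x \<noteq> 0" "\<And>w. w \<in> base_pts \<Longrightarrow> det3 z w x \<noteq> 0"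
  shows "misses z x"
  unfolding misses_def
proof (intro allI impI notI)
  fix a b assume ab: "(a, b) \<noteq> (0, 0)" and Q: "Q (a *s z + b *s x) = 0"
  have "det3 z u (a *s z + b *s x) = b * det3 z u x" "det3 (a *s z + b *s x) u x = a * det3 z u x"
    by (simp_all add: det3_linear det3_same)
  then have "a *s z + b *s x \<noteq> 0"
    using assms(2) ab by (auto simp: det3_0)
  then obtain w c where w: "w \<in> base_pts" "c \<noteq> 0" "a *s z + b *s x = c *s w"
    using base_pts_cover Q by blast
  have "det3 z (a *s z + b *s x) x = 0"
    by (simp add: det3_linear det3_same)
  then show False
    using assms(3)[OF w(1)] w(2) unfolding w(3) by (simp add: det3_linear)
qed

lemma misses_generic:
  assumes "Q z \<noteq> 0"
  obtains f where "polyfun f" "\<exists>x. f x \<noteq> 0" "\<And>x. f x \<noteq> 0 \<Longrightarrow> misses z x"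
proof -
  have z: "z \<noteq> 0"
    using assms by (rule Q_nonzero_imp)
  obtain u v where uv: "det3 z u v \<noteq> 0"
    using det3_complete[OF z] by blast
  let ?W = "insert u base_pts"
  have ex: "\<exists>x. det3 z w x \<noteq> 0" if "w \<in> ?W" for w
  proof (rule ccontr)
    assume *: "\<not> (\<exists>x. det3 z w x \<noteq> 0)"
    then have "w \<in> base_pts"
      using that uv by auto
    moreover obtain c where c: "w = c *s z"
      using det3_nondegenerate[OF z] * by metis
    ultimately have "c ^ d *s Q z = 0" "c \<noteq> 0"
      using base_ptsD[of w] by (auto simp: q_scale)
    then show False
      using assms by simp
  qed
  define f where "f x = (\<Prod>w\<in>?W. det3 z w x)" for x
  have pd: "polyfun (\<lambda>x. det3 z w x)" for w
    by (intro polyfun_det3 polyfun_const polyfun_nth)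
  show thesis
  proof (rule that[of f])
    show "polyfun f"
      unfolding f_def[abs_def] by (intro polyfun_prod pd)
    show "\<exists>x. f x \<noteq> 0"
      unfolding f_def using polyfun_prod_nonzero[OF inf, of ?W "det3 z"] finite_base_pts ex pd by auto
    fix x assume fx: "f x \<noteq> 0"
    then have ne: "det3 z w x \<noteq> 0" if "w \<in> ?W" for w
      using that finite_base_pts by (auto simp: f_def)
    show "misses z x"
      by (rule misses_criterion[OF assms, of u]) (use ne in auto)
  qed
qed

definition rho :: "'a ^ 3 \<Rightarrow> 'a" where
  "rho x = (SOME r. r \<noteq> 0 \<and> (\<forall>u v. cross4 (Q x) (DQ x u) (DQ x v) = (r * det3 x u v) *s grad (Q x)))"

lemma rho:
  assumes "Q x \<noteq> 0"
  shows "rho x \<noteq> 0" "cross4 (Q x) (DQ x u) (DQ x v) = (rho x * det3 x u v) *s grad (Q x)"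
proof -
  have "\<exists>r. r \<noteq> 0 \<and> (\<forall>u v. cross4 (Q x) (DQ x u) (DQ x v) = (r * det3 x u v) *s grad (Q x))"
    using cross4_Q[of x] assms Q_nonzero_imp by metis
  from someI_ex[OF this, folded rho_def]
  show "rho x \<noteq> 0" "cross4 (Q x) (DQ x u) (DQ x v) = (rho x * det3 x u v) *s grad (Q x)"
    by blast+
qed

lemma rho_unique:
  assumes "Q x \<noteq> 0" "det3 x u v \<noteq> 0" "cross4 (Q x) (DQ x u) (DQ x v) = (r * det3 x u v) *s grad (Q x)"
  shows "rho x = r"
proof -
  obtain i where "grad (Q x) $ i \<noteq> 0"
    using grad_nonzero[OF assms(1) F_Q] by (metis vec_eq_iff zero_index)
  moreover have "((rho x * det3 x u v) *s grad (Q x)) $ i = ((r * det3 x u v) *s grad (Q x)) $ i"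
    unfolding rho(2)[OF assms(1), of u v, symmetric] assms(3) ..
  ultimately show ?thesis
    using assms(2) by simp
qed

lemma polyfun_DQ: "polyfun (\<lambda>x. DQ x u $ i)"
  unfolding dder_vec_nth by (intro polyfun_dder polyfun_nth polyfun_const)

text \<open>On a line without base points both sides of the proportionality \<open>rho\<close> are polynomial vectors
  without common zeros, so their ratio is constant.\<close>

lemma rho_line:
  assumes "misses x y"
  shows "rho (x + t *s y) = rho x"
proof -
  obtain z where z: "det3 x y z \<noteq> 0"
    using misses_indep[OF assms] by blast
  have "polyfun (\<lambda>x. cross4 (Q x) (DQ x y) (DQ x z) $ i)" for i
    by (intro polyfun_cross4 polyfun_Q polyfun_DQ)
  then obtain N where N: "\<And>i x. cross4 (Q x) (DQ x y) (DQ x z) $ i = ev (N i) x"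
    unfolding polyfun_def by metis
  have "polyfun (\<lambda>x. grad (Q x) $ i)" for i
    by (intro polyfun_comp[OF polyfun_grad] polyfun_Q)
  then obtain G where G: "\<And>i x. grad (Q x) $ i = ev (G i) x"
    unfolding polyfun_def by metis
  have det: "det3 (x + t *s y) y z = det3 x y z" for t
    by (simp add: det3_linear det3_same)
  have Qnz: "Q (x + t *s y) \<noteq> 0" for t
    by (rule missesD(3)[OF assms])
  let ?r = "\<lambda>t. rho (x + t *s y) * det3 x y z"
  have eq: "ev (N i) (x + t *s y) = ?r t * ev (G i) (x + t *s y)" for i t
    unfolding N[symmetric] G[symmetric] rho(2)[OF Qnz] det by simp
  have gnz: "\<exists>i. ev (G i) (x + t *s y) \<noteq> 0" for t
    using grad_nonzero[OF Qnz F_Q] unfolding vec_eq_iff G zero_index by blast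
  have rnz: "?r t \<noteq> 0" for t
    using rho(1)[OF Qnz] z by simp
  obtain c where c: "\<And>i. line_poly (N i) x y = smult c (line_poly (G i) x y)"
  proof (rule unimodular_proportional[of "\<lambda>i. line_poly (N i) x y" "\<lambda>i. line_poly (G i) x y"])
    show "\<exists>i. poly (line_poly (N i) x y) t \<noteq> 0" "\<exists>i. poly (line_poly (G i) x y) t \<noteq> 0" for t
      unfolding poly_line_poly eq using gnz[of t] rnz[of t] by auto
    show "line_poly (N i) x y * line_poly (G j) x y = line_poly (N j) x y * line_poly (G i) x y" for i j
      by (rule poly_eqI_infinite[OF inf]) (simp add: poly_line_poly eq)
  qed blast
  have "?r t = c" for t
  proof -
    obtain i where i: "ev (G i) (x + t *s y) \<noteq> 0"
      using gnz by blast
    have "poly (line_poly (N i) x y) t = c * poly (line_poly (G i) x y) t"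
      by (simp add: c)
    then have "?r t * ev (G i) (x + t *s y) = c * ev (G i) (x + t *s y)"
      unfolding poly_line_poly eq .
    then show ?thesis
      using i by simp
  qed
  from this[of t] this[of 0] have "rho (x + t *s y) * det3 x y z = rho x * det3 x y z"
    by simp
  then show ?thesis
    using z by simp
qed

lemma DQ_scale:
  assumes "c \<noteq> 0"
  shows "DQ (c *s x) u = c ^ (d - 1) *s DQ x u"
  using dder_scale_arg[of "d - 1" "q i" c x u for i] hom_q d_pos assms by (simp add: vec_eq_iff)

text \<open>In \<open>x\<close>, the vector \<open>Q\<close> has degree \<open>d\<close>, each
  \<open>DQ\<close> degree \<open>d - 1\<close>, the gradient of the cubic at \<open>Q\<close>
  degree \<open>2 * d\<close>, and \<open>det3\<close> degree 1.\<close>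

lemma rho_scale:
  assumes "Q x \<noteq> 0" "c \<noteq> 0"
  shows "rho (c *s x) * c ^ (2 * d + 1) = c ^ (d + 2 * (d - 1)) * rho x"
proof -
  obtain u v where uv: "det3 x u v \<noteq> 0"
    using det3_complete[OF Q_nonzero_imp[OF assms(1)]] by blast
  let ?r = "c ^ (d + 2 * (d - 1)) * rho x / c ^ (2 * d + 1)"
  have "cross4 (Q (c *s x)) (DQ (c *s x) u) (DQ (c *s x) v)
      = c ^ (d + 2 * (d - 1)) *s cross4 (Q x) (DQ x u) (DQ x v)"
    unfolding q_scale DQ_scale[OF assms(2)] cross4_linear by (simp add: power_add mult_2 mult_ac)
  also have "\<dots> = (c ^ (d + 2 * (d - 1)) * rho x * det3 x u v) *s grad (Q x)"
    unfolding rho(2)[OF assms(1)] by simp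
  also have "\<dots> = (?r * det3 (c *s x) u v) *s grad (Q (c *s x))"
    using assms(2) unfolding q_scale by (simp add: grad_scale det3_linear power_mult[symmetric] field_simps)
  finally have "rho (c *s x) = ?r"
    by (intro rho_unique[of _ u v]) (use assms uv in \<open>auto simp: q_scale det3_linear\<close>)
  then show ?thesis
    using assms(2) by simp
qed

text \<open>Comparing degrees in \<open>t\<close> along \<open>x + t y\<close>: the cross product has degree \<open>3 d - 2\<close>, while
  \<open>det3\<close> times the gradient has degree \<open>2 d + 1\<close>.\<close>

theorem d_eq_3: "d = 3"
proof -
  obtain x where x: "Q x \<noteq> 0"
    using ex_nonbase by blast
  obtain y where m: "misses x y"
    using misses_generic[OF x] by metis
  note y = missesD(2)[OF m]
  \<comment> \<open>At \<open>x + t y\<close>, which is \<open>t\<close> times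
    \<open>y + x / t\<close>, \<open>rho\<close> equals \<open>rho x\<close> by constancy along one
    chart of the line, and \<open>rho y\<close> up to scaling by constancy along the other.\<close>
  have *: "rho x * t ^ (2 * d + 1) = t ^ (d + 2 * (d - 1)) * rho y" if "t \<noteq> 0" for t
  proof -
    have "x + t *s y = t *s (y + (1 / t) *s x)"
      using that by (simp add: vec_eq_iff field_simps)
    then show ?thesis
      using rho_scale[of "y + (1 / t) *s x" t] rho_line[OF m, of t] rho_line[OF misses_sym[OF m], of "1 / t"]
        missesD(3)[OF misses_sym[OF m]] that by simp
  qed
  have "rho x = rho y"
    using *[of 1] by simp
  have "monom (1 :: 'a) (2 * d + 1) = monom 1 (d + 2 * (d - 1))"
  proof (rule poly_eqI_infinite)
    show "infinite (UNIV - {0 :: 'a})"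
      using inf by simp
  qed (use *[unfolded \<open>rho x = rho y\<close>] rho(1)[OF y] in \<open>auto simp: poly_monom\<close>)
  then have "2 * d + 1 = d + 2 * (d - 1)"
    by (metis degree_monom_eq zero_neq_one)
  then show ?thesis
    using d_pos by simp
qed

text \<open>If the line joining \<open>z\<close> and \<open>x\<close> misses the base points,
  \<open>rho\<close> agrees at \<open>z\<close>, \<open>z + x\<close> and \<open>x\<close>. Density
  extends the identity to every vector, in particular to base points, where \<open>rho\<close>
  carries no information.\<close>

theorem cross4_Q_global:
  obtains m where "m \<noteq> 0" "\<And>x u v. cross4 (Q x) (DQ x u) (DQ x v) = (m * det3 x u v) *s grad (Q x)"
proof -
  obtain z where z: "Q z \<noteq> 0"
    using ex_nonbase by blast
  obtain f where f: "polyfun f" "\<exists>x. f x \<noteq> 0" "\<And>x. f x \<noteq> 0 \<Longrightarrow> misses z x"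
    using misses_generic[OF z] by blast
  then obtain x0 where x0: "f x0 \<noteq> 0" by blast
  show thesis
  proof (rule that[of "rho z"])
    show "rho z \<noteq> 0"
      by (rule rho(1)[OF z])
    fix x u v
    have "cross4 (Q x) (DQ x u) (DQ x v) $ i - ((rho z * det3 x u v) *s grad (Q x)) $ i = 0" for i
    proof (rule polyfun_mult_eq_0[OF inf f(1) _ _ x0])
      show "polyfun (\<lambda>x. cross4 (Q x) (DQ x u) (DQ x v) $ i - ((rho z * det3 x u v) *s grad (Q x)) $ i)"
        unfolding vector_smult_component
        by (intro polyfun_diff polyfun_mult polyfun_const polyfun_det3 polyfun_nth polyfun_cross4
            polyfun_Q polyfun_DQ polyfun_comp[OF polyfun_grad])
      fix x assume "f x \<noteq> 0"
      then have m: "misses z x"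
        by (rule f)
      have "rho z = rho x"
        using rho_line[OF m, of 1] rho_line[OF misses_sym[OF m], of 1] by (simp add: add.commute)
      then show "cross4 (Q x) (DQ x u) (DQ x v) $ i - ((rho z * det3 x u v) *s grad (Q x)) $ i = 0"
        using rho(2)[OF missesD(2)[OF m], of u v] by simp
    qed
    then show "cross4 (Q x) (DQ x u) (DQ x v) = (rho z * det3 x u v) *s grad (Q x)"
      by (simp add: vec_eq_iff)
  qed
qed

end


lemma dot_cross4_cycle:
  "dot a (cross4 b c d) = - dot d (cross4 a b c)" "dot b (cross4 a c d) = dot d (cross4 a b c)"
  "dot c (cross4 a b d) = - dot d (cross4 a b c)"
  by (simp_all add: dot_def sum_4 cross4_nth algebra_simps)

section \<open>Base points and the lines contracted to them\<close>

context cubic_parametrization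
begin

text \<open>Comparison of vanishing orders along \<open>w + t v\<close>: if \<open>Q\<close> vanishes to order \<open>m\<close> there,
  then \<open>grad (Q x)\<close> vanishes exactly to order \<open>2 m\<close> since the surface is smooth, but the cross product in
  \<open>cross4_Q_global\<close> would vanish to order at least \<open>2 m + 1\<close>.\<close>

lemma base_DQ_injective:
  assumes w: "w \<noteq> 0" "Q w = 0" and D: "DQ w u = 0"
  obtains c where "u = c *s w"
proof (rule ccontr)
  note obt = that
  assume "\<not> thesis"
  then have "\<exists>v. det3 w u v \<noteq> 0"
    using det3_nondegenerate[OF w(1), of u] obt by metis
  then obtain v0 where v0: "det3 w u v0 \<noteq> 0" by blast
  obtain x where "Q x \<noteq> 0"
    using ex_nonbase by blast
  then obtain k where "ev (q k) x \<noteq> 0"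
    by (auto simp: vec_eq_iff)
  then have k: "ev (q k) (w + (x - w)) \<noteq> 0"
    by simp
  \<comment> \<open>The direction \<open>v\<close> must be independent of \<open>w, u\<close>, and
    its line through \<open>w\<close> must leave the base locus.\<close>
  have "polyfun (\<lambda>v. det3 w u v)"
    by (intro polyfun_det3 polyfun_const polyfun_nth)
  moreover have "polyfun (\<lambda>v. ev (q k) (w + v))"
    by (rule polyfun_comp[OF polyfun_ev]) (auto intro: polyfun_add)
  ultimately obtain v where v: "det3 w u v \<noteq> 0" "ev (q k) (w + v) \<noteq> 0"
    using polyfun_common_nonzero[OF inf, of "\<lambda>v. det3 w u v" "\<lambda>v. ev (q k) (w + v)" v0 "x - w"] v0 k by blast
  let ?L = "\<lambda>i. line_poly (q i) w v"
  have "poly (?L k) 1 \<noteq> 0"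
    using v(2) by (simp add: poly_line_poly)
  then have "?L k \<noteq> 0"
    by auto
  then obtain m c where c: "\<And>i. ?L i = [:0, 1:] ^ m * c i" "\<exists>i. poly (c i) 0 \<noteq> 0"
    using common_order_at_0[of ?L k] by blast
  have "polyfun (\<lambda>x. dder (q i) x u)" for i
    using polyfun_DQ[of u i] by simp
  then obtain E where E: "\<And>i x. dder (q i) x u = ev (E i) x"
    unfolding polyfun_def by metis
  \<comment> \<open>Because \<open>DQ w u = 0\<close>, the derivative in direction \<open>u\<close>
    is divisible by \<open>t\<close> along the line. This is the surplus order of vanishing.\<close>
  have "[:0, 1:] dvd line_poly (E i) w v" for i
    using poly_eq_0_iff_dvd[of "line_poly (E i) w v" 0] D
    by (simp add: poly_line_poly vec_eq_iff flip: E)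
  then have "\<exists>r. line_poly (E i) w v = [:0, 1:] * r" for i
    by (simp add: dvd_def)
  then obtain r where r: "\<And>i. line_poly (E i) w v = [:0, 1:] * r i"
    by metis
  define C where "C t = (\<chi> i. poly (c i) t)" for t
  define C' where "C' t = (\<chi> i. poly (pderiv (c i)) t)" for t
  define R where "R t = (\<chi> i. poly (r i) t)" for t
  have Qt: "Q (w + t *s v) = t ^ m *s C t" for t
    by (simp add: vec_eq_iff C_def c(1) flip: poly_line_poly)
  have Dv: "DQ (w + t *s v) v = (of_nat m * t ^ (m - 1)) *s C t + t ^ m *s C' t" for t
    unfolding vec_eq_iff dder_vec_nth pderiv_line_poly[OF inf, symmetric] c(1)
    by (simp add: pderiv_mult pderiv_power C_def C'_def pderiv_pCons algebra_simps)
  have Du: "DQ (w + t *s v) u = t *s R t" for t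
    by (simp add: vec_eq_iff R_def E r flip: poly_line_poly)
  obtain \<mu> where mu: "\<mu> \<noteq> 0" "\<And>x u v. cross4 (Q x) (DQ x u) (DQ x v) = (\<mu> * det3 x u v) *s grad (Q x)"
    using cross4_Q_global by blast
  define del where "del = \<mu> * det3 w v u"
  have "del \<noteq> 0"
    using mu(1) v(1) det3_swap(2)[of w u v] by (simp add: del_def)
  \<comment> \<open>The part of \<open>DQ (w + t *s v) v\<close> parallel to \<open>C t\<close>
    drops out by alternation. Both sides then contain \<open>t ^ (2 * m)\<close>, and a factor
    \<open>t\<close> is left on the side of the cross product only.\<close>
  have main: "t *s cross4 (C t) (C' t) (R t) = del *s grad (C t)" if t: "t \<noteq> 0" for t
  proof -
    have "det3 (w + t *s v) v u = det3 w v u"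
      by (simp add: det3_linear det3_same)
    then have "cross4 (t ^ m *s C t) (DQ (w + t *s v) v) (t *s R t) = del *s grad (t ^ m *s C t)"
      using mu(2)[of "w + t *s v" v u] by (simp add: Qt Du del_def)
    then have "(t ^ (2 * m)) *s (t *s cross4 (C t) (C' t) (R t)) = (t ^ (2 * m)) *s (del *s grad (C t))"
      using t unfolding Dv
      by (simp add: cross4_linear cross4_same grad_scale mult_2 power_add power_mult power2_eq_square mult_ac)
    then show ?thesis
      using t by (simp add: vec_eq_iff)
  qed
  define G where "G i = mp_pderiv i F" for i
  have G: "grad v $ i = ev (G i) v" for v i
    by (simp add: grad_def G_def)
  have "[:0, 1:] * cross4 (\<chi> i. c i) (\<chi> i. pderiv (c i)) (\<chi> i. r i) $ i
      = smult del (mp_eval (\<lambda>c. [:c:]) (G i) (\<chi> i. c i))" for i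
  proof (rule poly_eqI_infinite)
    show "infinite (UNIV - {0 :: 'a})"
      using inf by simp
    fix t :: 'a assume "t \<in> UNIV - {0}"
    then have "(t *s cross4 (C t) (C' t) (R t)) $ i = (del *s grad (C t)) $ i"
      using main by simp
    then show "poly ([:0, 1:] * cross4 (\<chi> i. c i) (\<chi> i. pderiv (c i)) (\<chi> i. r i) $ i) t
        = poly (smult del (mp_eval (\<lambda>c. [:c:]) (G i) (\<chi> i. c i))) t"
      by (simp add: poly_cross4 poly_mp_eval_const G C_def C'_def R_def)
  qed
  from arg_cong[OF this, of "\<lambda>p. poly p 0"] have "grad (C 0) $ i = 0" for i
    using \<open>del \<noteq> 0\<close> by (simp add: poly_mp_eval_const G C_def)
  moreover have "ev F (C 0) = 0"
  proof -
    have "mp_eval (\<lambda>c. [:c:]) F (\<chi> i. c i) = 0"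
    proof (rule poly_eqI_infinite)
      show "infinite (UNIV - {0 :: 'a})"
        using inf by simp
      fix t :: 'a assume "t \<in> UNIV - {0}"
      then have "t \<noteq> 0" by simp
      have "(t ^ m) ^ 3 * ev F (C t) = 0"
        using F_Q[of "w + t *s v"] unfolding Qt F_scale .
      then show "poly (mp_eval (\<lambda>c. [:c:]) F (\<chi> i. c i)) t = poly 0 t"
        using \<open>t \<noteq> 0\<close> by (simp add: poly_mp_eval_const C_def)
    qed
    then show ?thesis
      using poly_mp_eval_const[of F "\<chi> i. c i" 0] by (simp add: C_def)
  qed
  moreover have "C 0 \<noteq> 0"
    using c(2) by (auto simp: C_def vec_eq_iff)
  ultimately show False
    using grad_nonzero[of "C 0"] by (simp add: vec_eq_iff)
qed

text \<open>\<open>DQ w u\<close> is the value at \<open>t = 0\<close> of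
  \<open>Q (w + t u) / t\<close>. The equation of the surface and the minors expressing
  \<open>p\<close> hold for generic \<open>t\<close> and persist at 0.\<close>

lemma base_contracted:
  assumes w: "w \<noteq> 0" "Q w = 0" and D: "DQ w u \<noteq> 0"
  shows "ev F (DQ w u) = 0" "p (abs_proj (DQ w u)) = abs_proj w"
proof -
  have "[:0, 1:] dvd line_poly (q i) w u" for i
    using poly_eq_0_iff_dvd[of "line_poly (q i) w u" 0] w(2) by (simp add: poly_line_poly vec_eq_iff)
  then have "\<exists>r. line_poly (q i) w u = [:0, 1:] * r" for i
    by (simp add: dvd_def)
  then obtain r where r: "\<And>i. line_poly (q i) w u = [:0, 1:] * r i"
    by metis
  define R where "R t = (\<chi> i. poly (r i) t)" for t
  have Qt: "Q (w + t *s u) = t *s R t" for t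
    by (simp add: vec_eq_iff R_def r flip: poly_line_poly)
  have R0: "R 0 = DQ w u"
    by (simp add: vec_eq_iff R_def dder_def r poly_0_coeff_0)
  have "mp_eval (\<lambda>c. [:c:]) F (\<chi> i. r i) = 0"
  proof (rule poly_eqI_infinite)
    show "infinite (UNIV - {0 :: 'a})"
      using inf by simp
    fix t :: 'a assume t: "t \<in> UNIV - {0}"
    have "t ^ 3 * ev F (R t) = 0"
      using F_Q[of "w + t *s u"] unfolding Qt F_scale .
    then show "poly (mp_eval (\<lambda>c. [:c:]) F (\<chi> i. r i)) t = poly 0 t"
      using t by (simp add: poly_mp_eval_const R_def)
  qed
  then show F0: "ev F (DQ w u) = 0"
    using poly_mp_eval_const[of F "\<chi> i. r i" 0] by (simp add: R_def R0[symmetric])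
  obtain g h where gh: "local_rep F p g h" "ev h (DQ w u) \<noteq> 0"
    using ex_local_rep[OF D F0] by blast
  obtain e e' where hom: "\<And>i. homogeneous e (g i)" "homogeneous e' h"
    using gh(1) unfolding local_rep_def by blast
  have "poly (mp_eval (\<lambda>c. [:c:]) h (\<chi> i. r i)) 0 \<noteq> 0"
    using gh(2) by (simp add: poly_mp_eval_const R_def R0[symmetric])
  then have "mp_eval (\<lambda>c. [:c:]) h (\<chi> i. r i) * [:0, 1:] \<noteq> 0"
    by auto
  then obtain t where "poly (mp_eval (\<lambda>c. [:c:]) h (\<chi> i. r i) * [:0, 1:]) t \<noteq> 0"
    using poly_eqI_infinite[OF inf, of _ 0] by (metis poly_0)
  then have "t \<noteq> 0" "ev h (R t) \<noteq> 0"
    by (auto simp: poly_mp_eval_const R_def)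
  then have hQ: "ev h (Q (w + t *s u)) \<noteq> 0"
    by (simp add: Qt mp_eval_scale[OF hom(2)])
  have "mp_eval (\<lambda>c. [:c:]) (g i) (\<chi> i. r i) * [:w $ j, u $ j:]
      = mp_eval (\<lambda>c. [:c:]) (g j) (\<chi> i. r i) * [:w $ i, u $ i:]" for i j
  proof (rule poly_eqI_infinite)
    show "infinite (UNIV - {0 :: 'a})"
      using inf by simp
    fix t :: 'a assume t: "t \<in> UNIV - {0}"
    have "t ^ e * (ev (g i) (R t) * (w + t *s u) $ j) = t ^ e * (ev (g j) (R t) * (w + t *s u) $ i)"
      using local_rep_identity[OF gh(1) hQ, of i "w + t *s u" j]
      unfolding Qt mp_eval_scale[OF hom(1)] by (simp add: mult.assoc)
    then have "ev (g i) (R t) * (w + t *s u) $ j = ev (g j) (R t) * (w + t *s u) $ i"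
      using t by simp
    then show "poly (mp_eval (\<lambda>c. [:c:]) (g i) (\<chi> i. r i) * [:w $ j, u $ j:]) t
      = poly (mp_eval (\<lambda>c. [:c:]) (g j) (\<chi> i. r i) * [:w $ i, u $ i:]) t"
      using t by (simp add: poly_mp_eval_const R_def algebra_simps)
  qed
  from arg_cong[OF this, of "\<lambda>p. poly p 0"]
  have id: "ev (g i) (DQ w u) * w $ j = ev (g j) (DQ w u) * w $ i" for i j
    by (simp add: poly_mp_eval_const R_def R0[symmetric] mult.commute)
  have "eval_vec g (DQ w u) \<noteq> 0" "p (abs_proj (DQ w u)) = abs_proj (eval_vec g (DQ w u))"
    using gh D F0 unfolding local_rep_def by blast+
  moreover have "abs_proj (eval_vec g (DQ w u)) = abs_proj w"
    by (rule abs_proj_eqI) (use calculation w id in auto)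
  ultimately show "p (abs_proj (DQ w u)) = abs_proj w"
    by simp
qed

text \<open>Irreducibility in the form used from here on: two nonempty open subsets of the surface
  meet.\<close>

lemma surface_common_nonzero:
  assumes "polyfun f" "polyfun g" "ev F u = 0" "f u \<noteq> 0" "ev F v = 0" "g v \<noteq> 0"
  shows "\<exists>w. ev F w = 0 \<and> f w \<noteq> 0 \<and> g w \<noteq> 0"
  using smooth_cubic_irreducible[OF hom_F smooth_F assms(1,2)] assms(3-) by blast

lemma surface_zeroI:
  assumes "polyfun f" "polyfun c" "ev F u = 0" "c u \<noteq> 0" "\<And>w. ev F w = 0 \<Longrightarrow> c w \<noteq> 0 \<Longrightarrow> f w = 0"
    and "ev F v = 0"
  shows "f v = 0"
  using surface_common_nonzero[OF assms(1,2) _ _ assms(3,4), of v] assms(5,6) by blast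

text \<open>Near any point the local forms for \<open>p\<close> may be compared with those near a given point \<open>Q x\<close>.\<close>

lemma local_rep_generic:
  assumes v: "v \<noteq> 0" "ev F v = 0" "local_rep F p g h" "ev h v \<noteq> 0"
    and x: "x \<noteq> 0" "Q x \<noteq> 0" and f: "polyfun f" "f x \<noteq> 0" "\<And>c y. c \<noteq> 0 \<Longrightarrow> f y \<noteq> 0 \<Longrightarrow> f (c *s y) \<noteq> 0"
  shows "\<exists>w. w \<noteq> 0 \<and> ev F w = 0 \<and> ev h w \<noteq> 0 \<and> f (eval_vec g w) \<noteq> 0"
proof -
  obtain g1 h1 e1 c where g1: "local_rep F p g1 h1" "ev h1 (Q x) \<noteq> 0" "c \<noteq> 0" "eval_vec g1 (Q x) = c *s x"
    using local_rep_at_Q[OF x] by metis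
  obtain k where k: "v $ k \<noteq> 0"
    using v(1) by (auto simp: vec_eq_iff)
  have pf: "polyfun (\<lambda>w. ev h w * w $ k)"
    by (intro polyfun_mult polyfun_ev polyfun_nth)
  have pf1: "polyfun (\<lambda>w. ev h1 w * f (eval_vec g1 w))"
    by (intro polyfun_mult polyfun_ev polyfun_comp[OF f(1)]) simp
  have "f (eval_vec g1 (Q x)) \<noteq> 0"
    using f(2,3) g1(3,4) by simp
  then obtain w where w: "ev F w = 0" "ev h w * w $ k \<noteq> 0" "ev h1 w * f (eval_vec g1 w) \<noteq> 0"
    using surface_common_nonzero[OF pf pf1 v(2) _ F_Q[of x]] v(4) k g1(2) by auto
  then have "w \<noteq> 0"
    by auto
  have a: "eval_vec g w \<noteq> 0" "p (abs_proj w) = abs_proj (eval_vec g w)"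
    using v(3) w \<open>w \<noteq> 0\<close> unfolding local_rep_def by auto
  have b: "eval_vec g1 w \<noteq> 0" "p (abs_proj w) = abs_proj (eval_vec g1 w)"
    using g1(1) w \<open>w \<noteq> 0\<close> unfolding local_rep_def by auto
  obtain c' where "c' \<noteq> 0" "eval_vec g w = c' *s eval_vec g1 w"
    using abs_proj_eq_iff[OF b(1) a(1)] a(2) b(2) by auto
  then show ?thesis
    using w \<open>w \<noteq> 0\<close> f(3) by auto
qed

text \<open>\<open>Q\<close> undoes \<open>p\<close> where \<open>inverse\<close> applies, a
  nonempty open set; irreducibility spreads the minor equations over the whole surface. They say
  nothing where \<open>Q x = 0\<close>, which is why fibres over base points need a separate
  argument.\<close>

lemma Q_p_proportional:
  assumes v: "v \<noteq> 0" "ev F v = 0" and x: "x \<noteq> 0" "p (abs_proj v) = abs_proj x"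
  shows "Q x $ i * v $ j = Q x $ j * v $ i"
proof -
  obtain g h where gh: "local_rep F p g h" "ev h v \<noteq> 0"
    using ex_local_rep[OF v] by blast
  obtain n where n: "homogeneous n chi"
    using hom_chi by blast
  obtain x1 where x1: "x1 \<noteq> 0" "ev chi x1 \<noteq> 0" "Q x1 \<noteq> 0"
    using chi_generic[of "\<lambda>_. 1" undefined] by auto
  obtain w where w: "w \<noteq> 0" "ev F w = 0" "ev h w \<noteq> 0" "ev chi (eval_vec g w) \<noteq> 0"
    using local_rep_generic[OF v gh x1(1,3) polyfun_ev x1(2)] by (auto simp: mp_eval_scale[OF n])
  obtain v0 where v0: "ev F v0 = 0" "ev tau v0 \<noteq> 0"
    using tau_nonzero by blast
  have pf: "polyfun (\<lambda>v. ev chi (eval_vec g v))"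
    by (rule polyfun_comp[OF polyfun_ev]) simp
  obtain w' where w': "ev F w' = 0" "ev h w' * ev chi (eval_vec g w') \<noteq> 0" "ev tau w' \<noteq> 0"
    using surface_common_nonzero[OF polyfun_mult[OF polyfun_ev[of h] pf] polyfun_ev[of tau] w(2) _ v0] w by auto
  let ?f = "\<lambda>v. Q (eval_vec g v) $ i * v $ j - Q (eval_vec g v) $ j * v $ i"
  have "?f v = 0"
  proof (rule surface_zeroI[where c = "\<lambda>v. (ev h v * ev chi (eval_vec g v)) * ev tau v"])
    show "polyfun ?f"
      unfolding eval_vec_nth by (intro polyfun_diff polyfun_mult polyfun_nth polyfun_comp[OF polyfun_ev], simp_all)
    show "polyfun (\<lambda>v. (ev h v * ev chi (eval_vec g v)) * ev tau v)"
      by (intro polyfun_mult polyfun_ev pf)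
    show "ev F w' = 0" "ev h w' * ev chi (eval_vec g w') * ev tau w' \<noteq> 0"
      using w' by auto
    fix u assume u: "ev F u = 0" "ev h u * ev chi (eval_vec g u) * ev tau u \<noteq> 0"
    show "?f u = 0"
    proof (cases "u = 0")
      case False
      let ?y = "eval_vec g u"
      have y: "?y \<noteq> 0" "p (abs_proj u) = abs_proj ?y"
        using gh(1) u False unfolding local_rep_def by auto
      have e: "abs_proj u = abs_proj (eval_vec g0 ?y)" and g0y: "eval_vec g0 ?y \<noteq> 0"
        using inverse[OF False u(1) _ y] u(2) g0[OF y(1)] by auto
      obtain c where c: "Q ?y = c *s eval_vec g0 ?y"
        using Q_proportional_g0[OF g0y] by blast
      show ?thesis
        using abs_proj_eqD[OF e False g0y, of i j] by (simp add: c algebra_simps)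
    qed simp
  qed (use v in auto)
  moreover have "eval_vec g v \<noteq> 0" "p (abs_proj v) = abs_proj (eval_vec g v)"
    using gh v unfolding local_rep_def by blast+
  then obtain c where "x = c *s eval_vec g v"
    using x abs_proj_eq_iff[of "eval_vec g v" x] by auto
  ultimately show ?thesis
    unfolding eval_vec_nth by (simp add: mp_eval_scale[OF hom_q] algebra_simps)
qed

corollary abs_proj_eq_Q:
  assumes v: "v \<noteq> 0" "ev F v = 0" and x: "x \<noteq> 0" "p (abs_proj v) = abs_proj x" and "Q x \<noteq> 0"
  shows "abs_proj v = abs_proj (Q x)"
  by (rule abs_proj_eqI) (use assms Q_p_proportional[OF v x] in \<open>auto simp: mult.commute\<close>)

text \<open>As \<open>Q\<close> vanishes at \<open>w\<close>, the forms lie in the ideal of the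
  coordinates along \<open>u\<close> and \<open>v\<close>. On the axis through \<open>w\<close> the
  cofactors are first derivatives, of degree 2 since the forms are cubic.\<close>

lemma Q_in_base_coordinates:
  assumes w: "Q w = 0"
  obtains A B :: "4 \<Rightarrow> 'a ^ 3 \<Rightarrow> 'a" where "\<And>i. polyfun (A i)" "\<And>i. polyfun (B i)"
    "\<And>y i. ev (q i) (y $ 1 *s w + y $ 2 *s u + y $ 3 *s v) = y $ 2 * A i y + y $ 3 * B i y"
    "\<And>i s. s \<noteq> 0 \<Longrightarrow> A i (s *s axis 1 1) = s ^ 2 * DQ w u $ i"
    "\<And>i s. s \<noteq> 0 \<Longrightarrow> B i (s *s axis 1 1) = s ^ 2 * DQ w v $ i"
proof -
  let ?f = "\<lambda>i (y :: 'a ^ 3). ev (q i) (y $ 1 *s w + y $ 2 *s u + y $ 3 *s v)"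
  have pf: "polyfun (?f i)" for i
    by (rule polyfun_comp[OF polyfun_ev]) (auto intro!: polyfun_add polyfun_mult)
  have ax: "(axis 1 1 :: 'a ^ 3) $ 1 = 1" "(axis 1 1 :: 'a ^ 3) $ 2 = 0" "(axis 1 1 :: 'a ^ 3) $ 3 = 0"
    by (simp_all add: axis_def)
  have z: "?f i (s *s axis 1 1) = 0" for i s
  proof -
    have "Q (s *s w) = 0"
      by (simp add: q_scale w)
    then have "ev (q i) (s *s w) = 0"
      by (metis eval_vec_nth zero_index)
    then show ?thesis
      by (simp add: ax)
  qed
  have "\<exists>A B. polyfun A \<and> polyfun B \<and> (\<forall>y. ?f i y = y $ 2 * A y + y $ 3 * B y)" for i
    using polyfun_split[OF pf[of i]] unfolding z by simp
  then obtain A B where AB: "\<And>i. polyfun (A i)" "\<And>i. polyfun (B i)" "\<And>i y. ?f i y = y $ 2 * A i y + y $ 3 * B i y"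
    by metis
  have q3: "dder (q i) (s *s w) y = s ^ 2 * dder (q i) w y" if "s \<noteq> 0" for i s y
    using dder_scale_arg[of 2 "q i" s w y] hom_q[of i] that by (simp add: d_eq_3)
  have lin: "dder (q i) (s *s w) y = a (s *s axis 1 1)"
    if a: "polyfun a" "\<And>t. ev (q i) (s *s w + t *s y) = t * a (s *s axis 1 1 + t *s z)" for a i s y z
  proof -
    obtain G where G: "a = ev G"
      using a(1) by (auto simp: polyfun_def)
    have "line_poly (q i) (s *s w) y = [:0, 1:] * line_poly G (s *s axis 1 1) z"
      by (rule poly_eqI_infinite[OF inf]) (simp add: poly_line_poly a(2) G)
    then show ?thesis
      by (simp add: dder_def coeff_0_line_poly G)
  qed
  show thesis
  proof (rule that[OF AB(1,2,3)])
    fix i s assume s: "(s :: 'a) \<noteq> 0"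
    have "ev (q i) (s *s w + t *s u) = t * A i (s *s axis 1 1 + t *s axis 2 1)" for t
      using AB(3)[of i "s *s axis 1 1 + t *s axis 2 1"] by (simp add: axis_def)
    from lin[OF AB(1) this] have "dder (q i) (s *s w) u = A i (s *s axis 1 1)" .
    then show "A i (s *s axis 1 1) = s ^ 2 * DQ w u $ i"
      using q3[OF s] by simp
    have "ev (q i) (s *s w + t *s v) = t * B i (s *s axis 1 1 + t *s axis 3 1)" for t
      using AB(3)[of i "s *s axis 1 1 + t *s axis 3 1"] by (simp add: axis_def)
    from lin[OF AB(2) this] have "dder (q i) (s *s w) v = B i (s *s axis 1 1)" .
    then show "B i (s *s axis 1 1) = s ^ 2 * DQ w v $ i"
      using q3[OF s] by simp
  qed
qed

text \<open>The fibre over a base point is no larger than the contracted line: at another point of the fibre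
  the two coordinates of \<open>p\<close> centred at \<open>w\<close> would satisfy a homogeneous \<open>2 \<times> 2\<close> linear system that is
  invertible there (Nakayama), so \<open>p\<close> would be constant on an open set.\<close>

theorem base_fibre:
  assumes w: "w \<noteq> 0" "Q w = 0" and z: "z \<noteq> 0" "ev F z = 0" "p (abs_proj z) = abs_proj w"
  obtains u where "z = DQ w u"
proof (rule ccontr)
  note obt = that
  assume "\<not> thesis"
  then have notin: "z \<noteq> DQ w u" for u
    using obt by blast
  obtain u v where uv: "det3 w u v \<noteq> 0"
    using det3_complete[OF w(1)] by blast
  let ?a = "DQ w u" and ?b = "DQ w v"
  have "cross4 ?a ?b z \<noteq> 0"
  proof
    assume "cross4 ?a ?b z = 0"
    then obtain r s t where rst: "(r, s, t) \<noteq> (0, 0, 0)" "r *s ?a + s *s ?b + t *s z = 0"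
      using cross4_eq_0 by blast
    show False
    proof (cases "t = 0")
      case True
      then have "DQ w (r *s u + s *s v) = 0"
        using rst(2) by (simp add: dder_vec_linear)
      then obtain c where "r *s u + s *s v = c *s w"
        using base_DQ_injective[OF w] by blast
      then have "(- c) *s w + (r *s u + s *s v) = 0"
        by simp
      then have "(- c) *s w + r *s u + s *s v = 0"
        by (simp only: add.assoc)
      from det3_indep[OF uv this] show False
        using rst(1) True by auto
    next
      case False
      have "z = DQ w ((- r / t) *s u + (- s / t) *s v)"
      proof -
        have "t * z $ i = - r * ?a $ i - s * ?b $ i" for i
          using arg_cong[OF rst(2), of "\<lambda>x. x $ i"] by (simp add: algebra_simps eq_neg_iff_add_eq_0)
        then have "z $ i = (- r / t) * ?a $ i + (- s / t) * ?b $ i" for i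
          using False by (simp add: field_simps del: dder_vec_nth)
        then show ?thesis
          unfolding dder_vec_linear vec_eq_iff by simp
      qed
      then show False
        using notin by blast
    qed
  qed
  then obtain j where "cross4 ?a ?b z $ j \<noteq> 0"
    by (auto simp: vec_eq_iff)
  then obtain e where e: "dot e (cross4 ?a ?b z) \<noteq> 0"
    by (metis dot_axis dot_commute)
  \<comment> \<open>Up to nonzero factors these are the linear forms dual to \<open>?a\<close>,
    \<open>?b\<close>, \<open>z\<close> that vanish on the complementary vector
    \<open>e\<close>.\<close>
  define f0 where "f0 y = dot y (cross4 ?b z e)" for y
  define f1 where "f1 y = dot y (cross4 ?a z e)" for y
  define f2 where "f2 y = dot y (cross4 ?a ?b e)" for y
  have vals: "f0 ?a \<noteq> 0" "f0 ?b = 0" "f0 z = 0" "f1 ?b \<noteq> 0" "f1 ?a = 0" "f1 z = 0" "f2 z \<noteq> 0" "f2 ?a = 0" "f2 ?b = 0"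
    using e dot_cross4_cycle(1)[of ?a ?b z e] dot_cross4_cycle(2)[of ?b ?a z e] dot_cross4_cycle(3)[of z ?a ?b e]
    by (simp_all add: f0_def f1_def f2_def)
  obtain g h where gh: "local_rep F p g h" "ev h z \<noteq> 0"
    using ex_local_rep[OF z(1,2)] by blast
  define \<delta> where "\<delta> = det3 w u v"
  \<comment> \<open>By Cramer's rule \<open>Y x\<close> is \<open>\<delta>\<close> times the
    coordinate vector of \<open>x\<close> with respect to \<open>w, u, v\<close>.\<close>
  define Y :: "'a ^ 3 \<Rightarrow> 'a ^ 3" where "Y x = (\<chi> i. if i = 1 then det3 x u v else if i = 2 then det3 w x v else det3 w u x)" for x
  have Y: "Y x $ 1 = det3 x u v" "Y x $ 2 = det3 w x v" "Y x $ 3 = det3 w u x" for x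
    by (simp_all add: Y_def)
  have Yx: "\<delta> *s x = Y x $ 1 *s w + Y x $ 2 *s u + Y x $ 3 *s v" for x
    unfolding Y \<delta>_def by (rule det3_cramer)
  obtain A B :: "4 \<Rightarrow> 'a ^ 3 \<Rightarrow> 'a" where AB: "\<And>i. polyfun (A i)" "\<And>i. polyfun (B i)"
    "\<And>y i. ev (q i) (y $ 1 *s w + y $ 2 *s u + y $ 3 *s v) = y $ 2 * A i y + y $ 3 * B i y"
    "\<And>i s. s \<noteq> 0 \<Longrightarrow> A i (s *s axis 1 1) = s ^ 2 * ?a $ i"
    "\<And>i s. s \<noteq> 0 \<Longrightarrow> B i (s *s axis 1 1) = s ^ 2 * ?b $ i"
    using Q_in_base_coordinates[OF w(2)] by blast
  define Av where "Av x = (\<chi> i. A i (Y (eval_vec g x)))" for x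
  define Bv where "Bv x = (\<chi> i. B i (Y (eval_vec g x)))" for x
  have QY: "Q (\<delta> *s eval_vec g x) = Y (eval_vec g x) $ 2 *s Av x + Y (eval_vec g x) $ 3 *s Bv x" for x
    unfolding Yx vec_eq_iff eval_vec_nth AB(3) by (simp add: Av_def Bv_def)
  \<comment> \<open>\<open>Q\<close> at the image of \<open>x\<close> is proportional to
    \<open>x\<close>. Eliminating the factor with \<open>f0\<close>, \<open>f1\<close>,
    \<open>f2\<close> leaves two linear equations for the second and third coordinate of the image;
    these are the entries of their matrix.\<close>
  define M11 where "M11 x = f0 (Av x) * f2 x - f2 (Av x) * f0 x" for x
  define M12 where "M12 x = f0 (Bv x) * f2 x - f2 (Bv x) * f0 x" for x
  define M21 where "M21 x = f1 (Av x) * f2 x - f2 (Av x) * f1 x" for x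
  define M22 where "M22 x = f1 (Bv x) * f2 x - f2 (Bv x) * f1 x" for x
  define D where "D x = M11 x * M22 x - M12 x * M21 x" for x
  have gz: "eval_vec g z \<noteq> 0" "p (abs_proj z) = abs_proj (eval_vec g z)"
    using gh z unfolding local_rep_def by blast+
  obtain s where s: "s \<noteq> 0" "eval_vec g z = s *s w"
    using abs_proj_eq_iff[OF w(1) gz(1)] gz(2) z(3) by auto
  have Yz: "Y (eval_vec g z) = (s * \<delta>) *s axis 1 1"
    unfolding s(2) by (simp add: vec_eq_iff forall_3 Y det3_linear det3_same axis_def \<delta>_def)
  have sd: "s * \<delta> \<noteq> 0"
    using s uv by (simp add: \<delta>_def)
  have Az: "Av z = (s * \<delta>) ^ 2 *s ?a" "Bv z = (s * \<delta>) ^ 2 *s ?b"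
    by (simp_all add: Av_def Bv_def Yz vec_eq_iff AB(4,5)[OF sd])
  have fl: "f0 (c *s y) = c * f0 y" "f1 (c *s y) = c * f1 y" "f2 (c *s y) = c * f2 y"
    "f0 (x + y) = f0 x + f0 y" "f1 (x + y) = f1 x + f1 y" "f2 (x + y) = f2 x + f2 y" for c x y
    by (simp_all add: f0_def f1_def f2_def dot_simps)
  \<comment> \<open>At \<open>z\<close> the matrix is diagonal: the image is \<open>w\<close>, so
    \<open>Av z\<close> and \<open>Bv z\<close> are multiples of \<open>?a\<close> and
    \<open>?b\<close>, which the dual forms separate.\<close>
  have Dz: "D z \<noteq> 0"
    using sd vals by (simp add: D_def M11_def M12_def M21_def M22_def Az fl)
  have pY: "polyfun (\<lambda>x. Y (eval_vec g x) $ i)" for i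
  proof -
    have "\<forall>i. polyfun (\<lambda>x. Y (eval_vec g x) $ i)"
      unfolding forall_3 Y by (intro conjI polyfun_det3 polyfun_const) simp_all
    then show ?thesis by blast
  qed
  have pA: "polyfun (\<lambda>x. Av x $ i)" "polyfun (\<lambda>x. Bv x $ i)" for i
    by (simp_all add: Av_def Bv_def polyfun_comp[OF AB(1) pY] polyfun_comp[OF AB(2) pY])
  have pf: "polyfun (\<lambda>x. f0 (k x))" "polyfun (\<lambda>x. f1 (k x))" "polyfun (\<lambda>x. f2 (k x))"
    if "\<And>i. polyfun (\<lambda>x. k x $ i)" for k :: "'a ^ 4 \<Rightarrow> 'a ^ 4"
    unfolding f0_def f1_def f2_def by (intro polyfun_dot polyfun_const that)+
  have pD: "polyfun D"
    unfolding D_def[abs_def] M11_def M12_def M21_def M22_def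
    by (intro polyfun_diff polyfun_mult pf pA polyfun_nth)
  have sys: "D x * Y (eval_vec g x) $ 2 = 0" "D x * Y (eval_vec g x) $ 3 = 0"
    if x: "x \<noteq> 0" "ev F x = 0" "ev h x \<noteq> 0" for x
  proof -
    let ?y = "eval_vec g x"
    have y: "?y \<noteq> 0" "p (abs_proj x) = abs_proj ?y"
      using gh(1) x unfolding local_rep_def by blast+
    have "Q (\<delta> *s ?y) $ i * x $ j = Q (\<delta> *s ?y) $ j * x $ i" for i j
      using Q_p_proportional[OF x(1,2) y, of i j] unfolding q_scale by (simp add: mult.assoc)
    then obtain c where c: "Q (\<delta> *s ?y) = c *s x"
      using proportional_cases[of "Q (\<delta> *s ?y)" x] x(1) by blast
    have "f0 (Q (\<delta> *s ?y)) * f2 x = f2 (Q (\<delta> *s ?y)) * f0 x" "f1 (Q (\<delta> *s ?y)) * f2 x = f2 (Q (\<delta> *s ?y)) * f1 x"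
      unfolding c by (simp_all add: fl)
    then have e: "Y ?y $ 2 * M11 x + Y ?y $ 3 * M12 x = 0" "Y ?y $ 2 * M21 x + Y ?y $ 3 * M22 x = 0"
      unfolding QY by (simp_all add: fl M11_def M12_def M21_def M22_def algebra_simps)
    have "D x * Y ?y $ 2 = M22 x * (Y ?y $ 2 * M11 x + Y ?y $ 3 * M12 x) - M12 x * (Y ?y $ 2 * M21 x + Y ?y $ 3 * M22 x)"
      "D x * Y ?y $ 3 = M11 x * (Y ?y $ 2 * M21 x + Y ?y $ 3 * M22 x) - M21 x * (Y ?y $ 2 * M11 x + Y ?y $ 3 * M12 x)"
      by (simp_all add: D_def algebra_simps)
    then show "D x * Y ?y $ 2 = 0" "D x * Y ?y $ 3 = 0"
      unfolding e by simp_all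
  qed
  obtain k where k: "z $ k \<noteq> 0"
    using z(1) by (auto simp: vec_eq_iff)
  \<comment> \<open>Where the determinant \<open>D\<close> is nonzero the two coordinates vanish,
    hence by irreducibility everywhere on the surface; \<open>p\<close> would only take the value
    \<open>w\<close>.\<close>
  have Y0: "Y (eval_vec g x) $ i = 0" if "i = 2 \<or> i = 3" "ev F x = 0" for x i
  proof (rule surface_zeroI[where c = "\<lambda>x. ev h x * x $ k * D x" and u = z])
    fix x assume "ev F x = 0" "ev h x * x $ k * D x \<noteq> 0"
    moreover from this have "x \<noteq> 0"
      by auto
    ultimately show "Y (eval_vec g x) $ i = 0"
      using sys[of x] that(1) by auto
  qed (use k gh Dz z that pY pD in \<open>auto intro!: polyfun_mult\<close>)
  obtain x1 where x1: "x1 \<noteq> 0" "Q x1 \<noteq> 0"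
    using ex_nonbase Q_nonzero_imp by blast
  have "Y x1 $ 2 \<noteq> 0 \<or> Y x1 $ 3 \<noteq> 0"
  proof (rule ccontr)
    assume "\<not> (Y x1 $ 2 \<noteq> 0 \<or> Y x1 $ 3 \<noteq> 0)"
    then have "\<delta> *s x1 = Y x1 $ 1 *s w"
      using Yx[of x1] by simp
    then have "\<delta> ^ d *s Q x1 = 0"
      using q_scale[of \<delta> x1] q_scale[of "Y x1 $ 1" w] w(2) by simp
    then show False
      using x1 uv by (simp add: \<delta>_def)
  qed
  then obtain i where i: "i = 2 \<or> i = 3" "Y x1 $ i \<noteq> 0" by blast
  have Ysc: "Y (c *s y) = c *s Y y" for c y
    by (simp add: vec_eq_iff forall_3 Y det3_linear)
  have "polyfun (\<lambda>x. Y x $ i)" for i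
  proof -
    have "\<forall>i. polyfun (\<lambda>x. Y x $ i)"
      unfolding forall_3 Y by (intro conjI polyfun_det3 polyfun_const polyfun_nth)
    then show ?thesis by blast
  qed
  then obtain x where "ev F x = 0" "Y (eval_vec g x) $ i \<noteq> 0"
    using local_rep_generic[OF z(1,2) gh x1, of "\<lambda>x. Y x $ i"] i(2) Ysc by auto
  then show False
    using Y0 i(1) by blast
qed

end


section \<open>Lines avoiding the base points\<close>

lemma degree_line_poly:
  assumes "homogeneous d F"
  shows "degree (line_poly F x v) \<le> d"
proof -
  have "degree ([:Poly_Mapping.lookup F m:] * (\<Prod>i\<in>UNIV. [:x $ i, v $ i:] ^ Poly_Mapping.lookup m i)) \<le> d"
    if "m \<in> Poly_Mapping.keys F" for m
  proof -
    have "degree (\<Prod>i\<in>UNIV. [:x $ i, v $ i:] ^ Poly_Mapping.lookup m i)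
      \<le> (\<Sum>i\<in>UNIV. degree ([:x $ i, v $ i:] ^ Poly_Mapping.lookup m i))"
      by (rule order_trans[OF degree_prod_sum_le]) auto
    also have "\<dots> \<le> (\<Sum>i\<in>UNIV. Poly_Mapping.lookup m i)"
      by (intro sum_mono order_trans[OF degree_power_le]) simp
    also have "\<dots> = d"
      using assms that by (simp add: homogeneous_def)
    finally show ?thesis
      by (intro order_trans[OF degree_mult_le]) simp
  qed
  then show ?thesis
    unfolding line_poly_def mp_eval_def by (intro degree_sum_le) simp_all
qed

text \<open>The first two coefficients are value and derivative at \<open>z\<close>; reversing the
  line gives the other two at \<open>x\<close>. No second derivatives, and so no division by 2, are
  involved.\<close>

lemma cubic_on_line:
  fixes G :: "('a::field, 'n::finite) mpoly"
  assumes inf: "infinite (UNIV :: 'a set)" and G: "homogeneous 3 G"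
  shows "ev G (a *s z + b *s x) = a ^ 3 * ev G z + a ^ 2 * b * dder G z x + a * b ^ 2 * dder G x z + b ^ 3 * ev G x"
proof -
  let ?L = "line_poly G z x" and ?M = "line_poly G x z"
  have expand: "poly p t = coeff p 0 + coeff p 1 * t + coeff p 2 * t ^ 2 + coeff p 3 * t ^ 3"
    if "degree p \<le> 3" for p :: "'a poly" and t
  proof -
    have "poly p t = (\<Sum>i\<le>3. coeff p i * t ^ i)"
      unfolding poly_altdef
      by (rule sum.mono_neutral_left) (use that in \<open>auto simp: coeff_eq_0\<close>)
    then show ?thesis
      by (simp add: eval_nat_numeral)
  qed
  have c: "coeff ?L 0 = ev G z" "coeff ?L 1 = dder G z x" "coeff ?M 0 = ev G x" "coeff ?M 1 = dder G x z"
    by (simp_all add: coeff_0_line_poly dder_def)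
  have dL: "degree ?L \<le> 3" "degree ?M \<le> 3"
    by (rule degree_line_poly[OF G])+
  have "?L = [:coeff ?M 3, coeff ?M 2, coeff ?M 1, coeff ?M 0:]"
  proof (rule poly_eqI_infinite)
    show "infinite (UNIV - {0 :: 'a})"
      using inf by simp
    fix t :: 'a assume "t \<in> UNIV - {0}"
    then have t: "t \<noteq> 0" by simp
    then have "z + t *s x = t *s (x + (1 / t) *s z)"
      by (simp add: vec_eq_iff field_simps)
    then have "poly ?L t = t ^ 3 * poly ?M (1 / t)"
      unfolding poly_line_poly using mp_eval_scale[OF G] by metis
    also have "\<dots> = coeff ?M 0 * t ^ 3 + coeff ?M 1 * t ^ 2 + coeff ?M 2 * t + coeff ?M 3"
      unfolding expand[OF dL(2)] distrib_left using t by (simp add: power2_eq_square power3_eq_cube)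
    finally show "poly ?L t = poly [:coeff ?M 3, coeff ?M 2, coeff ?M 1, coeff ?M 0:] t"
      by (simp add: algebra_simps power2_eq_square power3_eq_cube)
  qed
  then have c2: "coeff ?L 2 = dder G x z" "coeff ?L 3 = ev G x"
    using c(3,4) by (simp_all add: eval_nat_numeral)
  show ?thesis
  proof (cases "a = 0")
    case True
    then show ?thesis
      by (simp add: mp_eval_scale[OF G])
  next
    case False
    have "a *s z + b *s x = a *s (z + (b / a) *s x)"
      using False by (simp add: vec_eq_iff field_simps)
    then have "ev G (a *s z + b *s x) = a ^ 3 * poly ?L (b / a)"
      by (simp only: mp_eval_scale[OF G] poly_line_poly)
    also have "poly ?L (b / a) = ev G z + dder G z x * (b / a) + dder G x z * (b / a) ^ 2 + ev G x * (b / a) ^ 3"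
      unfolding expand[OF dL(1)] c c2 ..
    also have "a ^ 3 * \<dots> = a ^ 3 * ev G z + a ^ 2 * b * dder G z x + a * b ^ 2 * dder G x z + b ^ 3 * ev G x"
      unfolding distrib_left using False by (simp add: power2_eq_square power3_eq_cube)
    finally show ?thesis .
  qed
qed

text \<open>The cross product of the two rows \<open>f0, f1, f2\<close> and
  \<open>f1, f2, f3\<close> solves both equations; the remaining cases are those of dependent
  rows.\<close>

lemma ex_orthogonal:
  fixes f0 f1 f2 f3 :: "'a::field"
  obtains s0 s1 s2 where "(s0, s1, s2) \<noteq> (0, 0, 0)" "s0 * f0 + s1 * f1 + s2 * f2 = 0" "s0 * f1 + s1 * f2 + s2 * f3 = 0"
proof (cases "f0 = 0 \<and> f1 = 0 \<and> f2 = 0")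
  case True
  then show thesis
    using that[of 1 0 0] by simp
next
  case A: False
  let ?c0 = "f1 * f3 - f2 * f2" and ?c1 = "f2 * f1 - f0 * f3" and ?c2 = "f0 * f2 - f1 * f1"
  show thesis
  proof (cases "?c0 = 0 \<and> ?c1 = 0 \<and> ?c2 = 0")
    case False
    then show thesis
      using that[of ?c0 ?c1 ?c2] by (auto simp: algebra_simps)
  next
    case True
    then have e: "f1 * f3 = f2 * f2" "f0 * f3 = f2 * f1" "f0 * f2 = f1 * f1"
      by auto
    show thesis
    proof (cases "f1 = 0")
      case True
      then have "f2 = 0"
        using e by auto
      then show thesis
        using that[of 0 1 0] True by simp
    next
      case False
      then show thesis
        using that[of f1 "- f0" 0] e by (auto simp: algebra_simps)
    qed
  qed
qed

section \<open>The image of a line as a twisted cubic, and plane sections through three of its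
  points\<close>

context cubic_parametrization
begin

lemma Q_on_line: "Q (a *s z + b *s x) = a ^ 3 *s Q z + (a ^ 2 * b) *s DQ z x + (a * b ^ 2) *s DQ x z + b ^ 3 *s Q x"
  using cubic_on_line[OF inf, of "q i" for i] hom_q d_eq_3 by (simp add: vec_eq_iff)

lemma misses_indep2:
  assumes "misses x y" "a *s x + b *s y = 0"
  shows "a = 0" "b = 0"
  using missesD(4)[OF assms(1), of a b] assms(2) Q_0 by auto

lemma DQ_on_line: "DQ (z + t *s x) x = DQ z x + (2 * t) *s DQ x z + (3 * t ^ 2) *s Q x"
proof -
  have "dder (q i) (z + t *s x) x = dder (q i) z x + 2 * t * dder (q i) x z + 3 * t ^ 2 * ev (q i) x" for i
  proof -
    have "line_poly (q i) z x = [:ev (q i) z, dder (q i) z x, dder (q i) x z, ev (q i) x:]"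
    proof (rule poly_eqI_infinite[OF inf])
      fix s
      show "poly (line_poly (q i) z x) s = poly [:ev (q i) z, dder (q i) z x, dder (q i) x z, ev (q i) x:] s"
        using cubic_on_line[OF inf, of "q i" 1 z s x] hom_q[of i] d_eq_3
        by (simp add: poly_line_poly algebra_simps power2_eq_square power3_eq_cube)
    qed
    then show ?thesis
      unfolding pderiv_line_poly[OF inf, symmetric]
      by (simp add: pderiv_pCons algebra_simps power2_eq_square)
  qed
  then show ?thesis
    by (simp add: vec_eq_iff)
qed

text \<open>Different points of the line have different images, as \<open>p\<close> recovers them;
  hence their image vectors are independent.\<close>

lemma Q_dependent_on_line:
  assumes m: "misses z x" and ab: "(a1, b1) \<noteq> (0, 0)" "(a2, b2) \<noteq> (0, 0)" "a1 * b2 \<noteq> a2 * b1"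
    and dep: "r *s Q (a1 *s z + b1 *s x) + s *s Q (a2 *s z + b2 *s x) = 0"
  shows "r = 0" "s = 0"
proof -
  let ?u = "a1 *s z + b1 *s x" and ?v = "a2 *s z + b2 *s x"
  have Qu: "Q ?u \<noteq> 0" "Q ?v \<noteq> 0"
    using missesD(4)[OF m] ab by auto
  have "r = 0 \<and> s = 0"
  proof (rule ccontr)
    assume "\<not> (r = 0 \<and> s = 0)"
    then have rs: "r \<noteq> 0" "s \<noteq> 0"
      using dep Qu by auto
    have e: "Q ?v $ i = (- r / s) * Q ?u $ i" for i
      using arg_cong[OF dep, of "\<lambda>x. x $ i"] rs by (simp add: field_simps eq_neg_iff_add_eq_0 add.commute)
    have "abs_proj (Q ?u) = abs_proj (Q ?v)"
      by (rule abs_proj_eqI[OF Qu]) (simp only: e mult_ac)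
    then have "abs_proj ?u = abs_proj ?v"
      using Q_injective Qu Q_nonzero_imp by blast
    then obtain c where c: "?v = c *s ?u"
      using abs_proj_eq_iff[of ?u ?v] Qu Q_nonzero_imp by auto
    have "(a2 - c * a1) *s z + (b2 - c * b1) *s x = ?v - c *s ?u"
      by (simp add: vec_eq_iff algebra_simps)
    then have "(a2 - c * a1) *s z + (b2 - c * b1) *s x = 0"
      unfolding c by simp
    from misses_indep2[OF m this] have "a2 = c * a1" "b2 = c * b1"
      by auto
    then show False
      using ab(3) by simp
  qed
  then show "r = 0" "s = 0" by auto
qed

text \<open>A linear functional on binary cubic forms that kills the multiples of a binary quadratic form
  (one always exists by counting) is a combination of two evaluations or of an evaluation and a derivative;
  such a functional cannot kill the coordinates of \<open>Q\<close>, as \<open>Q\<close> is an injective immersion.\<close>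

theorem Q_line_independent:
  assumes m: "misses z x"
    and dep: "f0 *s Q z + f1 *s DQ z x + f2 *s DQ x z + f3 *s Q x = 0"
  shows "f0 = 0 \<and> f1 = 0 \<and> f2 = 0 \<and> f3 = 0"
proof -
  obtain s0 s1 s2 where s: "(s0, s1, s2) \<noteq> (0, 0, 0)" "s0 * f0 + s1 * f1 + s2 * f2 = 0" "s0 * f1 + s1 * f2 + s2 * f3 = 0"
    by (rule ex_orthogonal)
  have Qy: "Q (z + t *s x) = Q z + t *s DQ z x + t ^ 2 *s DQ x z + t ^ 3 *s Q x" for t
    using Q_on_line[of 1 z t x] by simp
  note comps = vec_eq_iff vector_add_component vector_smult_component zero_index
  \<comment> \<open>The \<open>f\<close> form a linear recurrence with characteristic polynomial
    \<open>s0 + s1 t + s2 t ^ 2\<close>. The cases are: both roots finite, one root at infinity, a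
    double root at infinity; the point at infinity is \<open>x\<close>.\<close>
  consider "s2 \<noteq> 0" | "s2 = 0" "s1 \<noteq> 0" | "s2 = 0" "s1 = 0" "s0 \<noteq> 0"
    using s(1) by auto
  then show ?thesis
  proof cases
    case 1
    then obtain t0 where "poly [:s0, s1, s2:] t0 = 0"
      using alg_closed_imp_poly_has_root[of "[:s0, s1, s2:]"] by auto
    then have t0: "s0 + s1 * t0 + s2 * t0 ^ 2 = 0"
      by (simp add: algebra_simps power2_eq_square)
    define t1 where "t1 = - s1 / s2 - t0"
    have s1: "s1 = - s2 * (t0 + t1)"
      using 1 by (simp add: t1_def field_simps)
    have s0: "s0 = s2 * t0 * t1"
    proof -
      have "s0 = - s1 * t0 - s2 * t0 ^ 2"
        using t0 by (simp add: algebra_simps eq_neg_iff_add_eq_0)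
      then show ?thesis
        unfolding s1 by (simp add: algebra_simps power2_eq_square)
    qed
    have "s2 * (f2 - ((t0 + t1) * f1 - t0 * t1 * f0)) = 0" "s2 * (f3 - ((t0 + t1) * f2 - t0 * t1 * f1)) = 0"
      using s(2,3) unfolding s0 s1 by (simp_all add: algebra_simps)
    then have f2: "f2 = (t0 + t1) * f1 - t0 * t1 * f0" and f3: "f3 = (t0 + t1) * f2 - t0 * t1 * f1"
      using 1 by auto
    show ?thesis
    proof (cases "t0 = t1")
      case True
      \<comment> \<open>Double root: the functional is \<open>f0\<close> times evaluation at
        \<open>t0\<close> plus \<open>b\<close> times the derivative there.\<close>
      define b where "b = f1 - f0 * t0"
      have f: "f1 = f0 * t0 + b" "f2 = f0 * t0 ^ 2 + 2 * t0 * b" "f3 = f0 * t0 ^ 3 + 3 * t0 ^ 2 * b"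
        unfolding f3 f2 True[symmetric] b_def by (simp_all add: algebra_simps power2_eq_square power3_eq_cube)
      have "f0 *s Q (z + t0 *s x) + DQ (z + t0 *s x) (b *s x) = 0"
        using dep unfolding dder_vec_linear DQ_on_line Qy f comps
        by (simp add: algebra_simps)
      then obtain c where c: "b *s x = c *s (z + t0 *s x)"
        using DQ_injective[of "z + t0 *s x" f0 "b *s x"] missesD(3)[OF m] Q_nonzero_imp by blast
      have "c *s z + (c * t0 - b) *s x = c *s (z + t0 *s x) - b *s x"
        by (simp add: vec_eq_iff algebra_simps)
      then have "c *s z + (c * t0 - b) *s x = 0"
        unfolding c by simp
      from misses_indep2[OF m this] have "b = 0"
        by simp
      moreover from this have "f0 = 0"
        using \<open>f0 *s Q (z + t0 *s x) + DQ (z + t0 *s x) (b *s x) = 0\<close> missesD(3)[OF m] by (simp add: dder_vec_linear)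
      ultimately show ?thesis
        using f by simp
    next
      case False
      \<comment> \<open>Two roots: \<open>f0\<close> and \<open>f1\<close> determine the weights
        \<open>a\<close>, \<open>b\<close> of the evaluations at \<open>t0\<close> and
        \<open>t1\<close>, and the recurrence gives \<open>f2\<close> and \<open>f3\<close>.\<close>
      define b where "b = (f1 - f0 * t0) / (t1 - t0)"
      define a where "a = f0 - b"
      have "b * (t1 - t0) = f1 - f0 * t0"
        using False by (simp add: b_def)
      then have f: "f0 = a + b" "f1 = a * t0 + b * t1"
        by (simp_all add: a_def algebra_simps)
      have f': "f2 = a * t0 ^ 2 + b * t1 ^ 2" "f3 = a * t0 ^ 3 + b * t1 ^ 3"
        unfolding f3 f2 f by (simp_all add: algebra_simps power2_eq_square power3_eq_cube)
      have "a *s Q (1 *s z + t0 *s x) + b *s Q (1 *s z + t1 *s x) = 0"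
        using dep unfolding f f' vector_smult_lid Qy comps by (simp add: algebra_simps)
      from Q_dependent_on_line[OF m _ _ _ this] False have "a = 0" "b = 0"
        by auto
      then show ?thesis
        using f f' by simp
    qed
  next
    case 2
    define t where "t = - s0 / s1"
    have s0: "s0 = - s1 * t"
      using 2 by (simp add: t_def)
    have "s1 * (f1 - t * f0) = 0" "s1 * (f2 - t * f1) = 0"
      using s(2,3) unfolding s0 2 by (simp_all add: algebra_simps)
    then have f: "f1 = t * f0" "f2 = t * (t * f0)"
      using 2 by auto
    have "f0 *s Q (1 *s z + t *s x) + (f3 - f0 * t ^ 3) *s Q (0 *s z + 1 *s x) = 0"
      using dep unfolding f vector_smult_lid Qy comps by (simp add: algebra_simps power2_eq_square)
    from Q_dependent_on_line[OF m _ _ _ this] have "f0 = 0" "f3 - f0 * t ^ 3 = 0"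
      by auto
    then show ?thesis
      using f by simp
  next
    case 3
    then have f: "f0 = 0" "f1 = 0"
      using s(2,3) by auto
    have D: "f3 *s Q x + DQ x (f2 *s z) = 0"
      using dep f by (simp add: dder_vec_linear add.commute)
    then obtain c where "f2 *s z = c *s x"
      using DQ_injective missesD(2)[OF m] Q_nonzero_imp by metis
    then have "f2 *s z + (- c) *s x = 0"
      by simp
    from misses_indep2[OF m this] have "f2 = 0"
      by simp
    then show ?thesis
      using f D missesD(2)[OF m] by (simp add: dder_vec_linear)
  qed
qed

lemma hyperplane_misses_line:
  assumes m: "misses z x" and h: "h \<noteq> 0"
    "dot h (Q z) = 0" "dot h (DQ z x) = 0" "dot h (DQ x z) = 0" "dot h (Q x) = 0"
  shows False
proof -
  obtain r s t u where "(r, s, t, u) \<noteq> (0, 0, 0, 0)" "r *s Q z + s *s DQ z x + t *s DQ x z + u *s Q x = 0"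
    using vectors_in_hyperplane_dependent[OF h] by blast
  then show False
    using Q_line_independent[OF m] by auto
qed

lemma hyperplane_nonzero_on_line:
  assumes m: "misses z x" and h: "h \<noteq> 0"
  obtains t where "dot h (Q (z + t *s x)) \<noteq> 0"
proof (rule ccontr)
  note obt = that
  assume "\<not> thesis"
  then have 0: "dot h (Q (z + t *s x)) = 0" for t
    using obt by blast
  have "[:dot h (Q z), dot h (DQ z x), dot h (DQ x z), dot h (Q x):] = 0"
  proof (rule poly_eqI_infinite[OF inf])
    fix t
    have "dot h (Q z) + t * dot h (DQ z x) + t ^ 2 * dot h (DQ x z) + t ^ 3 * dot h (Q x) = dot h (Q (z + t *s x))"
      using Q_on_line[of 1 z t x] by (simp add: dot_simps)
    then show "poly [:dot h (Q z), dot h (DQ z x), dot h (DQ x z), dot h (Q x):] t = poly 0 t"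
      unfolding 0 by (simp add: algebra_simps power2_eq_square power3_eq_cube)
  qed
  then show False
    using hyperplane_misses_line[OF m h] by simp
qed

text \<open>The plane spanned by \<open>Q z\<close> and the line contracted to \<open>w\<close>.\<close>

definition join :: "'a ^ 3 \<Rightarrow> 'a ^ 3 \<Rightarrow> 'a ^ 4" where
  "join w z = (SOME h. h \<noteq> 0 \<and>
     (\<forall>k. dot k (Q z) = 0 \<longrightarrow> (\<forall>u. dot k (DQ w u) = 0) \<longrightarrow> (\<exists>c. k = c *s h)))"

text \<open>\<open>Q z\<close> does not lie on the contracted line, because \<open>p\<close> sends
  that line to \<open>w\<close> and \<open>Q z\<close> to \<open>z\<close>. So the two span a plane,
  whose equation is unique up to a factor.\<close>

lemma join:
  assumes w: "w \<noteq> 0" "Q w = 0" and z: "Q z \<noteq> 0"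
  shows "join w z \<noteq> 0" "dot k (Q z) = 0 \<Longrightarrow> (\<And>u. dot k (DQ w u) = 0) \<Longrightarrow> \<exists>c. k = c *s join w z"
proof -
  obtain u v where uv: "det3 w u v \<noteq> 0"
    using det3_complete[OF w(1)] by blast
  let ?h = "cross4 (DQ w u) (DQ w v) (Q z)"
  have h: "?h \<noteq> 0"
  proof
    assume "?h = 0"
    then obtain r s t where rst: "(r, s, t) \<noteq> (0, 0, 0)" "r *s DQ w u + s *s DQ w v + t *s Q z = 0"
      using cross4_eq_0 by blast
    show False
    proof (cases "t = 0")
      case True
      then have "DQ w (r *s u + s *s v) = 0"
        using rst(2) by (simp add: dder_vec_linear)
      then obtain c where "r *s u + s *s v = c *s w"
        using base_DQ_injective[OF w] by blast
      then have "(- c) *s w + (r *s u + s *s v) = 0"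
        by simp
      then have "(- c) *s w + r *s u + s *s v = 0"
        by (simp only: add.assoc)
      from det3_indep[OF uv this] show False
        using rst(1) True by auto
    next
      case False
      let ?y = "(- r / t) *s u + (- s / t) *s v"
      have "t * Q z $ i = - r * DQ w u $ i - s * DQ w v $ i" for i
        using arg_cong[OF rst(2), of "\<lambda>x. x $ i"] by (simp add: algebra_simps eq_neg_iff_add_eq_0)
      then have "Q z $ i = (- r / t) * DQ w u $ i + (- s / t) * DQ w v $ i" for i
        using False by (simp add: field_simps del: dder_vec_nth eval_vec_nth)
      then have Qz: "Q z = DQ w ?y"
        unfolding dder_vec_linear vec_eq_iff by simp
      then have "p (abs_proj (Q z)) = abs_proj w"
        using base_contracted(2)[OF w, of ?y] z by simp
      then have "abs_proj z = abs_proj w"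
        using p_Q[OF Q_nonzero_imp[OF z] z] by simp
      then obtain c where "z = c *s w"
        using abs_proj_eq_iff[OF w(1) Q_nonzero_imp[OF z]] by metis
      then show False
        using z w(2) by (simp add: q_scale)
    qed
  qed
  have "\<exists>h. h \<noteq> 0 \<and> (\<forall>k. dot k (Q z) = 0 \<longrightarrow> (\<forall>u. dot k (DQ w u) = 0) \<longrightarrow> (\<exists>c. k = c *s h))"
  proof (intro exI[of _ ?h] conjI allI impI h)
    fix k assume "dot k (Q z) = 0" "\<forall>u. dot k (DQ w u) = 0"
    then show "\<exists>c. k = c *s ?h"
      using proportional_cases[OF cross4_proportional h] by metis
  qed
  from someI_ex[OF this, folded join_def]
  show "join w z \<noteq> 0" "dot k (Q z) = 0 \<Longrightarrow> (\<And>u. dot k (DQ w u) = 0) \<Longrightarrow> \<exists>c. k = c *s join w z"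
    by blast+
qed

text \<open>Off the base points the fibre of \<open>p\<close> is the single point
  \<open>Q x\<close>. Over a base point both sides hold, since every plane meets the line contracted
  to it.\<close>

lemma section_image:
  assumes x: "x \<noteq> 0"
  shows "dot h (Q x) = 0 \<longleftrightarrow> (\<exists>c. c \<noteq> 0 \<and> ev F c = 0 \<and> dot h c = 0 \<and> p (abs_proj c) = abs_proj x)"
proof
  assume h: "dot h (Q x) = 0"
  show "\<exists>c. c \<noteq> 0 \<and> ev F c = 0 \<and> dot h c = 0 \<and> p (abs_proj c) = abs_proj x"
  proof (cases "Q x = 0")
    case False
    then show ?thesis
      using h F_Q p_Q[OF x] by blast
  next
    case True
    obtain u v where uv: "det3 x u v \<noteq> 0"
      using det3_complete[OF x] by blast
    obtain s t where st: "(s, t) \<noteq> (0, 0)" "s * dot h (DQ x u) + t * dot h (DQ x v) = 0"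
    proof (cases "dot h (DQ x u) = 0")
      case True
      then show thesis
        using that[of 1 0] by simp
    next
      case False
      then show thesis
        using that[of "dot h (DQ x v)" "- dot h (DQ x u)"] by simp
    qed
    let ?c = "DQ x (s *s u + t *s v)"
    have "?c \<noteq> 0"
    proof
      assume "?c = 0"
      then obtain c where "s *s u + t *s v = c *s x"
        using base_DQ_injective[OF x True] by blast
      then have "(- c) *s x + (s *s u + t *s v) = 0"
        by simp
      then have "(- c) *s x + s *s u + t *s v = 0"
        by (simp only: add.assoc)
      from det3_indep[OF uv this] show False
        using st(1) by auto
    qed
    moreover have "dot h ?c = 0"
      using st(2) by (simp add: dder_vec_linear dot_simps)
    ultimately show ?thesis
      using base_contracted[OF x True] by blast
  qed
next
  assume "\<exists>c. c \<noteq> 0 \<and> ev F c = 0 \<and> dot h c = 0 \<and> p (abs_proj c) = abs_proj x"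
  then obtain c where c: "c \<noteq> 0" "ev F c = 0" "dot h c = 0" "p (abs_proj c) = abs_proj x"
    by blast
  obtain k where "Q x = k *s c"
    using proportional_cases[OF Q_p_proportional[OF c(1,2) x c(4)] c(1)] by blast
  then show "dot h (Q x) = 0"
    using c(3) by (simp add: dot_simps)
qed

definition triple_plane :: "'a ^ 3 \<Rightarrow> 'a ^ 3 \<Rightarrow> 'a ^ 3 \<Rightarrow> 'a ^ 4" where
  "triple_plane x y z = cross4 (Q x) (Q y) (Q z)"

text \<open>On the line the plane becomes a binary cubic vanishing at \<open>(1, 0)\<close>,
  \<open>(0, 1)\<close> and \<open>(a, b)\<close>. Its factor is \<open>a * b\<close> times the
  determinant, up to sign, of the four coefficient vectors of \<open>Q\<close> on the line, which
  are independent.\<close>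

lemma triple_plane_on_line:
  assumes m: "misses z y" and ab: "a \<noteq> 0" "b \<noteq> 0"
  obtains k where "k \<noteq> 0"
    "\<And>\<alpha> \<beta>. dot (triple_plane z y (a *s z + b *s y)) (Q (\<alpha> *s z + \<beta> *s y)) = k * (\<alpha> * \<beta> * (\<alpha> * b - \<beta> * a))"
proof -
  let ?q1 = "DQ z y" and ?q2 = "DQ y z"
  let ?h = "triple_plane z y (a *s z + b *s y)"
  let ?k = "dot (cross4 (Q z) (Q y) ?q2) ?q1"
  have "cross4 (Q z) (Q y) ?q2 \<noteq> 0"
  proof
    assume "cross4 (Q z) (Q y) ?q2 = 0"
    then obtain r s t where "(r, s, t) \<noteq> (0, 0, 0)" "r *s Q z + s *s Q y + t *s ?q2 = 0"
      using cross4_eq_0 by blast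
    then show False
      using Q_line_independent[OF m, of r 0 t s] by (simp add: add_ac)
  qed
  then have k: "?k \<noteq> 0"
    using hyperplane_misses_line[OF m, of "cross4 (Q z) (Q y) ?q2"]
    by (auto simp: dot_commute[of "cross4 _ _ _"])
  have h: "?h = (a ^ 2 * b) *s cross4 (Q z) (Q y) ?q1 + (a * b ^ 2) *s cross4 (Q z) (Q y) ?q2"
    unfolding triple_plane_def Q_on_line by (simp add: cross4_linear cross4_same)
  have k': "dot (cross4 (Q z) (Q y) ?q1) ?q2 = - ?k"
    using dot_cross4_swap(3)[of ?q2 "Q z" "Q y" ?q1] by (simp add: dot_commute)
  show thesis
  proof (rule that[of "a * b * ?k"])
    fix \<alpha> \<beta>
    have "dot ?h (Q (\<alpha> *s z + \<beta> *s y)) = (\<alpha> ^ 2 * \<beta>) * dot ?h ?q1 + (\<alpha> * \<beta> ^ 2) * dot ?h ?q2"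
      unfolding Q_on_line h by (simp add: dot_simps dot_commute[of "cross4 _ _ _"])
    also have "dot ?h ?q1 = a * b ^ 2 * ?k"
      unfolding h by (simp add: dot_simps dot_commute[of "cross4 _ _ _"])
    also have "dot ?h ?q2 = - (a ^ 2 * b * ?k)"
      unfolding h dot_simps k' by (simp add: dot_commute[of "cross4 _ _ _"])
    finally show "dot ?h (Q (\<alpha> *s z + \<beta> *s y)) = a * b * ?k * (\<alpha> * \<beta> * (\<alpha> * b - \<beta> * a))"
      by (simp add: algebra_simps power2_eq_square)
  qed (use ab k in simp)
qed

text \<open>A plane through \<open>Q z\<close> containing the line contracted to \<open>w\<close> is
  \<open>join w z\<close> up to a factor, and this plane is assumed to avoid
  \<open>Q y\<close>.\<close>

lemma triple_plane_admissible:
  assumes m: "misses z y" and ab: "a \<noteq> 0" "b \<noteq> 0"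
    and good: "\<And>w. w \<in> base_pts \<Longrightarrow> dot (join w z) (Q y) \<noteq> 0"
    and w: "w \<noteq> 0" "Q w = 0"
  shows "\<exists>u. dot (triple_plane z y (a *s z + b *s y)) (DQ w u) \<noteq> 0"
proof (rule ccontr)
  let ?h = "triple_plane z y (a *s z + b *s y)"
  assume "\<not> (\<exists>u. dot ?h (DQ w u) \<noteq> 0)"
  moreover obtain w' c where w': "w' \<in> base_pts" "c \<noteq> 0" "w = c *s w'"
    using base_pts_cover[OF w] by blast
  ultimately have "c ^ (d - 1) * dot ?h (DQ w' u) = 0" for u
    using DQ_scale[OF w'(2), of w' u] by (metis dot_simps(3))
  then have "dot ?h (DQ w' u) = 0" for u
    using w'(2) by simp
  moreover have h0: "dot ?h (Q z) = 0" "dot ?h (Q y) = 0"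
    by (simp_all add: triple_plane_def dot_commute[of "cross4 _ _ _"])
  ultimately obtain c where c: "?h = c *s join w' z"
    using join(2)[of w' z ?h] base_ptsD[OF w'(1)] missesD(1)[OF m] by blast
  obtain k where k: "k \<noteq> 0"
    "\<And>\<alpha> \<beta>. dot ?h (Q (\<alpha> *s z + \<beta> *s y)) = k * (\<alpha> * \<beta> * (\<alpha> * b - \<beta> * a))"
    using triple_plane_on_line[OF m ab] by blast
  have "?h \<noteq> 0"
  proof
    assume "?h = 0"
    then have 0: "k * (\<alpha> * \<beta> * (\<alpha> * b - \<beta> * a)) = 0" for \<alpha> \<beta>
      using k(2)[of \<alpha> \<beta>] by (simp add: dot_simps)
    obtain s where s: "s \<noteq> 0" "s \<noteq> a / b"
      using ex_new_if_finite[OF inf, of "{0, a / b}"] by auto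
    then have "s * b - a \<noteq> 0"
      using ab by (auto simp: field_simps)
    then show False
      using 0[of s 1] k(1) \<open>s \<noteq> 0\<close> by simp
  qed
  then have "c \<noteq> 0"
    using c by auto
  then show False
    using h0(2) good[OF w'(1)] unfolding c by (simp add: dot_simps)
qed

end


section \<open>Descent to the base field\<close>

abbreviation up :: "('k::field, 'n) mpoly \<Rightarrow> ('k alg_closure, 'n) mpoly" where
  "up \<equiv> Poly_Mapping.map to_ac"

definition vup :: "'k::field ^ 'n \<Rightarrow> 'k alg_closure ^ 'n" where
  "vup v = (\<chi> i. to_ac (v $ i))"

lemma vup_nth [simp]: "vup v $ i = to_ac (v $ i)"
  by (simp add: vup_def)

lemma vup_eq_0_iff [simp]: "vup v = 0 \<longleftrightarrow> v = 0"
  by (simp add: vec_eq_iff)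

lemma vup_linear: "vup (u + v) = vup u + vup v" "vup (c *s v) = to_ac c *s vup v"
  by (simp_all add: vec_eq_iff)

lemma lookup_map_0: "f 0 = 0 \<Longrightarrow> Poly_Mapping.lookup (Poly_Mapping.map f F) m = f (Poly_Mapping.lookup F m)"
  by (simp add: Poly_Mapping.map.rep_eq when_def)

lemma keys_map_subset: "f 0 = 0 \<Longrightarrow> Poly_Mapping.keys (Poly_Mapping.map f F) \<subseteq> Poly_Mapping.keys F"
  by (auto simp: in_keys_iff lookup_map_0)

lemma keys_up: "Poly_Mapping.keys (up F) = Poly_Mapping.keys F"
  by (auto simp: in_keys_iff lookup_map_0)

lemma homogeneous_map: "f 0 = 0 \<Longrightarrow> homogeneous d F \<Longrightarrow> homogeneous d (Poly_Mapping.map f F)"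
  using keys_map_subset[of f F] by (auto simp: homogeneous_def)

lemma homogeneous_up: "homogeneous d F \<Longrightarrow> homogeneous d (up F)"
  by (rule homogeneous_map) simp_all

lemma up_eq_0_iff [simp]: "up F = 0 \<longleftrightarrow> F = 0"
  by (simp add: poly_mapping_eq_iff fun_eq_iff lookup_map_0)

lemma mp_eval_up: "mp_eval \<phi> (up F) v = mp_eval (\<lambda>c. \<phi> (to_ac c)) F v"
  by (simp add: mp_eval_def keys_up lookup_map_0)

lemma ev_up: "ev (up F) v = mp_eval to_ac F v"
  by (simp add: mp_eval_up)

lemma ev_up_vup: "ev (up F) (vup v) = to_ac (ev F v)"
  by (simp add: ev_up mp_eval_hom[OF ring_hom_on_to_ac] vup_def)

lemma map_add: "f 0 = 0 \<Longrightarrow> (\<And>x y. f (x + y) = f x + f y) \<Longrightarrow>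
    Poly_Mapping.map f (F + G) = Poly_Mapping.map f F + Poly_Mapping.map f G"
  by (rule poly_mapping_eqI) (simp add: lookup_map_0 lookup_add)

lemma map_sum: "f 0 = 0 \<Longrightarrow> (\<And>x y. f (x + y) = f x + f y) \<Longrightarrow>
    Poly_Mapping.map f (sum F A) = (\<Sum>x\<in>A. Poly_Mapping.map f (F x))"
  by (induction A rule: infinite_finite_induct)
     (auto simp: map_add intro: poly_mapping_eqI simp: lookup_map_0)

lemma map_single_0: "f 0 = 0 \<Longrightarrow> Poly_Mapping.map f (Poly_Mapping.single m c) = Poly_Mapping.single m (f c)"
  by (rule poly_mapping_eqI) (simp add: lookup_map_0 lookup_single when_def)

lemma up_pderiv: "up (mp_pderiv i F) = mp_pderiv i (up F)"
  unfolding mp_pderiv_def keys_up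
  by (subst map_sum) (simp_all add: map_single_0 lookup_map_0)

lemma rep_proj_props: "rep_proj P \<noteq> 0" "abs_proj (rep_proj P) = P"
proof -
  have "proj_rel (rep_proj P) (rep_proj P)"
    by (rule Quotient3_rep_reflp[OF Quotient3_proj])
  then show "rep_proj P \<noteq> 0"
    by (simp add: proj_rel_def)
  show "abs_proj (rep_proj P) = P"
    by (rule Quotient3_abs_rep[OF Quotient3_proj])
qed

lemma rep_abs_proj:
  assumes "v \<noteq> 0"
  obtains c where "c \<noteq> 0" "rep_proj (abs_proj v) = c *s v"
  using abs_proj_eq_iff[OF assms rep_proj_props(1), of "abs_proj v"] rep_proj_props(2)[of "abs_proj v"] by auto

lemma proj_cases:
  obtains v where "v \<noteq> 0" "P = abs_proj v"
  using rep_proj_props[of P] by metis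

lemma value_at_abs:
  assumes "homogeneous d F" "v \<noteq> 0"
  shows "value_at F (abs_proj v) = 0 \<longleftrightarrow> ev (up F) v = 0"
proof -
  obtain c where "c \<noteq> 0" "rep_proj (abs_proj v) = c *s v"
    using rep_abs_proj[OF assms(2)] by blast
  then show ?thesis
    by (simp add: value_at_def mp_eval_scale[OF assms(1)] ev_up)
qed

lemma zeros_abs:
  assumes "homogeneous d F" "v \<noteq> 0"
  shows "abs_proj v \<in> zeros F \<longleftrightarrow> ev (up F) v = 0"
  using value_at_abs[OF assms] by (simp add: zeros_def)

lemma abs_proj_value_at:
  fixes g :: "'m::finite \<Rightarrow> ('k::field, 'n::finite) mpoly"
  assumes "\<And>i. homogeneous d (g i)" "v \<noteq> 0" "\<exists>i. value_at (g i) (abs_proj v) \<noteq> 0"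
  shows "eval_vec (\<lambda>i. up (g i)) v \<noteq> 0"
    "abs_proj (\<chi> i. value_at (g i) (abs_proj v)) = abs_proj (eval_vec (\<lambda>i. up (g i)) v)"
proof -
  obtain c where c: "c \<noteq> 0" "rep_proj (abs_proj v) = c *s v"
    using rep_abs_proj[OF assms(2)] by blast
  have e: "(\<chi> i. value_at (g i) (abs_proj v)) = c ^ d *s eval_vec (\<lambda>i. up (g i)) v"
    by (simp add: vec_eq_iff value_at_def c mp_eval_scale[OF assms(1)] ev_up)
  have nz: "(\<chi> i. value_at (g i) (abs_proj v)) \<noteq> 0"
    using assms(3) by (auto simp: vec_eq_iff)
  then show g: "eval_vec (\<lambda>i. up (g i)) v \<noteq> 0"
    unfolding e by auto
  show "abs_proj (\<chi> i. value_at (g i) (abs_proj v)) = abs_proj (eval_vec (\<lambda>i. up (g i)) v)"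
    by (rule abs_proj_eqI[OF nz g]) (simp add: e)
qed

lemma smooth_cubic_surfaceD:
  assumes "smooth_cubic_surface F"
  shows "homogeneous 3 F" "smooth_form (up F)"
proof -
  show h: "homogeneous 3 F"
    using assms by (simp add: smooth_cubic_surface_def)
  show "smooth_form (up F)"
    unfolding smooth_form_def
  proof (intro allI impI)
    fix v assume v: "v \<noteq> 0" "ev (up F) v = 0"
    obtain c where c: "c \<noteq> 0" "rep_proj (abs_proj v) = c *s v"
      using rep_abs_proj[OF v(1)] by blast
    have "value_at F (abs_proj v) = 0"
      using value_at_abs[OF h v(1)] v(2) by simp
    then obtain i where "value_at (mp_pderiv i F) (abs_proj v) \<noteq> 0"
      using assms unfolding smooth_cubic_surface_def by blast
    then have "ev (mp_pderiv i (up F)) (c *s v) \<noteq> 0"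
      by (simp add: value_at_def c flip: ev_up up_pderiv)
    then have "dder (up F) (c *s v) (axis i 1) \<noteq> 0"
      by (simp add: dder_eq_sum axis_def if_distrib[of "\<lambda>x. x * _"] cong: if_cong)
    moreover have "dder (up F) (c *s v) (axis i 1) = c ^ 2 * dder (up F) v (axis i 1)"
      using dder_scale_arg[of 2 "up F" c v] homogeneous_up[OF h] c(1) by simp
    ultimately show "\<exists>u. dder (up F) v u \<noteq> 0"
      by auto
  qed
qed

section \<open>Local forms of \<open>p\<close> and of its inverse\<close>

lemma regular_map_local_rep:
  assumes F: "homogeneous 3 F" and p: "regular_map (zeros F) p" and v: "v \<noteq> 0" "ev (up F) v = 0"
  obtains g h where "local_rep (up F) p (\<lambda>i. up (g i)) (up h)" "ev (up h) v \<noteq> 0"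
proof -
  have "abs_proj v \<in> zeros F"
    using zeros_abs[OF F v(1)] v(2) by simp
  from p[unfolded regular_map_def, rule_format, OF this]
  obtain h e g d where "homogeneous e h \<and> value_at h (abs_proj v) \<noteq> 0 \<and> (\<forall>i. homogeneous d (g i)) \<and>
    (\<forall>P\<in>zeros F. value_at h P \<noteq> 0 \<longrightarrow> (\<exists>i. value_at (g i) P \<noteq> 0) \<and> p P = abs_proj (\<chi> i. value_at (g i) P))"
    by blast
  then have hg: "homogeneous e h" "value_at h (abs_proj v) \<noteq> 0" "\<And>i. homogeneous d (g i)"
    "\<And>P. P \<in> zeros F \<Longrightarrow> value_at h P \<noteq> 0 \<Longrightarrow> (\<exists>i. value_at (g i) P \<noteq> 0) \<and> p P = abs_proj (\<chi> i. value_at (g i) P)"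
    by blast+
  have "local_rep (up F) p (\<lambda>i. up (g i)) (up h)"
    unfolding local_rep_def
  proof (intro conjI allI impI)
    show "\<exists>d. \<forall>i. homogeneous d (up (g i))" "\<exists>e. homogeneous e (up h)"
      using hg(1,3) homogeneous_up by blast+
    fix w assume w: "w \<noteq> 0" "ev (up F) w = 0" "ev (up h) w \<noteq> 0"
    then have "abs_proj w \<in> zeros F" "value_at h (abs_proj w) \<noteq> 0"
      using zeros_abs[OF F w(1)] value_at_abs[OF hg(1) w(1)] by auto
    from hg(4)[OF this] have pw: "\<exists>i. value_at (g i) (abs_proj w) \<noteq> 0"
      "p (abs_proj w) = abs_proj (\<chi> i. value_at (g i) (abs_proj w))"
      by auto
    show "eval_vec (\<lambda>i. up (g i)) w \<noteq> 0" "p (abs_proj w) = abs_proj (eval_vec (\<lambda>i. up (g i)) w)"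
      using abs_proj_value_at[OF hg(3) w(1) pw(1)] pw(2) by simp_all
  qed
  moreover have "ev (up h) v \<noteq> 0"
    using hg(2) value_at_abs[OF hg(1) v(1)] by simp
  ultimately show thesis
    by (rule that)
qed

text \<open>One form from each description suffices: \<open>chi\<close> cuts out an open part of
  \<open>W\<close> on which a single family \<open>g0\<close> gives the inverse, and
  \<open>tau\<close> an open part of \<open>U\<close>. Smaller open sets are enough because plane
  and surface are irreducible.\<close>

lemma birational_inverse:
  assumes F: "homogeneous 3 F" and p: "birational_morphism (zeros F) UNIV p"
  obtains g0 :: "4 \<Rightarrow> ('k::field, 3) mpoly" and D chi tau where
    "\<And>i. homogeneous D (g0 i)" "\<exists>n. homogeneous n chi" "\<exists>x. ev chi x \<noteq> 0" "\<exists>x. x \<noteq> 0 \<and> ev chi x \<noteq> 0"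
    "\<And>x. x \<noteq> 0 \<Longrightarrow> ev chi x \<noteq> 0 \<Longrightarrow> eval_vec (\<lambda>i. up (g0 i)) x \<noteq> 0 \<and>
      ev (up F) (eval_vec (\<lambda>i. up (g0 i)) x) = 0 \<and> p (abs_proj (eval_vec (\<lambda>i. up (g0 i)) x)) = abs_proj x"
    "\<exists>v. ev (up F) v = 0 \<and> ev tau v \<noteq> 0"
    "\<And>v x. v \<noteq> 0 \<Longrightarrow> ev (up F) v = 0 \<Longrightarrow> ev tau v \<noteq> 0 \<Longrightarrow> x \<noteq> 0 \<Longrightarrow> p (abs_proj v) = abs_proj x \<Longrightarrow>
      ev chi x \<noteq> 0 \<Longrightarrow> abs_proj v = abs_proj (eval_vec (\<lambda>i. up (g0 i)) x)"
proof -
  obtain U W where UW: "zariski_open_in (zeros F) U" "U \<noteq> {}" "zariski_open_in UNIV W" "W \<noteq> {}"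
    "bij_betw p U W" "regular_map W (the_inv_into U p)"
    using p unfolding birational_morphism_def by blast
  obtain S where S: "\<And>g. g \<in> S \<Longrightarrow> \<exists>d. homogeneous d g" "U = {P \<in> zeros F. \<exists>g\<in>S. value_at g P \<noteq> 0}"
    using UW(1) unfolding zariski_open_in_def by blast
  obtain T where T: "\<And>g. g \<in> T \<Longrightarrow> \<exists>d. homogeneous d g" "W = {P. \<exists>g\<in>T. value_at g P \<noteq> 0}"
    using UW(3) unfolding zariski_open_in_def by auto
  obtain P0 where "P0 \<in> U"
    using UW(2) by blast
  then obtain v0 where v0: "v0 \<noteq> 0" "abs_proj v0 \<in> U"
    using proj_cases[of P0] by metis
  then obtain s where s: "s \<in> S" "value_at s (abs_proj v0) \<noteq> 0" "abs_proj v0 \<in> zeros F"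
    using S(2) by blast
  obtain ds where ds: "homogeneous ds s"
    using S(1) s(1) by blast
  obtain P1 where "P1 \<in> W"
    using UW(4) by blast
  then obtain x0 where x0: "x0 \<noteq> 0" "abs_proj x0 \<in> W"
    using proj_cases[of P1] by metis
  then obtain t where t: "t \<in> T" "value_at t (abs_proj x0) \<noteq> 0"
    using T(2) by blast
  obtain dt where dt: "homogeneous dt t"
    using T(1) t(1) by blast
  from UW(6)[unfolded regular_map_def, rule_format, OF x0(2)]
  obtain h e g0 D where "homogeneous e h \<and> value_at h (abs_proj x0) \<noteq> 0 \<and> (\<forall>i. homogeneous D (g0 i)) \<and>
    (\<forall>P\<in>W. value_at h P \<noteq> 0 \<longrightarrow> (\<exists>i. value_at (g0 i) P \<noteq> 0) \<and>
      the_inv_into U p P = abs_proj (\<chi> i. value_at (g0 i) P))"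
    by blast
  then have h: "homogeneous e h" "value_at h (abs_proj x0) \<noteq> 0" "\<And>i. homogeneous D (g0 i)"
    "\<And>P. P \<in> W \<Longrightarrow> value_at h P \<noteq> 0 \<Longrightarrow> (\<exists>i. value_at (g0 i) P \<noteq> 0) \<and>
      the_inv_into U p P = abs_proj (\<chi> i. value_at (g0 i) P)"
    by blast+
  define chi where "chi = up t * up h"
  define tau where "tau = up s"
  have chi: "ev chi x = ev (up t) x * ev (up h) x" for x
    by (simp add: chi_def ev_simps)
  have inj: "inj_on p U"
    using UW(5) by (simp add: bij_betw_def)
  have inv: "eval_vec (\<lambda>i. up (g0 i)) x \<noteq> 0" "the_inv_into U p (abs_proj x) = abs_proj (eval_vec (\<lambda>i. up (g0 i)) x)"
    "abs_proj x \<in> W" if x: "x \<noteq> 0" "ev chi x \<noteq> 0" for x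
  proof -
    have "value_at t (abs_proj x) \<noteq> 0" "value_at h (abs_proj x) \<noteq> 0"
      using x(2) value_at_abs[OF dt x(1)] value_at_abs[OF h(1) x(1)] by (auto simp: chi)
    then have W: "abs_proj x \<in> W" and "\<exists>i. value_at (g0 i) (abs_proj x) \<noteq> 0"
      "the_inv_into U p (abs_proj x) = abs_proj (\<chi> i. value_at (g0 i) (abs_proj x))"
      using t(1) T(2) h(4) by blast+
    then show "eval_vec (\<lambda>i. up (g0 i)) x \<noteq> 0"
      "the_inv_into U p (abs_proj x) = abs_proj (eval_vec (\<lambda>i. up (g0 i)) x)" "abs_proj x \<in> W"
      using abs_proj_value_at[OF h(3) x(1)] by simp_all
  qed
  have ex: "x0 \<noteq> 0 \<and> ev chi x0 \<noteq> 0"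
    using t(2) h(2) x0(1) value_at_abs[OF dt x0(1)] value_at_abs[OF h(1) x0(1)] by (simp add: chi)
  show thesis
  proof (rule that[of D g0 chi tau])
    show "\<exists>n. homogeneous n chi"
      unfolding chi_def using homogeneous_mult[OF homogeneous_up[OF dt] homogeneous_up[OF h(1)]] by blast
    show "\<exists>x. x \<noteq> 0 \<and> ev chi x \<noteq> 0" "\<exists>x. ev chi x \<noteq> 0"
      using ex by blast+
    show "\<exists>v. ev (up F) v = 0 \<and> ev tau v \<noteq> 0"
      using s zeros_abs[OF F v0(1)] value_at_abs[OF ds v0(1)] unfolding tau_def by blast
  next
    fix x assume x: "x \<noteq> 0" "ev chi x \<noteq> 0"
    let ?g = "eval_vec (\<lambda>i. up (g0 i)) x"
    have "abs_proj ?g \<in> U" "p (abs_proj ?g) = abs_proj x"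
      using inv[OF x] UW(5) the_inv_into_into[OF inj _ order_refl, of "abs_proj x"] f_the_inv_into_f[OF inj, of "abs_proj x"]
      by (simp_all add: bij_betw_def)
    moreover from this have "abs_proj ?g \<in> zeros F"
      using S(2) by blast
    ultimately show "?g \<noteq> 0 \<and> ev (up F) ?g = 0 \<and> p (abs_proj ?g) = abs_proj x"
      using inv(1)[OF x] zeros_abs[OF F] by simp
  next
    fix v x assume v: "v \<noteq> 0" "ev (up F) v = 0" "ev tau v \<noteq> 0" and x: "x \<noteq> 0" "p (abs_proj v) = abs_proj x" "ev chi x \<noteq> 0"
    have "abs_proj v \<in> U"
      using v s(1) zeros_abs[OF F v(1)] value_at_abs[OF ds v(1)] unfolding S(2) tau_def by blast
    then have "the_inv_into U p (p (abs_proj v)) = abs_proj v"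
      by (rule the_inv_into_f_f[OF inj])
    then show "abs_proj v = abs_proj (eval_vec (\<lambda>i. up (g0 i)) x)"
      using inv(2)[OF x(1,3)] x(2) by simp
  qed (rule h(3))
qed

text \<open>A functional linear over the base field, applied to coefficients, turns a solution of a linear system
  over the algebraic closure into one over the base field.\<close>

lemma ex_base_field_functional:
  fixes x0 :: "'k::field alg_closure"
  assumes "x0 \<noteq> 0"
  obtains \<theta> :: "'k alg_closure \<Rightarrow> 'k" where "\<And>x y. \<theta> (x + y) = \<theta> x + \<theta> y"
    "\<And>c x. \<theta> (to_ac c * x) = c * \<theta> x" "\<theta> x0 \<noteq> 0"
proof -
  interpret vector_space_pair "\<lambda>(c :: 'k) (x :: 'k alg_closure). to_ac c * x" "(*) :: 'k \<Rightarrow> 'k \<Rightarrow> 'k"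
    by unfold_locales (simp_all add: algebra_simps)
  have "vs1.independent {x0}"
    using assms by (simp add: vs1.dependent_single)
  then obtain \<theta> where t: "Vector_Spaces.linear (\<lambda>(c :: 'k) (x :: 'k alg_closure). to_ac c * x) (*) \<theta>" "\<theta> x0 = 1"
    using linear_independent_extend[of "{x0}" "\<lambda>_. 1"] by auto
  interpret Vector_Spaces.linear "\<lambda>(c :: 'k) (x :: 'k alg_closure). to_ac c * x" "(*)" \<theta>
    by (rule t(1))
  show thesis
    using that[of \<theta>] add scale t(2) by simp
qed

lemma map_functional_mult:
  fixes \<theta> :: "'k::field alg_closure \<Rightarrow> 'k"
  assumes add: "\<And>x y. \<theta> (x + y) = \<theta> x + \<theta> y" and scale: "\<And>c x. \<theta> (to_ac c * x) = c * \<theta> x"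
  shows "Poly_Mapping.map \<theta> (up A * B) = A * Poly_Mapping.map \<theta> (B :: ('k alg_closure, 'n) mpoly)"
proof -
  have t0: "\<theta> 0 = 0"
    using scale[of 0 0] by simp
  have "Poly_Mapping.map \<theta> (up A * B)
    = (\<Sum>m\<in>Poly_Mapping.keys A. \<Sum>n\<in>Poly_Mapping.keys B.
        Poly_Mapping.single (m + n) (Poly_Mapping.lookup A m * \<theta> (Poly_Mapping.lookup B n)))"
    by (subst mpoly_eq_sum_single[of "up A"], subst mpoly_eq_sum_single[of B])
       (simp add: sum_product mult_single keys_up lookup_map_0 map_sum[of \<theta>, OF t0 add] map_single_0[of \<theta>, OF t0] scale)
  also have "\<dots> = A * (\<Sum>n\<in>Poly_Mapping.keys B. Poly_Mapping.single n (\<theta> (Poly_Mapping.lookup B n)))"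
    by (subst (3) mpoly_eq_sum_single[of A]) (simp add: sum_product mult_single)
  also have "(\<Sum>n\<in>Poly_Mapping.keys B. Poly_Mapping.single n (\<theta> (Poly_Mapping.lookup B n))) = Poly_Mapping.map \<theta> B"
    by (subst (3) mpoly_eq_sum_single[of B]) (simp add: map_sum[of \<theta>, OF t0 add] map_single_0[of \<theta>, OF t0])
  finally show ?thesis .
qed

text \<open>The minor equations are linear in \<open>r\<close> with coefficients in the base field,
  so a functional applied to the coefficients of \<open>r\<close> yields a solution of the same
  degree; it is chosen not to kill a given nonzero coefficient.\<close>

lemma prop_forms_descent:
  fixes g0 :: "4 \<Rightarrow> ('k::field, 3) mpoly"
  assumes "prop_forms (\<lambda>i. up (g0 i)) d r"
  obtains q where "prop_forms (\<lambda>i. up (g0 i)) d (\<lambda>i. up (q i))"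
proof -
  note inf = infinite_UNIV_alg_closed[where 'a = "'k alg_closure"]
  have r: "\<And>i. homogeneous d (r i)" "\<And>i j x. ev (up (g0 i)) x * ev (r j) x = ev (up (g0 j)) x * ev (r i) x"
    using assms by (auto simp: prop_forms_def)
  obtain i0 where "r i0 \<noteq> 0"
    using assms by (auto simp: prop_forms_def)
  then obtain m where "Poly_Mapping.lookup (r i0) m \<noteq> 0"
    by (auto simp: poly_mapping_eq_iff fun_eq_iff)
  then obtain \<theta> :: "'k alg_closure \<Rightarrow> 'k" where t: "\<And>x y. \<theta> (x + y) = \<theta> x + \<theta> y"
    "\<And>c x. \<theta> (to_ac c * x) = c * \<theta> x" "\<theta> (Poly_Mapping.lookup (r i0) m) \<noteq> 0"
    using ex_base_field_functional by metis
  have t0: "\<theta> 0 = 0"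
    using t(2)[of 0 0] by simp
  define q where "q i = Poly_Mapping.map \<theta> (r i)" for i
  have eq: "g0 i * q j = g0 j * q i" for i j
  proof -
    have "up (g0 i) * r j = up (g0 j) * r i"
      by (rule ev_eq_imp[OF inf]) (simp add: ev_simps r(2))
    then show ?thesis
      unfolding q_def by (metis map_functional_mult[OF t(1,2)])
  qed
  have "prop_forms (\<lambda>i. up (g0 i)) d (\<lambda>i. up (q i))"
    unfolding prop_forms_def
  proof (intro conjI allI)
    show "homogeneous d (up (q i))" for i
      unfolding q_def by (intro homogeneous_up homogeneous_map t0 r(1))
    have "Poly_Mapping.lookup (q i0) m \<noteq> 0"
      using t(3) by (simp add: q_def lookup_map_0[of \<theta>] t0)
    then show "\<exists>i. up (q i) \<noteq> 0"
      by (intro exI[of _ i0]) auto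
    show "ev (up (g0 i)) x * ev (up (q j)) x = ev (up (g0 j)) x * ev (up (q i)) x" for i j x
      using arg_cong[OF eq[of i j], of "\<lambda>F. mp_eval to_ac F x"]
      by (simp add: ev_up mp_eval_mult[OF ring_hom_on_to_ac])
  qed
  then show thesis
    by (rule that)
qed

text \<open>The least degree is taken among forms over the algebraic closure, as cancelling common
  factors there requires. Descent preserves the degree, so forms over the base field attain
  it.\<close>

theorem ex_cubic_parametrization:
  fixes F :: "('k::field, 4) mpoly" and p :: "('k, 4) gpt \<Rightarrow> ('k, 3) gpt"
  assumes "smooth_cubic_surface F" "birational_morphism (zeros F) UNIV p"
  obtains g0 chi tau d and q :: "4 \<Rightarrow> ('k, 3) mpoly"
  where "cubic_parametrization (up F) p g0 chi tau (\<lambda>i. up (q i)) d"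
proof -
  note F = smooth_cubic_surfaceD[OF assms(1)]
  show thesis
  proof (rule birational_inverse[OF F(1) assms(2)])
  fix g0 :: "4 \<Rightarrow> ('k, 3) mpoly" and D chi tau
  assume B:
    "\<And>i. homogeneous D (g0 i)" "\<exists>n. homogeneous n chi" "\<exists>x. ev chi x \<noteq> 0" "\<exists>x. x \<noteq> 0 \<and> ev chi x \<noteq> 0"
    "\<And>x. x \<noteq> 0 \<Longrightarrow> ev chi x \<noteq> 0 \<Longrightarrow> eval_vec (\<lambda>i. up (g0 i)) x \<noteq> 0 \<and>
      ev (up F) (eval_vec (\<lambda>i. up (g0 i)) x) = 0 \<and> p (abs_proj (eval_vec (\<lambda>i. up (g0 i)) x)) = abs_proj x"
    "\<exists>v. ev (up F) v = 0 \<and> ev tau v \<noteq> 0"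
    "\<And>v x. v \<noteq> 0 \<Longrightarrow> ev (up F) v = 0 \<Longrightarrow> ev tau v \<noteq> 0 \<Longrightarrow> x \<noteq> 0 \<Longrightarrow> p (abs_proj v) = abs_proj x \<Longrightarrow>
      ev chi x \<noteq> 0 \<Longrightarrow> abs_proj v = abs_proj (eval_vec (\<lambda>i. up (g0 i)) x)"
  obtain x where "eval_vec (\<lambda>i. up (g0 i)) x \<noteq> 0"
    using B(4,5) by blast
  then obtain i where "ev (up (g0 i)) x \<noteq> 0"
    by (auto simp: vec_eq_iff)
  then have "up (g0 i) \<noteq> 0"
    by (metis mp_eval_0)
  then have "prop_forms (\<lambda>i. up (g0 i)) D (\<lambda>i. up (g0 i))"
    using homogeneous_up[OF B(1)] by (auto simp: prop_forms_def)
  then have ex: "\<exists>d r. prop_forms (\<lambda>i. up (g0 i)) d r"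
    by blast
  define d where "d = (LEAST d. \<exists>r. prop_forms (\<lambda>i. up (g0 i)) d r)"
  have "\<exists>r. prop_forms (\<lambda>i. up (g0 i)) d r"
    unfolding d_def by (rule LeastI_ex[OF ex])
  then obtain q where q: "prop_forms (\<lambda>i. up (g0 i)) d (\<lambda>i. up (q i))"
    using prop_forms_descent by metis
  have min: "d \<le> e" if "prop_forms (\<lambda>i. up (g0 i)) e r" for e r
    unfolding d_def using that by (intro Least_le) blast
  have "regular_map (zeros F) p"
    using assms(2) by (simp add: birational_morphism_def)
  then have rep: "\<exists>g h. local_rep (up F) p g h \<and> ev h v \<noteq> 0" if "v \<noteq> 0" "ev (up F) v = 0" for v
    using regular_map_local_rep[OF F(1) _ that] by metis
  have "cubic_parametrization (up F) p (\<lambda>i. up (g0 i)) chi tau (\<lambda>i. up (q i)) d"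
    by unfold_locales (use F homogeneous_up B q min rep in blast)+
  then show thesis
    by (rule that)
  qed
qed


section \<open>Generation\<close>

lemma dvd_square_simple_roots:
  fixes f l m :: "'a::alg_closed_field poly"
  assumes f: "f = l ^ 2 * m" and roots: "\<And>t. poly f t = 0 \<Longrightarrow> poly (pderiv f) t \<noteq> 0"
  obtains c where "l = [:c:]"
proof -
  have "degree l = 0"
  proof (rule ccontr)
    assume "degree l \<noteq> 0"
    then obtain t where t: "poly l t = 0"
      using alg_closed_imp_poly_has_root[of l] by auto
    have "poly f t = 0" "poly (pderiv f) t = 0"
      using t by (simp_all add: f pderiv_mult power2_eq_square)
    then show False
      using roots by blast
  qed
  then show thesis
    using that by (metis degree_eq_zeroE)
qed

text \<open>Restricted to either affine chart of the line, the square of a factor divides a polynomial with simple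
  roots, so the factor is constant there, and a form constant in both charts has degree \<open>0\<close>.\<close>

lemma squarefree_if_simple_on_line:
  fixes G :: "('a::{alg_closed_field,field_gcd}, 'n::finite) mpoly"
  assumes G: "homogeneous e G" and k: "k \<noteq> 0" and ab: "a \<noteq> 0" "b \<noteq> 0"
    and line: "\<And>\<alpha> \<beta>. ev G (\<alpha> *s z + \<beta> *s y) = k * (\<alpha> * \<beta> * (\<alpha> * b - \<beta> * a))"
  shows "squarefree G"
  unfolding squarefree_def
proof (intro allI impI)
  note inf = infinite_UNIV_alg_closed[where 'a = 'a]
  fix H assume "H ^ 2 dvd G"
  then obtain A where A: "G = H ^ 2 * A" ..
  then have A': "G = H * (H * A)"
    by (simp add: power2_eq_square mult.assoc)
  have "line_poly G z y = smult k ([:0, 1:] * [:b, - a:])"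
    by (rule poly_eqI_infinite[OF inf])
       (use line[of 1] in \<open>simp add: poly_line_poly algebra_simps\<close>)
  then have d1: "poly (pderiv (line_poly G z y)) t = k * (b - 2 * a * t)" "poly (line_poly G z y) t = k * (t * (b - a * t))" for t
    by (simp_all add: pderiv_smult pderiv_pCons algebra_simps)
  have "line_poly G y z = smult k ([:0, 1:] * [:- a, b:])"
    by (rule poly_eqI_infinite[OF inf])
       (use line[of _ 1] in \<open>simp add: poly_line_poly algebra_simps\<close>)
  then have d2: "poly (pderiv (line_poly G y z)) t = k * (2 * b * t - a)" "poly (line_poly G y z) t = k * (t * (b * t - a))" for t
    by (simp_all add: pderiv_smult pderiv_pCons algebra_simps)
  have sq: "line_poly G u v = line_poly H u v ^ 2 * line_poly A u v" for u v
    unfolding A' line_poly_def mp_eval_mult[OF ring_hom_on_const_poly] by (simp add: power2_eq_square)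
  obtain c1 where c1: "line_poly H z y = [:c1:]"
  proof (rule dvd_square_simple_roots[OF sq])
    fix t assume "poly (line_poly G z y) t = 0"
    \<comment> \<open>At the roots \<open>t = 0\<close> and \<open>t = b / a\<close> the derivative
      is \<open>k * b\<close> and \<open>- (k * b)\<close>, nonzero in every characteristic.\<close>
    then have "t = 0 \<or> b = a * t"
      using k by (simp add: d1)
    moreover have "b - 2 * a * t = - b" if "b = a * t"
      by (simp only: mult.assoc that[symmetric]) simp
    ultimately have "b - 2 * a * t = b \<or> b - 2 * a * t = - b"
      by auto
    then show "poly (pderiv (line_poly G z y)) t \<noteq> 0"
    proof (elim disjE)
      assume e: "b - 2 * a * t = b"
      show ?thesis unfolding d1 e using k ab by simp
    next
      assume e: "b - 2 * a * t = - b"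
      show ?thesis unfolding d1 e using k ab by simp
    qed
  qed
  obtain c2 where c2: "line_poly H y z = [:c2:]"
  proof (rule dvd_square_simple_roots[OF sq])
    fix t assume "poly (line_poly G y z) t = 0"
    then have "t = 0 \<or> a = b * t"
      using k by (auto simp: d2)
    moreover have "2 * b * t - a = a" if "a = b * t"
      by (simp only: mult.assoc that[symmetric]) simp
    ultimately have "2 * b * t - a = - a \<or> 2 * b * t - a = a"
      by auto
    then show "poly (pderiv (line_poly G y z)) t \<noteq> 0"
    proof (elim disjE)
      assume e: "2 * b * t - a = - a"
      show ?thesis unfolding d2 e using k ab by simp
    next
      assume e: "2 * b * t - a = a"
      show ?thesis unfolding d2 e using k ab by simp
    qed
  qed
  obtain t where t: "t \<noteq> 0" "b - a * t \<noteq> 0"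
    using ex_new_if_finite[OF inf, of "{0, b / a}"] ab by (auto simp: field_simps)
  then have Gnz: "ev G (z + t *s y) \<noteq> 0"
    using d1(2)[of t] k by (simp add: poly_line_poly)
  have "ev H v * ev (H * A) v = ev G v" for v
    unfolding A' by (simp add: ev_simps)
  then obtain n m where n: "\<And>t v. ev H (t *s v) = t ^ n * ev H v"
    using homogeneous_factor[OF inf polyfun_ev polyfun_ev _ mp_eval_scale[OF G] Gnz, of H "H * A"] by blast
  have "c1 \<noteq> 0"
    using Gnz sq[of z y] c1 by (auto simp flip: poly_line_poly)
  \<comment> \<open>Both charts being constant, the change of chart leaves
    \<open>t ^ n * c2 = c1\<close> for all nonzero \<open>t\<close>, which forces
    \<open>n = 0\<close>.\<close>
  have e: "t ^ n * c2 = c1" if "t \<noteq> 0" for t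
  proof -
    have "z + t *s y = t *s (y + (1 / t) *s z)"
      using that by (simp add: vec_eq_iff field_simps)
    then have "poly (line_poly H z y) t = t ^ n * poly (line_poly H y z) (1 / t)"
      unfolding poly_line_poly using n by metis
    then show ?thesis
      by (simp add: c1 c2)
  qed
  have "monom c2 n = monom c2 0"
  proof (rule poly_eqI_infinite)
    show "infinite (UNIV - {0 :: 'a})"
      using inf by simp
    fix t :: 'a assume "t \<in> UNIV - {0}"
    then show "poly (monom c2 n) t = poly (monom c2 0) t"
      using e[of t] e[of 1] by (simp add: poly_monom mult.commute)
  qed
  moreover have "c2 \<noteq> 0"
    using e[of 1] \<open>c1 \<noteq> 0\<close> by auto
  ultimately have "n = 0"
    by (metis degree_monom_eq)
  then have "ev H v = ev H 0" for v
    using n[of 0 v] by simp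
  then have H: "H = mp_const (ev H 0)"
    by (intro ev_eq_imp[OF inf]) simp
  have "H \<noteq> 0"
    using Gnz A by auto
  then have "ev H 0 \<noteq> 0"
    using H by auto
  then have "mp_const (ev H 0) * mp_const (1 / ev H 0) = 1"
    by (simp add: mult_single)
  then show "H dvd 1"
    using H by (metis dvdI)
qed

lemma order_0_linear:
  assumes "(u, v) \<noteq> (0, 0)"
  shows "Polynomial.order 0 [:u, v :: 'a::field:] = (if u = 0 then 1 else 0)"
proof (cases "u = 0")
  case True
  then have e: "[:u, v:] = smult v ([:- 0, 1:] ^ 1)" and v: "v \<noteq> 0"
    using assms by auto
  show ?thesis
    unfolding e order_smult[OF v] order_power_n_n using True by simp
next
  case False
  then show ?thesis
    by (simp add: order_0I)
qed

lemma line_through_ends: "P \<in> line_through P R" "R \<in> line_through P R"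
proof -
  have "rep_proj P = 1 *s rep_proj P + 0 *s rep_proj R" "rep_proj R = 0 *s rep_proj P + 1 *s rep_proj R"
    by simp_all
  then show "P \<in> line_through P R" "R \<in> line_through P R"
    unfolding line_through_def by blast+
qed

lemma in_line_through_abs:
  fixes z y :: "'a::field ^ 'n::finite"
  assumes "z \<noteq> 0" "y \<noteq> 0"
  shows "P \<in> line_through (abs_proj z) (abs_proj y) \<longleftrightarrow> (\<exists>\<alpha> \<beta>. rep_proj P = \<alpha> *s z + \<beta> *s y)"
proof -
  obtain c where c: "c \<noteq> 0" "rep_proj (abs_proj z) = c *s z"
    using rep_abs_proj[OF assms(1)] by blast
  obtain c' where c': "c' \<noteq> 0" "rep_proj (abs_proj y) = c' *s y"
    using rep_abs_proj[OF assms(2)] by blast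
  show ?thesis
    unfolding line_through_def c c' mem_Collect_eq
  proof
    assume "\<exists>s t. rep_proj P = s *s (c *s z) + t *s (c' *s y)"
    then obtain s t where "rep_proj P = s *s (c *s z) + t *s (c' *s y)"
      by blast
    then have "rep_proj P = (s * c) *s z + (t * c') *s y"
      by (simp add: vec_eq_iff mult.assoc)
    then show "\<exists>\<alpha> \<beta>. rep_proj P = \<alpha> *s z + \<beta> *s y"
      by blast
  next
    assume "\<exists>\<alpha> \<beta>. rep_proj P = \<alpha> *s z + \<beta> *s y"
    then obtain \<alpha> \<beta> where "rep_proj P = \<alpha> *s z + \<beta> *s y"
      by blast
    then have "rep_proj P = (\<alpha> / c) *s (c *s z) + (\<beta> / c') *s (c' *s y)"
      using c c' by (simp add: vec_eq_iff)
    then show "\<exists>s t. rep_proj P = s *s (c *s z) + t *s (c' *s y)"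
      by blast
  qed
qed

lemma abs_proj_scale: "c \<noteq> 0 \<Longrightarrow> v \<noteq> 0 \<Longrightarrow> abs_proj (c *s v) = abs_proj (v :: 'a::field ^ 'n::finite)"
  by (rule abs_proj_eqI) auto

lemma abs_proj_combination_eq:
  fixes z y :: "'a::field ^ 'n::finite"
  assumes ind: "\<And>r s. r *s z + s *s y = 0 \<Longrightarrow> r = 0 \<and> s = 0"
    and nz: "(a, b) \<noteq> (0, 0)" "(a', b') \<noteq> (0, 0)"
  shows "abs_proj (a *s z + b *s y) = abs_proj (a' *s z + b' *s y) \<longleftrightarrow> a * b' = a' * b"
proof -
  let ?u = "a *s z + b *s y" and ?v = "a' *s z + b' *s y"
  have u: "?u \<noteq> 0" "?v \<noteq> 0"
    using ind nz by blast+
  have "(\<exists>c. c \<noteq> 0 \<and> ?v = c *s ?u) \<longleftrightarrow> a * b' = a' * b"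
  proof
    assume "\<exists>c. c \<noteq> 0 \<and> ?v = c *s ?u"
    then obtain c where c: "?v = c *s ?u" by blast
    have "(a' - c * a) *s z + (b' - c * b) *s y = ?v - c *s ?u"
      by (simp add: vec_eq_iff algebra_simps)
    then have "(a' - c * a) *s z + (b' - c * b) *s y = 0"
      unfolding c by simp
    from ind[OF this] show "a * b' = a' * b"
      by simp
  next
    assume e: "a * b' = a' * b"
    show "\<exists>c. c \<noteq> 0 \<and> ?v = c *s ?u"
    proof (cases "a = 0")
      case False
      have "a' \<noteq> 0"
        using e nz False by auto
      then show ?thesis
        using e False by (intro exI[of _ "a' / a"]) (simp add: vec_eq_iff field_simps)
    next
      case True
      then have "b \<noteq> 0" "a' = 0" "b' \<noteq> 0"
        using e nz by auto
      then show ?thesis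
        using True by (intro exI[of _ "b' / b"]) (simp add: vec_eq_iff)
    qed
  qed
  then show ?thesis
    using abs_proj_eq_iff[OF u] by simp
qed

text \<open>A form that restricts to \<open>k \<alpha> \<beta> (\<alpha> b - \<beta> a)\<close> on a line meets that line exactly in the three points
  with coordinates \<open>(1, 0)\<close>, \<open>(0, 1)\<close> and \<open>(a, b)\<close>.\<close>

lemma intersection_cycle_on_line:
  fixes G :: "('k::field, 3) mpoly"
  assumes G: "homogeneous 3 G" and ind: "\<And>r s. r *s z + s *s y = 0 \<Longrightarrow> r = 0 \<and> s = 0"
    and k: "k \<noteq> 0" "a \<noteq> 0" "b \<noteq> 0"
    and line: "\<And>\<alpha> \<beta>. ev (up G) (\<alpha> *s z + \<beta> *s y) = k * (\<alpha> * \<beta> * (\<alpha> * b - \<beta> * a))"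
  shows "is_intersection_cycle G (line_through (abs_proj z) (abs_proj y))
    {#abs_proj z, abs_proj y, abs_proj (a *s z + b *s y)#}"
proof -
  note inf = infinite_UNIV_alg_closed[where 'a = "'k alg_closure"]
  let ?l = "line_through (abs_proj z) (abs_proj y)"
  have zy: "z \<noteq> 0" "y \<noteq> 0"
    using ind[of 1 0] ind[of 0 1] by auto
  have e1: "abs_proj z = abs_proj (1 *s z + 0 *s y)" and e2: "abs_proj y = abs_proj (0 *s z + 1 *s y)"
    by simp_all
  have comb: "abs_proj (\<alpha> *s z + \<beta> *s y) = abs_proj (\<alpha>' *s z + \<beta>' *s y) \<longleftrightarrow> \<alpha> * \<beta>' = \<alpha>' * \<beta>"
    if "(\<alpha>, \<beta>) \<noteq> (0, 0)" "(\<alpha>', \<beta>') \<noteq> (0, 0)" for \<alpha> \<beta> \<alpha>' \<beta>'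
    by (rule abs_proj_combination_eq[OF ind that])
  have zyne: "abs_proj z \<noteq> abs_proj y"
    unfolding e1 e2 using comb[of 1 0 0 1] by simp
  have in_l: "abs_proj (\<alpha> *s z + \<beta> *s y) \<in> ?l" if "(\<alpha>, \<beta>) \<noteq> (0, 0)" for \<alpha> \<beta>
  proof -
    have "\<alpha> *s z + \<beta> *s y \<noteq> 0"
      using ind that by blast
    then obtain c where "rep_proj (abs_proj (\<alpha> *s z + \<beta> *s y)) = c *s (\<alpha> *s z + \<beta> *s y)"
      using rep_abs_proj by metis
    also have "\<dots> = (c * \<alpha>) *s z + (c * \<beta>) *s y"
      by (simp add: vec_eq_iff algebra_simps)
    finally show ?thesis
      unfolding in_line_through_abs[OF zy] by blast
  qed
  show ?thesis
    unfolding is_intersection_cycle_def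
  proof (intro conjI allI)
    show "is_line ?l"
      unfolding is_line_def using zyne by blast
    obtain t where t: "t \<noteq> 0" "t \<noteq> b / a"
      using ex_new_if_finite[OF inf, of "{0, b / a}"] by auto
    then have "b - t * a \<noteq> 0"
      using k by (auto simp: field_simps)
    then have nz: "ev (up G) (1 *s z + t *s y) \<noteq> 0"
      unfolding line using k t by simp
    moreover have "1 *s z + t *s y \<noteq> 0"
      using ind[of 1 t] by auto
    ultimately have "abs_proj (1 *s z + t *s y) \<notin> zeros G"
      using zeros_abs[OF G] by blast
    then show "\<not> ?l \<subseteq> zeros G"
      using in_l[of 1 t] by auto
  next
    fix P
    show "count {#abs_proj z, abs_proj y, abs_proj (a *s z + b *s y)#} P = intersection_mult G ?l P"
    proof (cases "P \<in> ?l")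
      case False
      then have "P \<noteq> abs_proj z" "P \<noteq> abs_proj y" "P \<noteq> abs_proj (a *s z + b *s y)"
        using in_l[of 1 0] in_l[of 0 1] in_l[of a b] k by auto
      then show ?thesis
        using False by (simp add: intersection_mult_def)
    next
      case True
      define R where "R = (SOME R. R \<in> ?l \<and> R \<noteq> P)"
      have "\<exists>R. R \<in> ?l \<and> R \<noteq> P"
        using line_through_ends zyne by metis
      then have R: "R \<in> ?l" "R \<noteq> P"
        unfolding R_def by (metis (mono_tags, lifting) someI_ex)+
      obtain \<alpha> \<beta> where P: "rep_proj P = \<alpha> *s z + \<beta> *s y"
        using True unfolding in_line_through_abs[OF zy] by blast
      obtain \<alpha>' \<beta>' where R': "rep_proj R = \<alpha>' *s z + \<beta>' *s y"
        using R(1) unfolding in_line_through_abs[OF zy] by blast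
      have nz: "(\<alpha>, \<beta>) \<noteq> (0, 0)" "(\<alpha>', \<beta>') \<noteq> (0, 0)"
        using P R' rep_proj_props(1)[of P] rep_proj_props(1)[of R] by auto
      have aP: "P = abs_proj (\<alpha> *s z + \<beta> *s y)" and aR: "R = abs_proj (\<alpha>' *s z + \<beta>' *s y)"
        using P R' rep_proj_props(2) by metis+
      have det: "\<alpha> * \<beta>' \<noteq> \<alpha>' * \<beta>"
        using R(2) comb[OF nz] aP aR by auto
      \<comment> \<open>The three linear factors of the form along \<open>P + t R\<close>. Each has
        order 1 at 0 exactly if \<open>P\<close> is its zero on the line, so coincidences among the
        three points would add up correctly.\<close>
      let ?p1 = "[:\<alpha>, \<alpha>':]" and ?p2 = "[:\<beta>, \<beta>':]" and ?p3 = "[:\<alpha> * b - \<beta> * a, \<alpha>' * b - \<beta>' * a:]"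
      have "restrict_to_line G P R = line_poly (up G) (rep_proj P) (rep_proj R)"
        by (simp add: restrict_to_line_def line_poly_def mp_eval_up)
      also have "\<dots> = smult k (?p1 * ?p2 * ?p3)"
      proof (rule poly_eqI_infinite[OF inf])
        fix t
        have "rep_proj P + t *s rep_proj R = (\<alpha> + t * \<alpha>') *s z + (\<beta> + t * \<beta>') *s y"
          unfolding P R' by (simp add: vec_eq_iff algebra_simps)
        moreover have "(\<alpha> + t * \<alpha>') * b - (\<beta> + t * \<beta>') * a = (\<alpha> * b - \<beta> * a) + t * (\<alpha>' * b - \<beta>' * a)"
          by (simp add: algebra_simps)
        ultimately show "poly (line_poly (up G) (rep_proj P) (rep_proj R)) t = poly (smult k (?p1 * ?p2 * ?p3)) t"
          unfolding poly_line_poly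
          by (simp only: line poly_smult poly_mult poly_pCons poly_0 mult_zero_right add_0_right)
      qed
      finally have r: "restrict_to_line G P R = smult k (?p1 * ?p2 * ?p3)" .
      have n1: "(\<alpha>, \<alpha>') \<noteq> (0, 0)" and n2: "(\<beta>, \<beta>') \<noteq> (0, 0)"
        using det by auto
      have n3: "(\<alpha> * b - \<beta> * a, \<alpha>' * b - \<beta>' * a) \<noteq> (0, 0)"
      proof
        assume "(\<alpha> * b - \<beta> * a, \<alpha>' * b - \<beta>' * a) = (0, 0)"
        then have e: "\<alpha> * b = \<beta> * a" "\<alpha>' * b = \<beta>' * a"
          by auto
        have "a * (\<alpha> * \<beta>') = \<alpha> * (\<alpha>' * b)"
          unfolding e by (simp add: mult_ac)
        also have "\<dots> = \<alpha>' * (\<beta> * a)"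
          unfolding e(1)[symmetric] by (simp add: mult_ac)
        finally show False
          using det k(2) by (simp add: mult_ac)
      qed
      have "?p1 \<noteq> 0" "?p2 \<noteq> 0" "?p3 \<noteq> 0"
        using n1 n2 n3 by auto
      then have nz2: "?p1 * ?p2 \<noteq> 0" and nz3: "?p1 * ?p2 * ?p3 \<noteq> 0"
        by (metis mult_eq_0_iff)+
      have "Polynomial.order 0 (smult k (?p1 * ?p2 * ?p3))
        = (if \<alpha> = 0 then 1 else 0) + (if \<beta> = 0 then 1 else 0) + (if \<alpha> * b - \<beta> * a = 0 then 1 else 0)"
        unfolding order_smult[OF k(1)] order_mult[OF nz3] order_mult[OF nz2]
          order_0_linear[OF n1] order_0_linear[OF n2] order_0_linear[OF n3] ..
      then have im: "intersection_mult G ?l P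
        = (if \<alpha> = 0 then 1 else 0) + (if \<beta> = 0 then 1 else 0) + (if \<alpha> * b - \<beta> * a = 0 then 1 else 0)"
        unfolding intersection_mult_def R_def[symmetric] r using True by (simp only: if_True)
      have "P = abs_proj z \<longleftrightarrow> \<beta> = 0" "P = abs_proj y \<longleftrightarrow> \<alpha> = 0"
        unfolding aP using comb[OF nz(1), of 1 0] comb[OF nz(1), of 0 1] by auto
      moreover have "P = abs_proj (a *s z + b *s y) \<longleftrightarrow> \<alpha> * b - \<beta> * a = 0"
        unfolding aP using comb[OF nz(1), of a b] k(2) by (simp add: mult.commute)
      moreover have "count {#A, B, C#} P = (if P = A then 1 else 0) + (if P = B then 1 else 0) + (if P = C then 1 else 0)"
        for A B C
        by simp
      ultimately show ?thesis
        unfolding im by (simp only: add_ac)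
    qed
  qed
qed

lemma det3_vup: "det3 (vup a) (vup b) (vup c) = to_ac (det3 a b c)"
  by (simp add: det3_def)

lemma cross4_vup: "cross4 (vup a) (vup b) (vup c) = vup (cross4 a b c)"
  by (simp add: vec_eq_iff forall_4 cross4_nth)

lemma rational_iff: "rational P \<longleftrightarrow> (\<exists>v. v \<noteq> 0 \<and> P = abs_proj (vup v))"
  by (simp add: rational_def vup_def)

section \<open>Rational points and compositions over an infinite base field\<close>

locale rational_parametrization = cubic_parametrization "up F" p g0 chi tau "\<lambda>i. up (qk i)" d
  for F :: "('k::field, 4) mpoly" and p g0 chi tau qk d +
  assumes infinite_base: "infinite (UNIV :: 'k set)" and hom_base: "homogeneous 3 F"
    and p_rational: "\<And>v. v \<noteq> 0 \<Longrightarrow> ev F v = 0 \<Longrightarrow> rational (p (abs_proj (vup v)))"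
begin

abbreviation "V \<equiv> zeros F"
abbreviation "bd \<equiv> blown_down_lines V p"

definition pt :: "'k ^ 3 \<Rightarrow> ('k, 4) gpt" where
  "pt x = abs_proj (Q (vup x))"

lemma Q_vup: "Q (vup x) = vup (eval_vec qk x)"
  by (simp add: vec_eq_iff ev_up_vup)

lemma abs_in_V: "v \<noteq> 0 \<Longrightarrow> abs_proj v \<in> V \<longleftrightarrow> ev (up F) v = 0"
  by (rule zeros_abs[OF hom_base])

lemma hom_qk: "homogeneous 3 (qk i)"
  using hom_q[of i] d_eq_3 by (simp add: homogeneous_def keys_up)

lemma pt_rational:
  assumes "Q (vup x) \<noteq> 0"
  shows "pt x \<in> rational_points V"
proof -
  have "pt x \<in> V"
    unfolding pt_def using abs_in_V[OF assms] F_Q by blast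
  moreover have "rational (pt x)"
    unfolding pt_def rational_iff using assms unfolding Q_vup by (intro exI[of _ "eval_vec qk x"]) simp
  ultimately show ?thesis
    by (simp add: rational_points_def)
qed

text \<open>Where \<open>Q w\<close> is not zero the fibre over \<open>w\<close> is a single point,
  so a line can only be contracted to a base point; \<open>base_fibre\<close> then describes its
  points.\<close>

lemma blown_down_base:
  assumes "l \<in> bd"
  obtains w u1 u2 where "w \<noteq> 0" "Q w = 0" "p ` l = {abs_proj w}" "DQ w u1 \<noteq> 0" "DQ w u2 \<noteq> 0"
    "abs_proj (DQ w u1) \<in> l" "abs_proj (DQ w u2) \<in> l" "abs_proj (DQ w u1) \<noteq> abs_proj (DQ w u2)"
proof -
  obtain P1 P2 q' where l: "P1 \<noteq> P2" "l = line_through P1 P2" "l \<subseteq> V" "p ` l = {q'}"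
    using assms unfolding blown_down_lines_def is_line_def by blast
  have P: "P1 \<in> l" "P2 \<in> l"
    unfolding l(2) by (rule line_through_ends)+
  obtain w where w: "w \<noteq> 0" "q' = abs_proj w"
    by (rule proj_cases)
  obtain v1 where v1: "v1 \<noteq> 0" "P1 = abs_proj v1"
    by (rule proj_cases)
  obtain v2 where v2: "v2 \<noteq> 0" "P2 = abs_proj v2"
    by (rule proj_cases)
  have F: "ev (up F) v1 = 0" "ev (up F) v2 = 0"
    using P l(3) abs_in_V v1 v2 by blast+
  have p: "p (abs_proj v1) = abs_proj w" "p (abs_proj v2) = abs_proj w"
    using P l(4) v1 v2 w by blast+
  have base: "Q w = 0"
  proof (rule ccontr)
    assume nz: "Q w \<noteq> 0"
    have "abs_proj v1 = abs_proj (Q w)" "abs_proj v2 = abs_proj (Q w)"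
      by (rule abs_proj_eq_Q[OF _ _ w(1) _ nz], fact+)+
    then show False
      using l(1) v1 v2 by simp
  qed
  obtain u1 where u1: "v1 = DQ w u1"
    using base_fibre[OF w(1) base v1(1) F(1) p(1)] by blast
  obtain u2 where u2: "v2 = DQ w u2"
    using base_fibre[OF w(1) base v2(1) F(2) p(2)] by blast
  show thesis
    by (rule that[OF w(1) base, of u1 u2]) (use l w v1 v2 P u1 u2 in auto)
qed

lemma pt_not_blown_down: "Q (vup x) \<noteq> 0 \<Longrightarrow> pt x \<notin> \<Union> bd"
proof
  assume Q: "Q (vup x) \<noteq> 0" and "pt x \<in> \<Union> bd"
  then obtain l where l: "l \<in> bd" "pt x \<in> l" by blast
  obtain w where w: "w \<noteq> 0" "Q w = 0" "p ` l = {abs_proj w}"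
    using blown_down_base[OF l(1)] by metis
  have "p (pt x) = abs_proj (vup x)"
    unfolding pt_def by (rule p_Q[OF Q_nonzero_imp[OF Q] Q])
  then have "abs_proj w = abs_proj (vup x)"
    using l(2) w(3) by (metis imageI singletonD)
  then obtain c where "vup x = c *s w"
    using abs_proj_eq_iff[OF w(1) Q_nonzero_imp[OF Q]] by blast
  then show False
    using Q w(2) by (simp add: q_scale)
qed

text \<open>The kernel of the differential at a base point \<open>w\<close> is spanned by
  \<open>w\<close>, so its image is two-dimensional: a projective line, which \<open>p\<close> maps
  to \<open>w\<close>.\<close>

lemma contracted_line:
  assumes w: "w \<noteq> 0" "Q w = 0" and D: "DQ w u \<noteq> 0"
  shows "abs_proj (DQ w u) \<in> \<Union> bd"
proof -
  obtain v v' where vv: "det3 w v v' \<noteq> 0"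
    using det3_complete[OF w(1)] by blast
  let ?a = "DQ w v" and ?b = "DQ w v'"
  have ind: "r = 0 \<and> s = 0" if "r *s ?a + s *s ?b = 0" for r s
  proof -
    have "DQ w (r *s v + s *s v') = 0"
      using that by (simp add: dder_vec_linear)
    then obtain c where "r *s v + s *s v' = c *s w"
      using base_DQ_injective[OF w] by blast
    then have "(- c) *s w + (r *s v + s *s v') = 0"
      by simp
    then have "(- c) *s w + r *s v + s *s v' = 0"
      by (simp only: add.assoc)
    from det3_indep[OF vv this] show ?thesis by simp
  qed
  have nz: "?a \<noteq> 0" "?b \<noteq> 0"
    using ind[of 1 0] ind[of 0 1] by auto
  let ?l = "line_through (abs_proj ?a) (abs_proj ?b)"
  have "abs_proj ?a \<noteq> abs_proj ?b"
    using abs_proj_combination_eq[OF ind, where a = 1 and b = 0 and a' = 0 and b' = 1] by simp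
  then have line: "is_line ?l"
    unfolding is_line_def by blast
  have on: "R \<in> V \<and> p R = abs_proj w" if R: "R \<in> ?l" for R
  proof -
    obtain \<alpha> \<beta> where "rep_proj R = \<alpha> *s ?a + \<beta> *s ?b"
      using R unfolding in_line_through_abs[OF nz] by blast
    then have r: "rep_proj R = DQ w (\<alpha> *s v + \<beta> *s v')"
      by (simp add: dder_vec_linear)
    have R': "R = abs_proj (DQ w (\<alpha> *s v + \<beta> *s v'))" and ne: "DQ w (\<alpha> *s v + \<beta> *s v') \<noteq> 0"
      using rep_proj_props[of R] unfolding r by simp_all
    show ?thesis
      using base_contracted[OF w ne] abs_in_V[OF ne] R' by simp
  qed
  have "abs_proj ?a \<in> ?l"
    by (rule line_through_ends)
  then have "p ` ?l = {abs_proj w}"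
    using on by (auto intro!: image_eqI[of _ p "abs_proj ?a"])
  then have "?l \<in> bd"
    unfolding blown_down_lines_def using line on by blast
  moreover have "abs_proj (DQ w u) \<in> ?l"
  proof -
    obtain a b c where "u = a *s w + b *s v + c *s v'"
      using det3_basis[OF vv] by blast
    then have u: "DQ w u = b *s ?a + c *s ?b"
      by (simp add: dder_vec_linear DQ_self w(2))
    obtain k where "rep_proj (abs_proj (DQ w u)) = k *s DQ w u"
      using rep_abs_proj[OF D] by blast
    also have "\<dots> = (k * b) *s ?a + (k * c) *s ?b"
      unfolding u by (simp add: vec_eq_iff algebra_simps)
    finally show ?thesis
      unfolding in_line_through_abs[OF nz] by blast
  qed
  ultimately show ?thesis by blast
qed

text \<open>The image under \<open>p\<close> is rational, and not a base point, as the whole fibre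
  over a base point lies on a contracted line. \<open>Q\<close> recovers the given point from
  it.\<close>

lemma rational_point_cases:
  assumes "P \<in> rational_points V - \<Union> bd"
  obtains x where "Q (vup x) \<noteq> 0" "P = pt x"
proof -
  obtain v where v: "v \<noteq> 0" "P = abs_proj (vup v)"
    using assms unfolding rational_points_def rational_iff by blast
  have F: "ev (up F) (vup v) = 0"
    using assms abs_in_V[of "vup v"] v unfolding rational_points_def by auto
  then have "ev F v = 0"
    by (simp add: ev_up_vup)
  then obtain x where x: "x \<noteq> 0" "p P = abs_proj (vup x)"
    using p_rational[OF v(1)] v(2) unfolding rational_iff by blast
  have "Q (vup x) \<noteq> 0"
  proof
    assume "Q (vup x) = 0"
    then obtain u where "vup v = DQ (vup x) u"
      using base_fibre[of "vup x" "vup v"] x v F by auto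
    then have "P \<in> \<Union> bd"
      using contracted_line[of "vup x" u] x v \<open>Q (vup x) = 0\<close> by (metis vup_eq_0_iff)
    then show False
      using assms by blast
  qed
  moreover have "P = pt x"
    unfolding pt_def v(2) by (rule abs_proj_eq_Q) (use v F x calculation in auto)
  ultimately show thesis
    by (rule that)
qed

text \<open>The third point is prescribed, and only the pair \<open>z, y\<close> has to be in
  general position. Both orders are recorded: \<open>x\<close> is obtained from the pair, or
  \<open>z\<close> from the other two points.\<close>

lemma composition_on_line:
  assumes m: "misses (vup z) (vup y)" and ab: "a \<noteq> 0" "b \<noteq> 0"
    and good: "\<And>w. w \<in> base_pts \<Longrightarrow> dot (join w (vup z)) (Q (vup y)) \<noteq> 0"
    and x: "x = a *s z + b *s y"
  obtains C where "admissible_section V p C" "pt x \<in> rational_points C" "pt y \<in> rational_points C" "pt z \<in> rational_points C"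
    "pt x \<in> section_comp p C (pt z) (pt y)" "pt z \<in> section_comp p C (pt x) (pt y)" "pt x \<noteq> pt y" "pt z \<noteq> pt y"
proof -
  let ?x = "vup x" and ?y = "vup y" and ?z = "vup z"
  let ?a = "to_ac a" and ?b = "to_ac b"
  have ab': "?a \<noteq> 0" "?b \<noteq> 0"
    using ab by auto
  have x': "?x = ?a *s ?z + ?b *s ?y"
    by (simp add: x vup_linear)
  have Qnz: "Q ?x \<noteq> 0" "Q ?y \<noteq> 0" "Q ?z \<noteq> 0"
    unfolding x' using missesD[OF m] ab' by auto
  note nz = Qnz[THEN Q_nonzero_imp]
  have ind: "r = 0 \<and> s = 0" if "r *s ?z + s *s ?y = 0" for r s
    using misses_indep2[OF m that] by simp
  \<comment> \<open>The cross product is taken over the base field, so the plane, and with it the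
    cubic \<open>G\<close>, has coefficients there.\<close>
  define hk where "hk = cross4 (eval_vec qk z) (eval_vec qk y) (eval_vec qk x)"
  define h where "h = triple_plane ?z ?y ?x"
  have h: "h = vup hk"
    unfolding h_def triple_plane_def hk_def Q_vup cross4_vup ..
  define H where "H = (\<Sum>i\<in>UNIV. mp_const (hk $ i) * mp_var i)"
  have evH: "mp_eval to_ac H v = dot h v" for v
    unfolding H_def dot_def h mp_eval_sum[OF ring_hom_on_to_ac] mp_eval_mult[OF ring_hom_on_to_ac]
    by (simp add: mp_eval_single monom_eval_single del: One_nat_def)
  have homH: "homogeneous 1 H"
    unfolding H_def using homogeneous_mult[OF homogeneous_const homogeneous_var] by (intro homogeneous_sum) auto
  define G where "G = mp_subst H qk"
  have evG: "ev (up G) v = dot h (Q v)" for v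
    unfolding G_def ev_up mp_eval_subst[OF ring_hom_on_to_ac] evH by (simp add: eval_vec_def ev_up)
  have homG: "homogeneous 3 G"
    using homogeneous_subst[OF homH hom_qk] by (simp add: G_def)
  obtain k where k: "k \<noteq> 0" "\<And>\<alpha> \<beta>. dot h (Q (\<alpha> *s ?z + \<beta> *s ?y)) = k * (\<alpha> * \<beta> * (\<alpha> * ?b - \<beta> * ?a))"
    unfolding h_def x' using triple_plane_on_line[OF m ab'] by blast
  have line: "ev (up G) (\<alpha> *s ?z + \<beta> *s ?y) = k * (\<alpha> * \<beta> * (\<alpha> * ?b - \<beta> * ?a))" for \<alpha> \<beta>
    unfolding evG by (rule k(2))
  define C where "C = V \<inter> zeros H"
  have in_C: "abs_proj c \<in> C \<longleftrightarrow> ev (up F) c = 0 \<and> dot h c = 0" if "c \<noteq> 0" for c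
    using abs_in_V[OF that] zeros_abs[OF homH that] by (simp add: C_def ev_up evH)
  have "h \<noteq> 0"
  proof
    assume h0: "h = 0"
    obtain t where "t \<noteq> 0" "t \<noteq> ?a / ?b"
      using ex_new_if_finite[OF inf, of "{0, ?a / ?b}"] by auto
    then have "k * (t * 1 * (t * ?b - 1 * ?a)) \<noteq> 0"
      using k(1) ab' by (auto simp: field_simps)
    then show False
      using k(2)[of t 1] h0 by (simp add: dot_simps)
  qed
  then have "H \<noteq> 0"
    using evH by (metis dot_axis mp_eval_0 vec_eq_iff zero_index)
  have adm: "admissible_section V p C"
    unfolding admissible_section_def
  proof (intro conjI ballI notI)
    show "\<exists>H. H \<noteq> 0 \<and> homogeneous 1 H \<and> C = V \<inter> zeros H"
      using \<open>H \<noteq> 0\<close> homH C_def by blast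
    fix l assume l: "l \<in> bd" "l \<subseteq> C"
    obtain w u1 u2 where w: "w \<noteq> 0" "Q w = 0" "DQ w u1 \<noteq> 0" "DQ w u2 \<noteq> 0"
      "abs_proj (DQ w u1) \<in> l" "abs_proj (DQ w u2) \<in> l" "abs_proj (DQ w u1) \<noteq> abs_proj (DQ w u2)"
      using blown_down_base[OF l(1)] by metis
    have h0: "dot h (DQ w u1) = 0" "dot h (DQ w u2) = 0"
      using w l(2) in_C by blast+
    \<comment> \<open>Two different points of the contracted line come from directions independent
      modulo \<open>w\<close>, so a form vanishing at both kills the whole image of the
      differential.\<close>
    have "det3 w u1 u2 \<noteq> 0"
    proof
      assume d0: "det3 w u1 u2 = 0"
      have "\<exists>v. det3 w u1 v \<noteq> 0"
      proof (rule ccontr)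
        assume "\<not> (\<exists>v. det3 w u1 v \<noteq> 0)"
        then obtain c where "u1 = c *s w"
          using det3_nondegenerate[OF w(1)] by metis
        then show False
          using w(2,3) by (simp add: dder_vec_linear DQ_self)
      qed
      then obtain v where v: "det3 w u1 v \<noteq> 0" by blast
      obtain r s t where u2: "u2 = r *s w + s *s u1 + t *s v"
        using det3_basis[OF v] by blast
      have "t = 0"
        using d0 v unfolding u2 by (simp add: det3_linear det3_same)
      then have e: "DQ w u2 = s *s DQ w u1"
        unfolding u2 by (simp add: dder_vec_linear DQ_self w(2))
      then have "s \<noteq> 0"
        using w(4) by auto
      then show False
        using w(3,7) unfolding e by (simp add: abs_proj_scale)
    qed
    then have "dot h (DQ w u) = 0" for u
    proof -
      obtain r s t where u: "u = r *s w + s *s u1 + t *s u2"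
        using det3_basis[OF \<open>det3 w u1 u2 \<noteq> 0\<close>] by blast
      show ?thesis
        unfolding u by (simp add: dder_vec_linear DQ_self w(2) dot_simps h0)
    qed
    then show False
      using triple_plane_admissible[OF m ab' good w(1,2)] unfolding h_def x' by blast
  qed
  have zerosG: "zeros G = p ` C"
  proof (rule Set.set_eqI)
    fix P :: "('k, 3) gpt"
    obtain v where v: "v \<noteq> 0" "P = abs_proj v"
      by (rule proj_cases)
    have "P \<in> zeros G \<longleftrightarrow> dot h (Q v) = 0"
      unfolding v(2) zeros_abs[OF homG v(1)] evG ..
    also have "\<dots> \<longleftrightarrow> (\<exists>c. c \<noteq> 0 \<and> abs_proj c \<in> C \<and> p (abs_proj c) = P)"
      unfolding section_image[OF v(1)] v(2) using in_C by blast
    also have "\<dots> \<longleftrightarrow> P \<in> p ` C"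
      using proj_cases by (metis (no_types, lifting) image_iff)
    finally show "P \<in> zeros G \<longleftrightarrow> P \<in> p ` C" .
  qed
  \<comment> \<open>A multiple component would meet the line with multiplicity at least 2 somewhere,
    but the three intersection points are different.\<close>
  have "squarefree (up G)"
    by (rule squarefree_if_simple_on_line[OF homogeneous_up[OF homG] k(1) ab' line])
  moreover have "G \<noteq> 0"
  proof
    assume "G = 0"
    then have "up G = 0"
      by simp
    then have "dot h (Q v) = 0" for v
      using evG[of v] by (metis mp_eval_0)
    then show False
      using hyperplane_nonzero_on_line[OF m \<open>h \<noteq> 0\<close>] by metis
  qed
  ultimately have cubic: "plane_cubic G"
    using homG by (simp add: plane_cubic_def)
  have pp: "p (pt x) = abs_proj ?x" "p (pt y) = abs_proj ?y" "p (pt z) = abs_proj ?z"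
    unfolding pt_def by (rule p_Q; fact)+
  have hQ: "dot h (Q ?x) = 0" "dot h (Q ?y) = 0" "dot h (Q ?z) = 0"
    by (simp_all add: h_def triple_plane_def dot_commute[of "cross4 _ _ _"])
  have ptC: "pt x \<in> C" "pt y \<in> C" "pt z \<in> C"
    unfolding pt_def using in_C Qnz F_Q hQ by blast+
  then have ratC: "pt x \<in> rational_points C" "pt y \<in> rational_points C" "pt z \<in> rational_points C"
    using pt_rational Qnz unfolding rational_points_def by auto
  \<comment> \<open>Only injectivity over this one point matters: its image is no base point, so
    \<open>Q\<close> determines the preimage.\<close>
  have inv: "the_inv_into C p (abs_proj (vup v)) = pt v" if v: "Q (vup v) \<noteq> 0" "pt v \<in> C" for v
    unfolding the_inv_into_def
  proof (rule the_equality)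
    show "pt v \<in> C \<and> p (pt v) = abs_proj (vup v)"
      using v p_Q[OF Q_nonzero_imp[OF v(1)] v(1)] by (simp add: pt_def)
    fix c assume c: "c \<in> C \<and> p c = abs_proj (vup v)"
    obtain c' where c': "c' \<noteq> 0" "c = abs_proj c'"
      by (rule proj_cases)
    then show "c = pt v"
      unfolding pt_def using abs_proj_eq_Q[of c' "vup v"] c in_C[of c'] v(1) Q_nonzero_imp by blast
  qed
  have ratP: "abs_proj (vup v) \<in> rational_points (zeros G)" if v: "vup v \<noteq> 0" "pt v \<in> C" "p (pt v) = abs_proj (vup v)" for v
  proof -
    have "abs_proj (vup v) \<in> zeros G"
      unfolding zerosG using v(2) unfolding v(3)[symmetric] by (rule imageI)
    moreover have "rational (abs_proj (vup v))"
      unfolding rational_iff using v(1) by auto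
    ultimately show ?thesis
      by (simp add: rational_points_def)
  qed
  have rat: "abs_proj ?x \<in> rational_points (zeros G)" "abs_proj ?y \<in> rational_points (zeros G)" "abs_proj ?z \<in> rational_points (zeros G)"
    using ratP nz ptC pp by blast+
  have cyc: "is_intersection_cycle G (line_through (abs_proj ?z) (abs_proj ?y)) {#abs_proj ?z, abs_proj ?y, abs_proj ?x#}"
    unfolding x' by (rule intersection_cycle_on_line[OF homG ind k(1) ab' line])
  have "collinear_on G (abs_proj ?z) (abs_proj ?y) (abs_proj ?x)"
    using cyc rat unfolding collinear_on_def by blast
  moreover have "collinear_on G (abs_proj ?x) (abs_proj ?y) (abs_proj ?z)"
  proof -
    have e: "{#abs_proj ?z, abs_proj ?y, abs_proj ?x#} = {#abs_proj ?x, abs_proj ?y, abs_proj ?z#}"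
      by simp
    have "is_intersection_cycle G (line_through (abs_proj ?z) (abs_proj ?y)) {#abs_proj ?x, abs_proj ?y, abs_proj ?z#}"
      using cyc unfolding e .
    then show ?thesis
      using rat unfolding collinear_on_def by blast
  qed
  ultimately have comp: "pt x \<in> section_comp p C (pt z) (pt y)" "pt z \<in> section_comp p C (pt x) (pt y)"
    unfolding section_comp_def cubic_comp_def pp
    using inv[OF Qnz(1) ptC(1), symmetric] inv[OF Qnz(3) ptC(3), symmetric] cubic zerosG by blast+
  have "abs_proj ?x \<noteq> abs_proj ?y" "abs_proj ?z \<noteq> abs_proj ?y"
    unfolding x' using abs_proj_combination_eq[OF ind, where a = ?a and b = ?b and a' = 0 and b' = 1]
      abs_proj_combination_eq[OF ind, where a = 1 and b = 0 and a' = 0 and b' = 1] ab' by auto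
  then have "pt x \<noteq> pt y" "pt z \<noteq> pt y"
    using pp by auto
  then show thesis
    using that adm ratC comp by blast
qed

section \<open>General position at rational points, and generation from a triangle\<close>

lemma infinite_range_to_ac: "infinite (range (to_ac :: 'k \<Rightarrow> _))"
  using infinite_base finite_imageD[OF _ inj_to_ac] by blast

lemma ex_rational_nonzero:
  assumes "polyfun f" "f (x :: 'k alg_closure ^ 3) \<noteq> 0"
  obtains v where "f (vup v) \<noteq> 0"
proof -
  obtain u where u: "\<And>i. u $ i \<in> range (to_ac :: 'k \<Rightarrow> _)" "f u \<noteq> 0"
  proof (rule polyfun_nonzero_point[OF assms infinite_range_to_ac])
    fix t :: "'k alg_closure" and n assume "t \<in> range to_ac"
    then show "t ^ n \<in> range to_ac"
      by (metis image_iff rangeI to_ac_power)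
  qed blast
  then have "\<exists>c. u $ i = to_ac c" for i
    by blast
  then obtain c where "\<And>i. u $ i = to_ac (c i)"
    by metis
  then have "u = vup (\<chi> i. c i)"
    by (simp add: vec_eq_iff)
  then show thesis
    using that u(2) by blast
qed

text \<open>\<open>join w z\<close> is a nonzero linear form and cannot vanish on the image of a
  line off the base points. The finitely many conditions are multiplied together.\<close>

lemma good_generic:
  assumes z: "Q z \<noteq> 0"
  obtains f where "polyfun f" "\<exists>y. f y \<noteq> 0" "\<And>y. f y \<noteq> 0 \<Longrightarrow> misses z y"
    "\<And>y w. f y \<noteq> 0 \<Longrightarrow> w \<in> base_pts \<Longrightarrow> dot (join w z) (Q y) \<noteq> 0"
proof -
  obtain f where f: "polyfun f" "\<exists>y. f y \<noteq> 0" "\<And>y. f y \<noteq> 0 \<Longrightarrow> misses z y"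
    using misses_generic[OF z] by blast
  obtain y0 where y0: "f y0 \<noteq> 0"
    using f(2) by blast
  let ?g = "\<lambda>y. \<Prod>w\<in>base_pts. dot (join w z) (Q y)"
  have pf: "polyfun (\<lambda>y. dot (join w z) (Q y))" for w
    by (intro polyfun_dot polyfun_const polyfun_Q)
  have "\<exists>y. dot (join w z) (Q y) \<noteq> 0" if "w \<in> base_pts" for w
    using hyperplane_nonzero_on_line[OF f(3)[OF y0] join(1)[OF base_ptsD[OF that] z]] by metis
  then obtain y1 where y1: "?g y1 \<noteq> 0"
    using polyfun_prod_nonzero[OF inf finite_base_pts, of "\<lambda>w y. dot (join w z) (Q y)"] pf by blast
  have pg: "polyfun ?g"
    by (intro polyfun_prod pf)
  show thesis
  proof (rule that[of "\<lambda>y. f y * ?g y"])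
    show "polyfun (\<lambda>y. f y * ?g y)"
      by (intro polyfun_mult f pg)
    show "\<exists>y. f y * ?g y \<noteq> 0"
      using polyfun_common_nonzero[OF inf f(1) pg y0 y1] by simp
  qed (use f(3) finite_base_pts in auto)
qed

text \<open>If both determinants vanished, \<open>a\<close> and \<open>b\<close> would span the line
  through \<open>z\<close> and \<open>w\<close>, although their line contains no base point. So at
  most one point of it is aligned with \<open>z\<close> and \<open>w\<close>.\<close>

lemma line_not_through_base:
  assumes m: "misses a b" and z: "Q z \<noteq> 0" and w: "w \<in> base_pts"
  shows "det3 z w a \<noteq> 0 \<or> det3 z w b \<noteq> 0"
proof (rule ccontr)
  assume "\<not> (det3 z w a \<noteq> 0 \<or> det3 z w b \<noteq> 0)"
  then have 0: "det3 z w a = 0" "det3 z w b = 0"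
    by auto
  note wb = base_ptsD[OF w]
  have "\<exists>y. det3 z w y \<noteq> 0"
  proof (rule ccontr)
    assume "\<not> (\<exists>y. det3 z w y \<noteq> 0)"
    then obtain c where c: "w = c *s z"
      using det3_nondegenerate[OF Q_nonzero_imp[OF z]] by metis
    then show False
      using wb z by (auto simp: q_scale)
  qed
  then obtain y where y: "det3 z w y \<noteq> 0" by blast
  obtain r s t where a: "a = r *s z + s *s w + t *s y"
    using det3_basis[OF y] by blast
  obtain r' s' t' where b: "b = r' *s z + s' *s w + t' *s y"
    using det3_basis[OF y] by blast
  have t: "t = 0" "t' = 0"
    using 0 y unfolding a b by (simp_all add: det3_linear det3_same)
  have e: "r' *s a + (- r) *s b = (r' * s - r * s') *s w" "s' *s a + (- s) *s b = (s' * r - s * r') *s z"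
    unfolding a b t by (simp_all add: vec_eq_iff algebra_simps)
  have "Q (r' *s a + (- r) *s b) = 0"
    unfolding e(1) q_scale wb(2) by simp
  then have r: "r' = 0" "r = 0"
    using missesD(4)[OF m, of r' "- r"] by auto
  then have "s' *s a + (- s) *s b = 0"
    unfolding e(2) by simp
  then have "s' = 0" "s = 0"
    using misses_indep2[OF m, of s' "- s"] by auto
  then show False
    using a r t missesD(1)[OF m] Q_0 by simp
qed

lemma pt_scale:
  assumes "c \<noteq> 0" "Q (vup x) \<noteq> 0"
  shows "pt (c *s x) = pt x"
  unfolding pt_def vup_linear q_scale using assms by (intro abs_proj_scale) simp_all

text \<open>The conditions of \<open>composition_on_line\<close> do not involve the third point, so
  one good pair yields all rational points of its line.\<close>

definition good :: "'k ^ 3 \<Rightarrow> 'k ^ 3 \<Rightarrow> bool" where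
  "good z y \<longleftrightarrow> misses (vup z) (vup y) \<and> (\<forall>w\<in>base_pts. dot (join w (vup z)) (Q (vup y)) \<noteq> 0)"

lemma generated_line:
  assumes g: "good a b" and gen: "pt a \<in> generated_points V p B" "pt b \<in> generated_points V p B"
    and rs: "(r, s) \<noteq> (0, 0)"
  shows "pt (r *s a + s *s b) \<in> generated_points V p B"
proof -
  have m: "misses (vup a) (vup b)"
    using g by (simp add: good_def)
  consider "r = 0" | "s = 0" | "r \<noteq> 0" "s \<noteq> 0"
    by blast
  then show ?thesis
  proof cases
    case 1
    then show ?thesis
      using gen(2) rs pt_scale[of s b] missesD(2)[OF m] by simp
  next
    case 2
    then show ?thesis
      using gen(1) rs pt_scale[of r a] missesD(1)[OF m] by simp
  next
    case 3
    then obtain C where C: "admissible_section V p C" "pt b \<in> rational_points C" "pt a \<in> rational_points C"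
      "pt (r *s a + s *s b) \<in> section_comp p C (pt a) (pt b)" "pt a \<noteq> pt b"
      using composition_on_line[OF m 3 _ refl] g unfolding good_def by metis
    show ?thesis
      by (rule generated_points.comp[OF gen C(5,1,3,2,4)])
  qed
qed

theorem finitely_generated:
  "finitely_generated_points V p (rational_points V - \<Union> bd)"
proof -
  obtain x0 i where "ev (up (qk i)) x0 \<noteq> 0"
    using ex_nonbase by (auto simp: vec_eq_iff)
  then obtain a where "ev (up (qk i)) (vup a) \<noteq> 0"
    using ex_rational_nonzero[OF polyfun_ev] by metis
  then have a: "Q (vup a) \<noteq> 0"
    by (metis eval_vec_nth zero_index)
  obtain f where f: "polyfun f" "\<exists>y. f y \<noteq> 0" "\<And>y. f y \<noteq> 0 \<Longrightarrow> misses (vup a) y"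
    "\<And>y w. f y \<noteq> 0 \<Longrightarrow> w \<in> base_pts \<Longrightarrow> dot (join w (vup a)) (Q y) \<noteq> 0"
    using good_generic[OF a] by metis
  have good_f: "good a y" if "f (vup y) \<noteq> 0" for y
    using f(3,4) that by (simp add: good_def)
  obtain y0 where y0: "f y0 \<noteq> 0"
    using f(2) by blast
  obtain b where b: "f (vup b) \<noteq> 0"
    using ex_rational_nonzero[OF f(1) y0] by blast
  have gab: "good a b"
    by (rule good_f[OF b])
  then have mab: "misses (vup a) (vup b)"
    by (simp add: good_def)
  obtain e where e: "det3 (vup a) (vup b) e \<noteq> 0"
    using misses_indep[OF mab] by blast
  have pd: "polyfun (\<lambda>y. det3 (vup a) (vup b) y)"
    by (intro polyfun_det3 polyfun_const polyfun_nth)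
  obtain y1 where y1: "f y1 * det3 (vup a) (vup b) y1 \<noteq> 0"
    using polyfun_common_nonzero[OF inf f(1) pd y0 e] by auto
  obtain c where "f (vup c) * det3 (vup a) (vup b) (vup c) \<noteq> 0"
    using ex_rational_nonzero[OF polyfun_mult[OF f(1) pd] y1] by blast
  then have gac: "good a c" and D: "det3 a b c \<noteq> 0"
    using good_f[of c] by (auto simp: det3_vup)
  have mac: "misses (vup a) (vup c)"
    using gac by (simp add: good_def)
  define B where "B = {pt a, pt b, pt c}"
  have gB: "pt a \<in> generated_points V p B" "pt b \<in> generated_points V p B" "pt c \<in> generated_points V p B"
    by (auto simp: B_def intro: generated_points.base)
  have BS: "B \<subseteq> rational_points V - \<Union> bd"
    using pt_rational pt_not_blown_down missesD(1,2)[OF mab] missesD(2)[OF mac] by (auto simp: B_def)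
  have "P \<in> generated_points V p B" if P: "P \<in> rational_points V - \<Union> bd" for P
  proof -
    obtain z where z: "Q (vup z) \<noteq> 0" "P = pt z"
      using rational_point_cases[OF P] by blast
    obtain r s t where zc: "z = r *s a + s *s b + t *s c"
      using det3_basis[OF D] by blast
    have z0: "z \<noteq> 0"
      using Q_nonzero_imp[OF z(1)] by auto
    consider "t = 0" | "s = 0" | "s \<noteq> 0" "t \<noteq> 0"
      by blast
    then show ?thesis
    proof cases
      case 1
      then have "(r, s) \<noteq> (0, 0)"
        using z0 zc by auto
      then show ?thesis
        using generated_line[OF gab gB(1,2)] z(2) zc 1 by simp
    next
      case 2
      then have "(r, t) \<noteq> (0, 0)"
        using z0 zc by auto
      then show ?thesis
        using generated_line[OF gac gB(1,3)] z(2) zc 2 by simp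
    next
      case 3
      let ?z = "vup z" and ?a = "vup a" and ?b = "vup b"
      have "\<exists>G. \<forall>y. dot (join w ?z) (Q y) = ev G y" for w
        using polyfun_dot[OF polyfun_const polyfun_Q, of "join w ?z"] unfolding polyfun_def .
      then obtain G where G: "\<And>w y. dot (join w ?z) (Q y) = ev (G w) y"
        by metis
      \<comment> \<open>A value of \<open>N w\<close> at a parameter is the product of the two
        quantities to be kept nonzero at \<open>x = a + \<sigma> b\<close>: the first keeps
        \<open>w\<close> off the line \<open>z x\<close>, the second keeps \<open>Q x\<close> out of
        the plane \<open>join w z\<close>. As polynomials they exclude finitely many
        \<open>\<sigma>\<close>.\<close>
      define N where "N w = [:det3 ?z w ?a, det3 ?z w ?b:] * line_poly (G w) ?a ?b" for w
      have "N w \<noteq> 0" if w: "w \<in> base_pts" for w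
      proof -
        obtain t where "dot (join w ?z) (Q (?a + t *s ?b)) \<noteq> 0"
          using hyperplane_nonzero_on_line[OF mab join(1)[OF base_ptsD[OF w] z(1)]] by blast
        then have "poly (line_poly (G w) ?a ?b) t \<noteq> 0"
          by (simp add: poly_line_poly G)
        then have "line_poly (G w) ?a ?b \<noteq> 0"
          by auto
        moreover have "[:det3 ?z w ?a, det3 ?z w ?b:] \<noteq> 0"
          using line_not_through_base[OF mab z(1) w] by auto
        ultimately show ?thesis
          unfolding N_def using no_zero_divisors by blast
      qed
      then have "(\<Prod>w\<in>base_pts. N w) * [:0, 1:] \<noteq> 0"
        using finite_base_pts by simp
      then have "finite {x. poly ((\<Prod>w\<in>base_pts. N w) * [:0, 1:]) x = 0}"
        by (rule poly_roots_finite)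
      then obtain \<sigma> where "poly ((\<Prod>w\<in>base_pts. N w) * [:0, 1:]) (to_ac \<sigma>) \<noteq> 0"
        using infinite_range_to_ac by (metis (mono_tags, lifting) finite_subset image_subsetI mem_Collect_eq)
      then have sg: "\<sigma> \<noteq> 0" "poly (N w) (to_ac \<sigma>) \<noteq> 0" if "w \<in> base_pts" for w
        using that finite_base_pts by (auto simp: poly_prod)
      have sg0: "\<sigma> \<noteq> 0"
        using \<open>poly ((\<Prod>w\<in>base_pts. N w) * [:0, 1:]) (to_ac \<sigma>) \<noteq> 0\<close> by auto
      define x where "x = 1 *s a + \<sigma> *s b"
      have x': "vup x = ?a + to_ac \<sigma> *s ?b"
        by (simp add: x_def vup_linear)
      have j: "dot (join w ?z) (Q (vup x)) \<noteq> 0" "det3 ?z w (vup x) \<noteq> 0" if "w \<in> base_pts" for w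
      proof -
        have "poly (N w) (to_ac \<sigma>) = det3 ?z w (vup x) * dot (join w ?z) (Q (vup x))"
          by (simp add: N_def x' poly_line_poly G det3_linear algebra_simps)
        then show "dot (join w ?z) (Q (vup x)) \<noteq> 0" "det3 ?z w (vup x) \<noteq> 0"
          using sg(2)[OF that] by auto
      qed
      \<comment> \<open>Independence of \<open>z\<close> and \<open>x\<close> for
        \<open>misses_criterion\<close>, with \<open>b\<close> as the auxiliary vector; here
        \<open>z\<close> off the side \<open>a b\<close> enters through \<open>t\<close>.\<close>
      have "det3 ?z ?b (vup x) \<noteq> 0"
      proof -
        have "det3 z b x = t * det3 c b a"
          unfolding zc x_def by (simp add: det3_linear det3_same det3_swap(1)[of a b])
        then have "det3 z b x \<noteq> 0"
          using D 3(2) det3_swap(3)[of c b a] by simp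
        then show ?thesis
          by (simp add: det3_vup)
      qed
      then have mzx: "misses ?z (vup x)"
        using misses_criterion[OF z(1)] j(2) by blast
      \<comment> \<open>The multiple of \<open>x\<close> is chosen to cancel the coordinate along
        \<open>b\<close>: \<open>y\<close> is the intersection of the line \<open>z x\<close> with
        the side \<open>a c\<close>.\<close>
      define y where "y = 1 *s z + (- s / \<sigma>) *s x"
      have y: "y = (r - s / \<sigma>) *s a + t *s c"
        using sg0 by (simp add: y_def x_def zc vec_eq_iff algebra_simps)
      obtain C where C: "admissible_section V p C" "pt y \<in> rational_points C" "pt x \<in> rational_points C"
        "pt z \<in> section_comp p C (pt y) (pt x)" "pt y \<noteq> pt x"
        using composition_on_line[OF mzx _ _ j(1) y_def] 3(1) sg0 by (metis divide_eq_0_iff neg_equal_0_iff_equal zero_neq_one)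
      have gx: "pt x \<in> generated_points V p B"
        unfolding x_def by (rule generated_line[OF gab gB(1,2)]) simp
      have gy: "pt y \<in> generated_points V p B"
        unfolding y by (rule generated_line[OF gac gB(1,3)]) (use 3(2) in simp)
      show ?thesis
        unfolding z(2) by (rule generated_points.comp[OF gy gx C(5,1,2,3,4)])
    qed
  qed
  then show ?thesis
    unfolding finitely_generated_points_def using BS by (intro exI[of _ B]) (auto simp: B_def)
qed

end

section \<open>Finite base fields and the conclusion\<close>

lemma finite_rational_points:
  assumes "finite (UNIV :: 'k::field set)"
  shows "finite {P :: ('k, 4) gpt. rational P}"
proof -
  let ?f = "\<lambda>(a, b, c, d). (\<chi> i :: 4. if i = 1 then a else if i = 2 then b else if i = 3 then c else (d :: 'k))"
  have "v \<in> range ?f" for v :: "'k ^ 4"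
  proof -
    have "v = ?f (v $ 1, v $ 2, v $ 3, v $ 4)"
      by (simp add: vec_eq_iff forall_4)
    then show ?thesis
      by (rule range_eqI)
  qed
  then have "range ?f = UNIV"
    by blast
  moreover have "finite (range ?f)"
    by (intro finite_imageI) (simp add: assms finite_prod)
  ultimately have "finite (UNIV :: ('k ^ 4) set)"
    by simp
  then have "finite (range (\<lambda>v :: 'k ^ 4. abs_proj (vup v)))"
    by simp
  then show ?thesis
    by (rule finite_subset[rotated]) (auto simp: rational_iff)
qed

theorem theorem5p2:
  fixes F :: "('k::field, 4) mpoly"
    and p :: "('k, 4) gpt \<Rightarrow> ('k, 3) gpt"
  assumes "finitely_generated_field TYPE('k)"
    and "smooth_cubic_surface F"
    and "birational_morphism (zeros F) UNIV p"
  shows "finitely_generated_points (zeros F) p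
           (rational_points (zeros F) - \<Union> (blown_down_lines (zeros F) p))"
proof (cases "finite (UNIV :: 'k set)")
  case True
  let ?S = "rational_points (zeros F) - \<Union> (blown_down_lines (zeros F) p)"
  have "finite ?S"
    by (rule finite_subset[OF _ finite_rational_points[OF True]]) (auto simp: rational_points_def)
  then show ?thesis
    unfolding finitely_generated_points_def
    by (intro exI[of _ ?S]) (auto intro: generated_points.base)
next
  case False
  obtain g0 chi tau d and q :: "4 \<Rightarrow> ('k, 3) mpoly"
    where "cubic_parametrization (up F) p g0 chi tau (\<lambda>i. up (q i)) d"
    by (rule ex_cubic_parametrization[OF assms(2,3)])
  then interpret cubic_parametrization "up F" p g0 chi tau "\<lambda>i. up (q i)" d .
  note F = smooth_cubic_surfaceD(1)[OF assms(2)]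
  \<comment> \<open>The local forms of \<open>p\<close> have coefficients in the base field, so they
    map a rational vector to a rational vector.\<close>
  have "rational (p (abs_proj (vup v)))" if v: "v \<noteq> 0" "ev F v = 0" for v
  proof -
    have Fv: "ev (up F) (vup v) = 0" and vn: "vup v \<noteq> 0"
      using v by (simp_all add: ev_up_vup)
    obtain g h where gh: "local_rep (up F) p (\<lambda>i. up (g i)) (up h)" "ev (up h) (vup v) \<noteq> 0"
      using regular_map_local_rep[OF F _ vn Fv] assms(3) unfolding birational_morphism_def by blast
    have "eval_vec (\<lambda>i. up (g i)) (vup v) = vup (eval_vec g v)"
      by (simp add: vec_eq_iff ev_up_vup)
    then have "vup (eval_vec g v) \<noteq> 0" "p (abs_proj (vup v)) = abs_proj (vup (eval_vec g v))"
      using gh Fv vn unfolding local_rep_def by metis+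
    then show ?thesis
      unfolding rational_iff by auto
  qed
  then interpret rational_parametrization F p g0 chi tau q d
    by unfold_locales (use False F in auto)
  show ?thesis
    by (rule finitely_generated)
qed

end
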